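(* Let $d\geq 3$ and $\beta>0$, and set $f_d(\beta)=(d-2)\beta^2+(2d-3)\beta$. Then there exists $\boldsymbol\alpha\in\pi_d$ such that: (i) for every $\mathbf z\in\mathbb Z^d$ which is a best approximation vector for $L_{\boldsymbol\alpha}$ we have $|L_{\boldsymbol\alpha}(\mathbf z)|\cdot|\mathbf z|^{d-1}\asymp|\mathbf z|^{-f_d(\beta)}$; (ii) for every $\mathbf z\in\mathbb Z^d$ which is not an integer multiple of a best approximation vector for $L_{\boldsymbol\alpha}$ we have $|L_{\boldsymbol\alpha}(\mathbf z)|\cdot|\mathbf z|^{d-1}\gg|\mathbf z|^{-f_d(\beta)+(d-1)\beta}$; (iii) the set of asymptotic directions for best approximation vectors for $L_{\boldsymbol\alpha}$ consists of exactly two pairs $\pm\mathbf u_1,\pm\mathbf u_2$ of points. The constants implied by $\asymp$ and $\gg$ depend only on $d$, $\beta$ and $\boldsymbol\alpha$.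
   Context: $|\cdot|$ is the Euclidean norm and $\langle\cdot,\cdot\rangle$ the standard inner product. For $\mathbf x=(x_1,\dots,x_d)\in\mathbb R^d$ write $\underline{\mathbf x}=(x_1,\dots,x_{d-1})$. Let $\pi_d=\{\mathbf x\in\mathbb R^d: x_d=1\}$ and, for $\boldsymbol\alpha=(\alpha_1,\dots,\alpha_{d-1},1)\in\pi_d$, $L_{\boldsymbol\alpha}(\mathbf x)=\langle\boldsymbol\alpha,\mathbf x\rangle=\alpha_1x_1+\dots+\alpha_{d-1}x_{d-1}+x_d$. A vector $\mathbf z\in\mathbb Z^d$ with $\underline{\mathbf z}\neq0$ is a best approximation vector for $L_{\boldsymbol\alpha}$ if $|L_{\boldsymbol\alpha}(\mathbf z)|\leq|L_{\boldsymbol\alpha}(\mathbf z')|$ for every $\mathbf z'\in\mathbb Z^d$ with $0<|\underline{\mathbf z'}|\leq|\underline{\mathbf z}|$, with strict inequality whenever $0<|\underline{\mathbf z'}|<|\underline{\mathbf z}|$. A unit vector $\mathbf u\in\mathbb R^d$ is an asymptotic direction for best approximation vectors for $L_{\boldsymbol\alpha}$ if it is an accumulation point of the set $\{\mathbf z/|\mathbf z|:\mathbf z\text{ a best approximation vector for }L_{\boldsymbol\alpha}\}$ (this set of directions is symmetric under $\mathbf u\mapsto-\mathbf u$). *)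

theory Defs
  imports Complex_Main
begin

text \<open>Vectors in R^d are represented as functions on nat supported on {0..<d};
  coordinate x_k of the paper is x (k-1).\<close>

definition zvecs :: "nat \<Rightarrow> (nat \<Rightarrow> int) set" where
  "zvecs d = {z. \<forall>i\<ge>d. z i = 0}"

definition rvecs :: "nat \<Rightarrow> (nat \<Rightarrow> real) set" where
  "rvecs d = {x. \<forall>i\<ge>d. x i = 0}"

definition pi_d :: "nat \<Rightarrow> (nat \<Rightarrow> real) set" where
  "pi_d d = {a \<in> rvecs d. a (d - 1) = 1}"

definition vnorm :: "nat \<Rightarrow> (nat \<Rightarrow> real) \<Rightarrow> real" where
  "vnorm d x = sqrt (\<Sum>i<d. (x i)\<^sup>2)"

definition unorm :: "nat \<Rightarrow> (nat \<Rightarrow> real) \<Rightarrow> real" where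
  "unorm d x = sqrt (\<Sum>i<d - 1. (x i)\<^sup>2)"

definition Lform :: "nat \<Rightarrow> (nat \<Rightarrow> real) \<Rightarrow> (nat \<Rightarrow> int) \<Rightarrow> real" where
  "Lform d a z = (\<Sum>i<d. a i * of_int (z i))"

definition rv :: "(nat \<Rightarrow> int) \<Rightarrow> (nat \<Rightarrow> real)" where
  "rv z = (\<lambda>i. of_int (z i))"

definition best_approx :: "nat \<Rightarrow> (nat \<Rightarrow> real) \<Rightarrow> (nat \<Rightarrow> int) \<Rightarrow> bool" where
  "best_approx d a z \<longleftrightarrow> z \<in> zvecs d \<and> unorm d (rv z) \<noteq> 0 \<and>
     (\<forall>z' \<in> zvecs d. 0 < unorm d (rv z') \<and> unorm d (rv z') \<le> unorm d (rv z)
         \<longrightarrow> \<bar>Lform d a z\<bar> \<le> \<bar>Lform d a z'\<bar>) \<and>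
     (\<forall>z' \<in> zvecs d. 0 < unorm d (rv z') \<and> unorm d (rv z') < unorm d (rv z)
         \<longrightarrow> \<bar>Lform d a z\<bar> < \<bar>Lform d a z'\<bar>)"

definition best_dirs :: "nat \<Rightarrow> (nat \<Rightarrow> real) \<Rightarrow> (nat \<Rightarrow> real) set" where
  "best_dirs d a = {(\<lambda>i. rv z i / vnorm d (rv z)) | z. best_approx d a z}"

definition asym_dir :: "nat \<Rightarrow> (nat \<Rightarrow> real) \<Rightarrow> (nat \<Rightarrow> real) \<Rightarrow> bool" where
  "asym_dir d a u \<longleftrightarrow> u \<in> rvecs d \<and> vnorm d u = 1 \<and>
     (\<forall>e>0. \<exists>v \<in> best_dirs d a. v \<noteq> u \<and> vnorm d (\<lambda>i. v i - u i) < e)"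

definition f_d :: "nat \<Rightarrow> real \<Rightarrow> real" where
  "f_d d \<beta> = (real d - 2) * \<beta>\<^sup>2 + (2 * real d - 3) * \<beta>"

end

theory Submission
  imports Defs "HOL-Analysis.L2_Norm"
begin

text \<open>
  Write \<open>d = n + 3\<close>. An inductively built sequence of bases of \<open>\<int>\<^sup>d\<close> has the shape
  \<open>z\<^sub>k, y\<^sub>n, \<dots>, y\<^sub>1, z\<^bsub>k+1\<^esub>, z\<^bsub>k+2\<^esub>\<close>, where \<open>z\<^sub>k\<close> has length comparable to \<open>S\<^sub>k\<close> with
  \<open>S\<^bsub>k+1\<^esub>\<close> comparable to \<open>S\<^sub>k\<^bsup>1+\<beta>\<^esup>\<close>, and all \<open>y\<^sub>i\<close> have length comparable to \<open>S\<^bsub>k+2\<^esub>\<close>.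
  The next basis arises from \<open>z\<^bsub>k+3\<^esub> = N N' z\<^bsub>k+1\<^esub> - y\<^sub>1\<close> and \<open>y\<^sub>i' = N y\<^sub>i - y\<^bsub>i+1\<^esub>\<close> (with
  \<open>y\<^bsub>n+1\<^esub> = z\<^sub>k\<close>), where \<open>N = S\<^bsub>k+3\<^esub> / S\<^bsub>k+2\<^esub>\<close> and \<open>N' = S\<^bsub>k+2\<^esub> / S\<^bsub>k+1\<^esub>\<close>. This step is
  unimodular, and since \<open>N\<close> is large it hardly changes directions, so the vectors \<open>z\<^sub>k\<close>
  approach two directions, according to the parity of \<open>k\<close>, and all but the first vector of each
  basis, scaled to unit length, stay uniformly independent.

  A form \<open>L\<close> whose values decrease along each of these bases exists by compactness, because the
  inverse step preserves decreasing sequences. The recursion then forces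
  \<open>L(z\<^sub>k)\<close> to be comparable to \<open>1 / (S\<^bsub>k+1\<^esub> S\<^bsub>k+2\<^esub>\<^bsup>n+1\<^esup>)\<close>, and expanding an arbitrary integer vector
  in the basis matching its length shows that it is a multiple of some \<open>z\<^sub>k\<close> or has a large value
  of \<open>L\<close>. Hence, up to finitely many exceptions, the best approximation vectors are
  exactly \<open>\<plusminus>z\<^sub>k\<close>.
\<close>

section \<open>Growth sequences and compactness\<close>

text \<open>Let \<open>q k\<close> be \<open>S k powr \<beta>\<close> rounded up; as this power is
  at least 1, rounding costs at most a factor 2. If the start is so large that every
  \<open>q k\<close> is at least \<open>4 powr (1 / \<beta>)\<close>, doubling follows:
  \<open>q (Suc k)\<close> is at least \<open>q k powr \<beta> * S k powr \<beta>\<close>, hence at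
  least \<open>4 * S k powr \<beta>\<close>, hence at least \<open>2 * q k\<close>.\<close>

lemma growth_sequence_exists:
  fixes \<beta> :: real and A :: nat
  assumes "\<beta> > 0"
  obtains S q :: "nat \<Rightarrow> nat" where
    "\<And>k. S (Suc k) = q k * S k" "\<And>k. 0 < S k" "A \<le> q 0" "\<And>k. 2 * q k \<le> q (Suc k)"
    "\<And>k. real (S k) powr (1 + \<beta>) \<le> real (S (Suc k))"
    "\<And>k. real (S (Suc k)) \<le> 2 * real (S k) powr (1 + \<beta>)"
proof -
  \<comment> \<open>\<open>B\<close> is the lower bound wanted for all \<open>q k\<close>: it covers
    \<open>A\<close> and satisfies \<open>B powr \<beta> >= 4\<close>. The starting value
    \<open>s\<close> is then chosen so that \<open>s powr \<beta> >= B\<close>.\<close>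
  define B where "B = max A (nat \<lceil>4 powr (1 / \<beta>)\<rceil>)"
  have B4: "4 powr (1 / \<beta>) \<le> real B" and AB: "A \<le> B"
    unfolding B_def by linarith+
  define s where "s = max 1 (nat \<lceil>real B powr (1 / \<beta>)\<rceil>)"
  have s1: "1 \<le> s" and sB: "real B powr (1 / \<beta>) \<le> real s"
    unfolding s_def by linarith+
  define g where "g = (\<lambda>m::nat. nat \<lceil>real m powr \<beta>\<rceil>)"
  define S where "S = rec_nat s (\<lambda>_ m. g m * m)"
  define q where "q = (\<lambda>k. g (S k))"
  have SSuc: "S (Suc k) = q k * S k" for k by (simp add: S_def q_def)
  have g_ge: "real m powr \<beta> \<le> real (g m)" for m unfolding g_def by linarith
  have powr_ge1: "1 \<le> real m powr \<beta>" if "1 \<le> m" for m :: nat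
    using that assms by (simp add: ge_one_powr_ge_zero)
  have g_le: "real (g m) \<le> 2 * real m powr \<beta>" if "1 \<le> m" for m
    using powr_ge1[OF that] unfolding g_def by linarith
  have S_ge: "s \<le> S k" for k
  proof (induction k)
    case 0
    then show ?case by (simp add: S_def)
  next
    case (Suc k)
    have "1 \<le> q k"
      using g_ge[of "S k"] powr_ge1[of "S k"] Suc s1 unfolding q_def by simp
    with Suc show ?case unfolding SSuc by (metis mult_le_mono mult_1)
  qed
  have S1: "1 \<le> S k" for k using S_ge[of k] s1 by linarith
  have qB: "B \<le> q k" for k
  proof -
    have "real B = (real B powr (1 / \<beta>)) powr \<beta>"
      using assms by (simp add: powr_powr)
    also have "\<dots> \<le> real (S k) powr \<beta>"
      using sB S_ge[of k] assms by (intro powr_mono2) auto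
    also have "\<dots> \<le> real (q k)" using g_ge by (simp add: q_def)
    finally show ?thesis by simp
  qed
  have qb4: "4 \<le> real (q k) powr \<beta>" for k
  proof -
    have "4 = (4 powr (1 / \<beta>)) powr \<beta>" using assms by (simp add: powr_powr)
    also have "\<dots> \<le> real (q k) powr \<beta>"
      using B4 qB[of k] assms by (intro powr_mono2) auto
    finally show ?thesis .
  qed
  have dbl: "2 * q k \<le> q (Suc k)" for k
  proof -
    have h: "real (q k) \<le> 2 * real (S k) powr \<beta>" using g_le[OF S1] by (simp add: q_def)
    have "2 * real (q k) \<le> 4 * real (S k) powr \<beta>" using h by simp
    also have "\<dots> \<le> real (q k) powr \<beta> * real (S k) powr \<beta>"
      using qb4[of k] by (intro mult_right_mono) auto
    also have "\<dots> = real (S (Suc k)) powr \<beta>" by (simp add: SSuc powr_mult)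
    also have "\<dots> \<le> real (q (Suc k))" using g_ge by (simp add: q_def)
    finally show ?thesis by linarith
  qed
  have e: "real (S k) powr (1 + \<beta>) = real (S k) powr \<beta> * real (S k)" for k
    using S1[of k] by (simp add: powr_add)
  have up: "real (S k) powr (1 + \<beta>) \<le> real (S (Suc k))" for k
    unfolding e SSuc of_nat_mult using g_ge by (intro mult_right_mono) (auto simp: q_def)
  have lo: "real (S (Suc k)) \<le> 2 * real (S k) powr (1 + \<beta>)" for k
  proof -
    have "real (q k) * real (S k) \<le> (2 * real (S k) powr \<beta>) * real (S k)"
      using g_le[OF S1] by (intro mult_right_mono) (auto simp: q_def)
    then show ?thesis unfolding e SSuc of_nat_mult by (simp add: mult.assoc)
  qed
  have "A \<le> q 0" using AB qB[of 0] by linarith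
  have pos: "0 < S k" for k using S1[of k] by simp
  show ?thesis using that[of S q, OF SSuc pos \<open>A \<le> q 0\<close> dbl up lo] .
qed

text \<open>Bolzano-Weierstrass one coordinate at a time: a further monotone subsequence for the new
  coordinate keeps the limits already secured.\<close>

lemma bounded_finite_coordinates_convergent_subseq:
  fixes f :: "nat \<Rightarrow> nat \<Rightarrow> real"
  assumes "\<And>m i. i < D \<Longrightarrow> \<bar>f m i\<bar> \<le> B"
  shows "\<exists>r :: nat \<Rightarrow> nat. strict_mono r \<and> (\<forall>i<D. convergent (\<lambda>m. f (r m) i))"
  using assms
proof (induction D)
  case 0
  have "strict_mono (\<lambda>x::nat. x)" by (simp add: strict_mono_def)
  then show ?case by blast
next
  case (Suc D)
  then obtain r where r: "strict_mono r" "\<forall>i<D. convergent (\<lambda>m. f (r m) i)"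
    by (meson less_Suc_eq)
  obtain s where s: "strict_mono s" "monoseq (\<lambda>m. f (r (s m)) D)"
    using seq_monosub[of "\<lambda>m. f (r m) D"] by (auto simp: o_def)
  have "Bseq (\<lambda>m. f (r (s m)) D)"
    using Suc.prems[of D] by (intro BseqI'[of _ B]) auto
  then have "convergent (\<lambda>m. f (r (s m)) D)"
    using s(2) Bseq_monoseq_convergent by blast
  moreover have "convergent (\<lambda>m. f (r (s m)) i)" if "i < D" for i
    using r(2) that convergent_subseq_convergent[of "\<lambda>m. f (r m) i" s] s(1)
    by (auto simp: o_def)
  moreover have "strict_mono (\<lambda>m. r (s m))"
    using r(1) s(1) by (simp add: strict_mono_def)
  ultimately show ?case
    by (intro exI[of _ "\<lambda>m. r (s m)"]) (auto simp: less_Suc_eq)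
qed

section \<open>The cascade of bases\<close>

text \<open>All error estimates rest on a small sum of the \<open>1 / q (l + 2)\<close>. Doubling
  bounds it by \<open>1 / (2 * q 0)\<close>; in the bound on \<open>q 0\<close> the 8 keeps
  directions within \<open>1 / 8\<close>, and the \<open>n\<close> absorbs the relative error
  \<open>(n + 1) / q (k + 2)\<close> that each stage causes in the values of the form.\<close>

locale cascade =
  fixes n :: nat and S q :: "nat \<Rightarrow> nat"
  assumes S_Suc: "S (Suc k) = q k * S k"
    and S_pos: "0 < S k"
    and q0: "n + 8 \<le> q 0"
    and q_double: "2 * q k \<le> q (Suc k)"
begin

section \<open>Growth of the quotients\<close>

lemma q_mono: "k \<le> l \<Longrightarrow> q k \<le> q l"
proof (induction rule: dec_induct)
  case (step l)
  then show ?case using q_double[of l] by linarith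
qed simp

lemma q_ge: "n + 8 \<le> q k"
  using q_mono[of 0 k] q0 by linarith

lemma q_ge_real: "8 \<le> real (q k)"
  using q_ge[of k] by linarith

lemma q_at_top: "filterlim (\<lambda>k. real (q k)) at_top sequentially"
proof -
  have "real k \<le> real (q k)" for k
  proof (induction k)
    case (Suc k)
    then show ?case using q_double[of k] q_ge[of k] by linarith
  qed simp
  then show ?thesis
    using filterlim_at_top_mono[OF filterlim_real_sequentially] by simp
qed

text \<open>Doubling gives \<open>1 / q (k + 2) <= 2 / q (k + 2) - 2 / q (k + 3)\<close>; the sum
  telescopes to at most \<open>2 / q 2\<close>, and \<open>q 2\<close> is at least
  \<open>4 * q 0\<close>.\<close>

lemma sum_inverse_q: "(\<Sum>l<k. 1 / real (q (l + 2))) \<le> 1 / (2 * real (q 0))"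
proof -
  have "(\<Sum>l<k. 1 / real (q (l + 2))) \<le> 2 / real (q 2) - 2 / real (q (k + 2))"
  proof (induction k)
    case (Suc k)
    have p: "0 < real (q (k + 2))" "0 < real (q (k + 3))"
      using q_ge_real[of "k + 2"] q_ge_real[of "k + 3"] by linarith+
    have "2 * real (q (k + 2)) \<le> real (q (k + 3))"
      using q_double[of "k + 2"] by (simp add: eval_nat_numeral)
    then have "2 / real (q (k + 3)) \<le> 1 / real (q (k + 2))"
      using p by (simp add: field_simps)
    then have "1 / real (q (k + 2)) \<le> 2 / real (q (k + 2)) - 2 / real (q (k + 3))"
      by linarith
    with Suc show ?case by (simp add: add.commute numeral_3_eq_3 numeral_2_eq_2)
  qed (simp add: numeral_2_eq_2)
  also have "\<dots> \<le> 2 / real (q 2)" by simp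
  also have "\<dots> \<le> 2 / (4 * real (q 0))"
  proof (intro divide_left_mono)
    show "4 * real (q 0) \<le> real (q 2)"
      using q_double[of 0] q_double[of 1] by (simp add: numeral_2_eq_2)
    show "0 < real (q 2) * (4 * real (q 0))"
      using q_ge_real[of 0] q_ge_real[of 2] by (intro mult_pos_pos) linarith+
  qed simp
  finally show ?thesis by simp
qed

text \<open>In the orbit of a basis under \<open>step\<close> the indices 0, 1, ..., n, n + 1, n + 2 at stage k stand for
  \<open>z\<^sub>k, y\<^sub>n, \<dots>, y\<^sub>1, z\<^bsub>k+1\<^esub>, z\<^bsub>k+2\<^esub>\<close>.\<close>

definition step :: "nat \<Rightarrow> (nat \<Rightarrow> 'a::comm_ring_1) \<Rightarrow> nat \<Rightarrow> 'a" where
  "step k x i =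
    (if i = 0 then x (n + 1)
     else if i \<le> n then of_nat (q (k + 2)) * x i - x (i - 1)
     else if i = n + 1 then x (n + 2)
     else of_nat (q (k + 2) * q (k + 1)) * x (n + 1) - x n)"

text \<open>The ring is left open so that the same recursion acts on the integer coordinates of the
  basis vectors and on the real values of a form at them.\<close>

primrec orb :: "(nat \<Rightarrow> 'a::comm_ring_1) \<Rightarrow> nat \<Rightarrow> nat \<Rightarrow> 'a" where
  "orb x 0 = x"
| "orb x (Suc k) = step k (orb x k)"

text \<open>Since \<open>step\<close> is linear, the values of a form along the moving basis are the
  orbit of its initial values; this is used in \<open>Lform_C\<close>.\<close>

lemma orb_sum:
  "orb (\<lambda>i. \<Sum>t\<in>T. a t * f t i) k i = (\<Sum>t\<in>T. a t * orb (f t) k i)"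
proof (induction k arbitrary: i)
  case (Suc k)
  show ?case
    by (simp add: step_def Suc sum_distrib_left right_diff_distrib
        sum_subtractf mult.left_commute)
qed simp

lemma orb_of_int: "orb (\<lambda>i. of_int (x i)) k i = of_int (orb x k i)"
  by (induction k arbitrary: i) (simp_all add: step_def)

lemma orb_cong: "(\<And>i. i \<le> n + 2 \<Longrightarrow> x i = y i) \<Longrightarrow> i \<le> n + 2 \<Longrightarrow> orb x k i = orb y k i"
  by (induction k arbitrary: i) (simp_all add: step_def)

text \<open>Weak inequalities make the condition closed, so that it survives the limit in
  \<open>chain_orbit_exists\<close>; strict positivity is recovered later, in
  \<open>lam_pos\<close>.\<close>

definition chain :: "(nat \<Rightarrow> real) \<Rightarrow> bool" where
  "chain x \<longleftrightarrow> (\<forall>i\<le>n + 1. x (Suc i) \<le> x i) \<and> 0 \<le> x (n + 2)"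

lemma chain_antimono:
  assumes "chain x" "i \<le> j" "j \<le> n + 2"
  shows "x j \<le> x i"
  using assms(2,3)
proof (induction rule: dec_induct)
  case (step l)
  then show ?case using assms(1) unfolding chain_def by force
qed simp

lemma chain_nonneg: "chain x \<Longrightarrow> i \<le> n + 2 \<Longrightarrow> 0 \<le> x i"
  using chain_antimono[of x i "n + 2"] by (auto simp: chain_def)

text \<open>The equations of \<open>step\<close> can be solved for \<open>x\<close>: two entries are
  read off from \<open>y\<close>, and those from index \<open>n\<close> down to 0 follow one after
  the other. All factors are at least 8, so the entries grow as the index falls and form a chain
  again.\<close>

lemma chain_step_inverse:
  assumes "chain y"
  obtains x where "chain x" "\<And>i. i \<le> n + 2 \<Longrightarrow> step k x i = y i" "y 0 \<le> x 0"
proof -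
  define N where "N = real (q (k + 2))"
  define M where "M = real (q (k + 2) * q (k + 1))"
  have N8: "8 \<le> N" using q_ge_real by (simp add: N_def)
  have M8: "8 \<le> M"
  proof -
    have "8 * 1 \<le> real (q (k + 2)) * real (q (k + 1))"
      using q_ge_real[of "k + 2"] q_ge_real[of "k + 1"] by (intro mult_mono) linarith+
    then show ?thesis by (simp add: M_def)
  qed
  \<comment> \<open>\<open>g j\<close> is the future \<open>x (n - j)\<close>.\<close>
  define g where "g = rec_nat (M * y 0 - y (n + 2)) (\<lambda>j r. N * r - y (n - j))"
  have g0: "g 0 = M * y 0 - y (n + 2)" and gS: "g (Suc j) = N * g j - y (n - j)" for j
    by (simp_all add: g_def)
  have y_le: "y i \<le> y 0" if "i \<le> n + 2" for i using chain_antimono[OF assms] that by simp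
  have y0: "0 \<le> y 0" using chain_nonneg[OF assms] by simp
  have g_ge: "y 0 \<le> g j" for j
  proof (induction j)
    case 0
    have "8 * y 0 \<le> M * y 0" using M8 y0 by (intro mult_right_mono)
    then show ?case using y_le[of "n + 2"] y0 unfolding g0 by simp
  next
    case (Suc j)
    have "8 * g j \<le> N * g j" using N8 Suc y0 by (intro mult_right_mono) auto
    moreover have "y (n - j) \<le> y 0" using y_le by simp
    ultimately show ?case using y0 Suc unfolding gS by linarith
  qed
  have g_mono: "g j \<le> g (Suc j)" for j
  proof -
    have "8 * g j \<le> N * g j" using N8 g_ge[of j] y0 by (intro mult_right_mono) auto
    moreover have "y (n - j) \<le> y 0" using y_le by simp
    ultimately show ?thesis using y0 g_ge[of j] unfolding gS by linarith
  qed
  define x where "x = (\<lambda>i. if i \<le> n then g (n - i) else if i = n + 1 then y 0 else y (n + 1))"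
  have "chain x"
    unfolding chain_def
  proof (intro conjI allI impI)
    fix i assume "i \<le> n + 1"
    then consider "i < n" | "i = n" | "i = n + 1" by linarith
    then show "x (Suc i) \<le> x i"
    proof cases
      case 1
      then have "n - i = Suc (n - Suc i)" by simp
      with 1 show ?thesis using g_mono[of "n - Suc i"] by (simp add: x_def)
    next
      case 2
      then show ?thesis using g_ge by (simp add: x_def)
    next
      case 3
      then show ?thesis using y_le[of "n + 1"] by (simp add: x_def)
    qed
  qed (use chain_nonneg[OF assms, of "n + 1"] in \<open>simp add: x_def\<close>)
  moreover have "step k x i = y i" if i: "i \<le> n + 2" for i
  proof -
    consider "i = 0" | "1 \<le> i" "i \<le> n" | "i = n + 1" | "i = n + 2"
      using i by force
    then show ?thesis
    proof cases
      case 2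
      then have "n - (i - 1) = Suc (n - i)" by simp
      moreover have "i - 1 \<le> n" using 2 by simp
      ultimately have "x (i - 1) = N * x i - y i" using 2 by (simp add: x_def gS)
      then show ?thesis using 2 by (simp add: step_def N_def)
    qed (simp_all add: step_def x_def g0 M_def)
  qed
  moreover have "y 0 \<le> x 0" using g_ge by (simp add: x_def)
  ultimately show ?thesis using that by blast
qed

text \<open>Pulling \<open>y\<close> back through \<open>m\<close> stages by
  \<open>chain_step_inverse\<close>. The bound on \<open>x 0\<close> guarantees that the result can
  be normalised.\<close>

lemma chain_orbit_prefix:
  assumes "chain y"
  shows "\<exists>x. (\<forall>k\<le>m. chain (orb x k)) \<and> (\<forall>i\<le>n + 2. orb x m i = y i) \<and> y 0 \<le> x 0"
  using assms
proof (induction m arbitrary: y)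
  case 0
  then show ?case by (intro exI[of _ y]) auto
next
  case (Suc m)
  obtain x' where x': "chain x'" "\<And>i. i \<le> n + 2 \<Longrightarrow> step m x' i = y i" "y 0 \<le> x' 0"
    using chain_step_inverse[OF Suc.prems] by blast
  obtain x where x: "\<forall>k\<le>m. chain (orb x k)" "\<forall>i\<le>n + 2. orb x m i = x' i" "x' 0 \<le> x 0"
    using Suc.IH[OF x'(1)] by blast
  have e: "orb x (Suc m) i = y i" if "i \<le> n + 2" for i
    using x(2) x'(2)[OF that] that by (simp add: step_def split: if_splits)
  then have "chain (orb x (Suc m))" using Suc.prems by (simp add: chain_def)
  then show ?case using e x x'(3) by (intro exI[of _ x]) (auto simp: le_Suc_eq)
qed

lemma orb_scale: "orb (\<lambda>i. c * x i) k i = c * orb x k i"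
  using orb_sum[of "\<lambda>_. c" "\<lambda>_. x" "{0::nat}"] by simp

lemma tendsto_orb:
  fixes x :: "nat \<Rightarrow> nat \<Rightarrow> real"
  assumes "\<And>i. i \<le> n + 2 \<Longrightarrow> (\<lambda>m. x m i) \<longlonglongrightarrow> y i" "i \<le> n + 2"
  shows "(\<lambda>m. orb (x m) k i) \<longlonglongrightarrow> orb y k i"
  using assms(2)
proof (induction k arbitrary: i)
  case 0
  then show ?case using assms(1) by simp
next
  case (Suc k)
  show ?case
    using Suc by (auto simp: step_def intro!: tendsto_intros)
qed

text \<open>The forms whose first m stages are chains form a decreasing sequence of compact sets.\<close>

lemma chain_orbit_exists: "\<exists>x. x 0 = 1 \<and> (\<forall>k. chain (orb x k))"
proof -
  define e where "e = (\<lambda>i::nat. if i = 0 then 1 else 0 :: real)"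
  have "chain e" by (simp add: chain_def e_def)
  have "\<exists>x. x 0 = 1 \<and> (\<forall>k\<le>m. chain (orb x k))" for m
  proof -
    obtain x where x: "\<forall>k\<le>m. chain (orb x k)" "1 \<le> x 0"
      using chain_orbit_prefix[OF \<open>chain e\<close>, of m] by (auto simp: e_def)
    \<comment> \<open>Division by \<open>x 0\<close> keeps all chains and puts the initial entries
      into the interval from 0 to 1, which supplies the compactness.\<close>
    let ?x = "\<lambda>i. (1 / x 0) * x i"
    have "chain (orb ?x k)" if "k \<le> m" for k
      using x that unfolding chain_def orb_scale
      by (auto intro!: mult_left_mono divide_right_mono)
    then show ?thesis using x(2) by (intro exI[of _ ?x]) auto
  qed
  then obtain X where X: "\<And>m. X m 0 = 1" "\<And>m k. k \<le> m \<Longrightarrow> chain (orb (X m) k)"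
    by metis
  have bd: "\<bar>X m i\<bar> \<le> 1" if "i < n + 3" for m i
  proof -
    have c: "chain (X m)" using X(2)[of 0 m] by simp
    show ?thesis
      using chain_nonneg[OF c, of i] chain_antimono[OF c, of 0 i] X(1)[of m] that by simp
  qed
  obtain r where r: "strict_mono r" "\<forall>i<n + 3. convergent (\<lambda>m. X (r m) i)"
    using bounded_finite_coordinates_convergent_subseq[of "n + 3" X, OF bd] by blast
  define x where "x = (\<lambda>i. lim (\<lambda>m. X (r m) i))"
  have lim: "(\<lambda>m. X (r m) i) \<longlonglongrightarrow> x i" if "i \<le> n + 2" for i
    using r(2) that unfolding x_def by (simp add: convergent_LIMSEQ_iff)
  have x0: "x 0 = 1"
    using lim[of 0] X(1) by (simp add: LIMSEQ_const_iff)
  have "chain (orb x k)" for k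
  proof -
    \<comment> \<open>As \<open>r m >= m\<close>, stage \<open>k\<close> is a chain for all
      \<open>m >= k\<close>, which is enough for the limit.\<close>
    have ev: "chain (orb (X (r m)) k)" if "k \<le> m" for m
      using X(2) that seq_suble[OF r(1), of m] le_trans by blast
    have "orb x k (Suc i) \<le> orb x k i" if "i \<le> n + 1" for i
      using that ev tendsto_orb[of "\<lambda>m. X (r m)" x, OF lim]
      by (intro LIMSEQ_le[of "\<lambda>m. orb (X (r m)) k (Suc i)" _ "\<lambda>m. orb (X (r m)) k i"])
        (auto simp: chain_def)
    moreover have "0 \<le> orb x k (n + 2)"
      using ev tendsto_orb[of "\<lambda>m. X (r m)" x, OF lim]
      by (intro LIMSEQ_le_const[of "\<lambda>m. orb (X (r m)) k (n + 2)"]) (auto simp: chain_def)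
    ultimately show ?thesis by (simp add: chain_def)
  qed
  with x0 show ?thesis by blast
qed

text \<open>Keeps sums over index sets ending in n + 2 from being unrolled.\<close>

declare add_2_eq_Suc' [simp del]

text \<open>The multiple \<open>q 1\<close> in the last initial vector makes the directions of consecutive
  vectors \<open>C k 0\<close> and \<open>C (k + 1) 0\<close> enclose an obtuse angle; otherwise their difference could be
  a best approximation vector violating (i).\<close>

definition C0 :: "nat \<Rightarrow> nat \<Rightarrow> int" where
  "C0 i t =
    (if i = 0 then (if t = n + 2 then 1 else 0)
     else if i \<le> n + 1 then (if t = i - 1 then 1 else 0)
     else if t = n + 1 then 1 else if t = n then - int (q 1) else 0)"

definition C :: "nat \<Rightarrow> nat \<Rightarrow> nat \<Rightarrow> int" where
  "C k i = (\<lambda>t. orb (\<lambda>i. C0 i t) k i)"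

lemma C_0: "C 0 i = C0 i"
  by (simp add: C_def)

lemma C_Suc: "C (Suc k) i t = step k (\<lambda>i. C k i t) i"
  by (simp add: C_def)

lemma C_Suc_simps:
  "C (Suc k) 0 = C k (n + 1)"
  "1 \<le> i \<Longrightarrow> i \<le> n \<Longrightarrow> C (Suc k) i = (\<lambda>t. int (q (k + 2)) * C k i t - C k (i - 1) t)"
  "C (Suc k) (n + 1) = C k (n + 2)"
  "C (Suc k) (n + 2) = (\<lambda>t. int (q (k + 2) * q (k + 1)) * C k (n + 1) t - C k n t)"
  by (auto simp: C_Suc step_def fun_eq_iff)

lemma C_in_zvecs: "C k i \<in> zvecs (n + 3)"
proof -
  have "orb (\<lambda>i. C0 i t) k i = 0" if "n + 3 \<le> t" for t
  proof -
    have "C0 i t = 0" for i using that by (auto simp: C0_def)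
    then have "(\<lambda>i. C0 i t) = (\<lambda>i. 0 * (0::int))" by simp
    then show ?thesis using orb_scale[of "0::int" "\<lambda>_. 0" k i] by simp
  qed
  then show ?thesis by (simp add: zvecs_def C_def)
qed

section \<open>Every stage spans the integer lattice\<close>

definition stage_lattice :: "nat \<Rightarrow> (nat \<Rightarrow> int) set" where
  "stage_lattice k = {z. \<exists>c. z = (\<lambda>t. \<Sum>i\<le>n + 2. c i * C k i t)}"

lemma stage_lattice_lincomb:
  assumes "x \<in> stage_lattice k" "y \<in> stage_lattice k"
  shows "(\<lambda>t. a * x t + b * y t) \<in> stage_lattice k"
proof -
  obtain c c' where "x = (\<lambda>t. \<Sum>i\<le>n + 2. c i * C k i t)" "y = (\<lambda>t. \<Sum>i\<le>n + 2. c' i * C k i t)"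
    using assms by (auto simp: stage_lattice_def)
  then have "(\<lambda>t. a * x t + b * y t) = (\<lambda>t. \<Sum>i\<le>n + 2. (a * c i + b * c' i) * C k i t)"
    by (simp add: sum_distrib_left sum.distrib distrib_right mult.assoc)
  then show ?thesis by (auto simp: stage_lattice_def)
qed

lemma stage_lattice_basis: "i \<le> n + 2 \<Longrightarrow> C k i \<in> stage_lattice k"
  unfolding stage_lattice_def
  by (auto intro!: exI[of _ "\<lambda>j. if j = i then 1 else 0"] simp: if_distrib if_distribR cong: if_cong)

lemma stage_lattice_sum:
  assumes "finite I" "\<And>i. i \<in> I \<Longrightarrow> f i \<in> stage_lattice k"
  shows "(\<lambda>t. \<Sum>i\<in>I. c i * f i t) \<in> stage_lattice k"
  using assms
proof (induction I rule: finite_induct)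
  case empty
  show ?case using stage_lattice_lincomb[of "C k 0" k "C k 0" 0 0] stage_lattice_basis[of 0] by simp
next
  case (insert i I)
  then show ?case
    using stage_lattice_lincomb[of "f i" k "\<lambda>t. \<Sum>i\<in>I. c i * f i t" "c i" 1] by simp
qed

text \<open>\<open>step\<close> is unimodular: its equations, solved for the old vectors, have
  integer coefficients. The solution starts at index \<open>n\<close>, obtained from the last new
  vector, and descends to 0.\<close>

lemma previous_basis_in_stage_lattice:
  assumes "i \<le> n + 2"
  shows "C k i \<in> stage_lattice (Suc k)"
proof -
  have high: "C k (n + 1) \<in> stage_lattice (Suc k)" "C k (n + 2) \<in> stage_lattice (Suc k)"
    using stage_lattice_basis[of 0 "Suc k"] stage_lattice_basis[of "n + 1" "Suc k"]
    unfolding C_Suc_simps by auto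
  have "C k (n - j) \<in> stage_lattice (Suc k)" if "j \<le> n" for j
    using that
  proof (induction j)
    case 0
    have "C k n = (\<lambda>t. int (q (k + 2) * q (k + 1)) * C k (n + 1) t + (-1) * C (Suc k) (n + 2) t)"
      by (simp add: C_Suc_simps(4) del: One_nat_def)
    also have "\<dots> \<in> stage_lattice (Suc k)"
      using high stage_lattice_basis[of "n + 2" "Suc k"] by (intro stage_lattice_lincomb) auto
    finally show ?case by simp
  next
    case (Suc j)
    then have e: "n - Suc j = (n - j) - 1" by simp
    have "C k (n - Suc j) = (\<lambda>t. int (q (k + 2)) * C k (n - j) t + (-1) * C (Suc k) (n - j) t)"
      unfolding e using Suc by (subst C_Suc_simps(2)) auto
    also have "\<dots> \<in> stage_lattice (Suc k)"
      using Suc stage_lattice_basis[of "n - j" "Suc k"] by (intro stage_lattice_lincomb) auto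
    finally show ?case .
  qed
  from this[of "n - i"] high show ?thesis
    using assms by (cases "i \<le> n"; cases "i = n + 1"; cases "i = n + 2") auto
qed

lemma zvecs_subset_stage_lattice:
  assumes "z \<in> zvecs (n + 3)"
  shows "z \<in> stage_lattice k"
proof (induction k)
  case 0
  \<comment> \<open>The initial vectors are unit vectors except the last one, whose extra entry
    \<open>- int (q 1)\<close> is compensated in the coefficient at \<open>n + 1\<close>.\<close>
  define c where "c = (\<lambda>i. if i = 0 then z (n + 2) else if i \<le> n then z (i - 1)
    else if i = n + 1 then z n + int (q 1) * z (n + 1) else z (n + 1))"
  have "z t = (\<Sum>i\<le>n + 2. c i * C 0 i t)" for t
  proof -
    have "(\<Sum>i\<le>n + 2. c i * C 0 i t) = z (n + 2) * C0 0 t + (\<Sum>i<n. z i * C0 (Suc i) t)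
      + (z n + int (q 1) * z (n + 1)) * C0 (n + 1) t + z (n + 1) * C0 (n + 2) t"
      by (simp add: c_def C_0 sum.atMost_shift add_2_eq_Suc')
    moreover have "(\<Sum>i<n. z i * C0 (Suc i) t) = (if t < n then z t else 0)"
    proof -
      have "(\<Sum>i<n. z i * C0 (Suc i) t) = (\<Sum>i<n. if t = i then z i else 0)"
        by (intro sum.cong) (auto simp: C0_def)
      then show ?thesis by simp
    qed
    moreover have "z t = 0" if "\<not> t \<le> n + 2" using assms that by (simp add: zvecs_def)
    moreover consider "t < n" | "t = n" | "t = n + 1" | "t = n + 2" | "\<not> t \<le> n + 2" by force
    ultimately show ?thesis
      by cases (simp_all add: C0_def)
  qed
  then show ?case unfolding stage_lattice_def by blast
next
  case (Suc k)
  then obtain c where "z = (\<lambda>t. \<Sum>i\<le>n + 2. c i * C k i t)"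
    by (auto simp: stage_lattice_def)
  then show ?case
    using stage_lattice_sum[of "{..n + 2}" "C k" "Suc k" c] previous_basis_in_stage_lattice by simp
qed

lemma Lform_C: "Lform (n + 3) a (C k i) = orb (\<lambda>i. Lform (n + 3) a (C0 i)) k i"
  unfolding Lform_def orb_sum C_def orb_of_int ..

lemma chain_form_exists:
  "\<exists>a\<in>pi_d (n + 3). \<forall>k. chain (\<lambda>i. Lform (n + 3) a (C k i))"
proof -
  obtain x where x: "x 0 = 1" "\<And>k. chain (orb x k)" using chain_orbit_exists by blast
  \<comment> \<open>The coefficients are chosen so that the form takes the value \<open>x i\<close>
    at \<open>C0 i\<close>; the normalisation \<open>x 0 = 1\<close> is exactly what puts
    \<open>a\<close> into \<open>pi_d\<close>.\<close>
  define a where "a = (\<lambda>t. if t = n + 2 then 1 else if t \<le> n then x (t + 1)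
    else if t = n + 1 then x (n + 2) + real (q 1) * x (n + 1) else 0)"
  have L: "Lform (n + 3) a (C0 i) = x i" if i: "i \<le> n + 2" for i
  proof -
    have split: "Lform (n + 3) a (C0 i) = (\<Sum>t<n. a t * of_int (C0 i t)) + a n * of_int (C0 i n)
        + a (n + 1) * of_int (C0 i (n + 1)) + a (n + 2) * of_int (C0 i (n + 2))"
      by (simp add: Lform_def numeral_3_eq_3 add_2_eq_Suc')
    have "(\<Sum>t<n. a t * of_int (C0 i t)) = (\<Sum>t<n. if t = i - 1 \<and> 1 \<le> i \<and> i \<le> n then a t else 0)"
      by (intro sum.cong) (auto simp: C0_def)
    also have "\<dots> = (if 1 \<le> i \<and> i \<le> n then a (i - 1) else 0)"
      by (cases "1 \<le> i \<and> i \<le> n") (auto simp: sum.delta)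
    finally have sum: "(\<Sum>t<n. a t * of_int (C0 i t)) = (if 1 \<le> i \<and> i \<le> n then a (i - 1) else 0)" .
    consider "i = 0" | "1 \<le> i" "i \<le> n" | "i = n + 1" | "i = n + 2" using i by force
    then show ?thesis
      unfolding split sum by cases (use x(1) in \<open>auto simp: C0_def a_def\<close>)
  qed
  have "chain (\<lambda>i. Lform (n + 3) a (C k i))" for k
  proof -
    have "Lform (n + 3) a (C k i) = orb x k i" if "i \<le> n + 2" for i
      using orb_cong[of "\<lambda>i. Lform (n + 3) a (C0 i)" x i k, OF L that] by (simp add: Lform_C)
    then show ?thesis using x(2)[of k] by (simp add: chain_def)
  qed
  moreover have "a \<in> pi_d (n + 3)" by (auto simp: a_def pi_d_def rvecs_def)
  ultimately show ?thesis by blast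
qed

section \<open>Geometry of the bases\<close>

text \<open>Coordinates with respect to the initial vectors 1, ..., n + 2 (the last component is ignored),
  scaled so that the initial vectors have their intended lengths.\<close>

definition U :: "(nat \<Rightarrow> real) \<Rightarrow> nat \<Rightarrow> real" where
  "U x j =
    (if j \<le> n then real (S 2) * x (j - 1)
     else if j = n + 1 then real (S 1) * (x n + real (q 1) * x (n + 1))
     else real (S 2) * x (n + 1))"

text \<open>As \<open>U\<close> ignores the last component, this is a norm on the first
  \<open>n + 2\<close> components only, to be compared with \<open>unorm\<close>.\<close>

definition nrm :: "(nat \<Rightarrow> real) \<Rightarrow> real" where
  "nrm x = (\<Sum>j=1..n + 2. \<bar>U x j\<bar>)"

text \<open>The intended length of \<open>C k i\<close>.\<close>

definition scale :: "nat \<Rightarrow> nat \<Rightarrow> real" where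
  "scale k i = (if i = 0 then real (S k) else if i = n + 1 then real (S (k + 1)) else real (S (k + 2)))"

text \<open>The two long-term directions of the vectors \<open>z\<^sub>k\<close> change places at each stage.\<close>

definition perm :: "nat \<Rightarrow> nat \<Rightarrow> nat" where
  "perm k i = (if i \<le> n \<or> even k then i else 2 * n + 3 - i)"

text \<open>Ideally \<open>C k i\<close> with \<open>i >= 1\<close> would have a single nonzero
  coordinate, of size \<open>scale k i\<close> at position \<open>perm k i\<close>; this is the
  error in coordinate \<open>j\<close>.\<close>

definition dev :: "nat \<Rightarrow> nat \<Rightarrow> nat \<Rightarrow> real" where
  "dev k i j = U (rv (C k i)) j - scale k i * (if j = perm k i then 1 else 0)"

text \<open>Accumulated relative error. Stage \<open>l\<close> contributes
  \<open>2 / q (l + 2)\<close>, a bound for the subtracted vector in \<open>step\<close> relative to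
  the new length \<open>S (l + 3)\<close>.\<close>

definition delta :: "nat \<Rightarrow> real" where
  "delta k = (\<Sum>l<k. 2 / real (q (l + 2)))"

lemma scale_pos: "0 < scale k i"
  by (simp add: scale_def S_pos)

lemma S_Suc_real: "real (S (Suc k)) = real (q k) * real (S k)"
  by (simp add: S_Suc)

lemma S_shift:
  "real (S (k + 3)) = real (q (k + 2)) * real (S (k + 2))"
  "real (S (k + 3)) = real (q (k + 2) * q (k + 1)) * real (S (k + 1))"
  by (simp_all add: S_Suc_real numeral_3_eq_3 add_2_eq_Suc')

lemma S_mono: "k \<le> l \<Longrightarrow> S k \<le> S l"
proof (induction rule: dec_induct)
  case (step l)
  have "1 * S l \<le> q l * S l" using q_ge[of l] by (intro mult_right_mono) auto
  then show ?case using step by (metis S_Suc le_trans mult_1)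
qed simp

lemma delta_le: "delta k \<le> 1 / 8"
proof -
  have "delta k = 2 * (\<Sum>l<k. 1 / real (q (l + 2)))"
    by (simp add: delta_def sum_distrib_left)
  also have "\<dots> \<le> 2 * (1 / (2 * real (q 0)))" using sum_inverse_q by (intro mult_left_mono) auto
  also have "\<dots> = 1 / real (q 0)" by simp
  also have "\<dots> \<le> 1 / 8" using q_ge_real[of 0] by (intro divide_left_mono) auto
  finally show ?thesis .
qed

lemma U_lincomb: "U (\<lambda>t. a * x t + b * y t) j = a * U x j + b * U y j"
  by (simp add: U_def algebra_simps)

lemma U_sum: "U (\<lambda>t. \<Sum>i\<in>I. c i * f i t) j = (\<Sum>i\<in>I. c i * U (f i) j)"
  by (simp add: U_def sum_distrib_left sum.distrib distrib_left mult.left_commute)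

lemma U_C_Suc: "U (rv (C (Suc k) i)) j = step k (\<lambda>i. U (rv (C k i)) j) i"
  by (simp add: U_def rv_def C_Suc step_def algebra_simps)

lemma nrm_nonneg: "0 \<le> nrm x"
  by (simp add: nrm_def sum_nonneg)

lemma perm_range: "i \<in> {1..n + 2} \<Longrightarrow> perm k i \<in> {1..n + 2}"
  by (auto simp: perm_def)

lemma perm_perm: "i \<le> n + 2 \<Longrightarrow> perm k (perm k i) = i"
  by (auto simp: perm_def)

lemma bij_betw_perm: "bij_betw (perm k) {1..n + 2} {1..n + 2}"
  by (rule bij_betw_byWitness[of _ "perm k"]) (use perm_range[of _ k] in \<open>auto simp: perm_perm\<close>)

lemma nrm_le_dev:
  assumes "i \<in> {1..n + 2}"
  shows "nrm (rv (C k i)) \<le> scale k i + (\<Sum>j=1..n + 2. \<bar>dev k i j\<bar>)"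
proof -
  have "nrm (rv (C k i)) \<le> (\<Sum>j=1..n + 2. (if j = perm k i then scale k i else 0) + \<bar>dev k i j\<bar>)"
    unfolding nrm_def
    by (intro sum_mono) (use scale_pos[of k i] in \<open>auto simp: dev_def\<close>)
  also have "\<dots> = scale k i + (\<Sum>j=1..n + 2. \<bar>dev k i j\<bar>)"
    using perm_range[OF assms, of k] by (simp add: sum.distrib)
  finally show ?thesis .
qed

lemma sum_abs_dev_step:
  assumes "\<And>j. x j = m * y j - z j" "0 \<le> m"
  shows "(\<Sum>j\<in>J. \<bar>x j\<bar>) \<le> m * (\<Sum>j\<in>J. \<bar>y j\<bar>) + (\<Sum>j\<in>J. \<bar>z j :: real\<bar>)"
proof -
  have "\<bar>x j\<bar> \<le> m * \<bar>y j\<bar> + \<bar>z j\<bar>" for j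
    using assms abs_triangle_ineq4[of "m * y j" "z j"] by (simp add: abs_mult)
  then have "(\<Sum>j\<in>J. \<bar>x j\<bar>) \<le> (\<Sum>j\<in>J. m * \<bar>y j\<bar> + \<bar>z j\<bar>)" by (intro sum_mono)
  then show ?thesis by (simp add: sum.distrib sum_distrib_left)
qed

text \<open>The multiplied vector in \<open>step\<close> scales exactly by the factor by which the
  intended length grows, so its relative error is unchanged; new error comes only from the
  subtracted vector. The vector of index 0 enters only through its size, since it is no member of
  the nearly orthogonal system.\<close>

lemma dev_bound_aux:
  "nrm (rv (C k 0)) \<le> 2 * scale k 0 \<and>
   (\<forall>i\<in>{1..n + 2}. (\<Sum>j=1..n + 2. \<bar>dev k i j\<bar>) \<le> scale k i * delta k)"
proof (induction k)
  case 0
  have "dev 0 i j = 0" if ij: "i \<in> {1..n + 2}" "j \<in> {1..n + 2}" for i j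
  proof -
    have eq: "j - 1 = i - 1 \<longleftrightarrow> j = i" using ij by auto
    have "U (rv (C0 i)) j = scale 0 i * (if j = i then 1 else 0)"
    proof (cases "i \<le> n + 1")
      case True
      have "C0 i t = (if t = i - 1 then 1 else 0)" for t using True ij by (simp add: C0_def)
      moreover have "n + 1 \<noteq> i - 1" "n = i - 1 \<longleftrightarrow> i = n + 1" using True ij by auto
      ultimately show ?thesis
        using eq True ij by (auto simp: U_def rv_def scale_def)
    next
      case False
      then have i: "i = n + 2" using ij by simp
      have "C0 i t = (if t = n + 1 then 1 else if t = n then - int (q 1) else 0)" for t
        by (simp add: C0_def i)
      moreover have "j \<le> n \<Longrightarrow> j - 1 < n" using ij by auto
      ultimately show ?thesis
        using ij by (auto simp: U_def rv_def scale_def i)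
    qed
    then show ?thesis by (simp add: dev_def C_0 perm_def)
  qed
  moreover have "U (rv (C 0 0)) j = 0" if "j \<in> {1..n + 2}" for j
  proof -
    have "j - 1 \<noteq> n + 2" using that by auto
    then show ?thesis by (simp add: U_def rv_def C_0 C0_def)
  qed
  then have "nrm (rv (C 0 0)) = 0" unfolding nrm_def by (intro sum.neutral) auto
  ultimately show ?case using scale_pos[of 0 0] by (simp add: delta_def)
next
  case (Suc k)
  have IH0: "nrm (rv (C k 0)) \<le> 2 * scale k 0"
    and IH: "\<And>i. i \<in> {1..n + 2} \<Longrightarrow> (\<Sum>j=1..n + 2. \<bar>dev k i j\<bar>) \<le> scale k i * delta k"
    using Suc by blast+
  have two: "nrm (rv (C k i)) \<le> 2 * scale k i" if "i \<le> n + 2" for i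
  proof (cases "i = 0")
    case False
    then have i: "i \<in> {1..n + 2}" using that by simp
    have "scale k i * delta k \<le> scale k i * 1"
      using delta_le[of k] scale_pos[of k i] by (intro mult_left_mono) auto
    then show ?thesis using nrm_le_dev[OF i, of k] IH[OF i] by linarith
  qed (use IH0 in simp)
  have two': "nrm (rv (C k i)) \<le> 2 * real (S (k + 2))" if "i \<le> n + 2" for i
    using two[OF that] S_mono[of k "k + 2"] S_mono[of "k + 1" "k + 2"]
    by (auto simp: scale_def split: if_splits)
  have dS: "delta (Suc k) = delta k + 2 / real (q (k + 2))" by (simp add: delta_def)
  have qp: "0 < real (q (k + 2))" using q_ge_real[of "k + 2"] by linarith
  \<comment> \<open>The increment of \<open>delta\<close>, multiplied by the new length
    \<open>S (k + 3)\<close>, is exactly the bound \<open>2 * S (k + 2)\<close> on the subtracted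
    vector.\<close>
  have fin: "real (S (k + 3)) * delta (Suc k) = real (S (k + 3)) * delta k + 2 * real (S (k + 2))"
    using qp unfolding dS S_shift(1) by (simp add: field_simps)
  have "(\<Sum>j=1..n + 2. \<bar>dev (Suc k) i j\<bar>) \<le> scale (Suc k) i * delta (Suc k)"
    if i: "i \<in> {1..n + 2}" for i
  proof -
    consider "i \<le> n" | "i = n + 1" | "i = n + 2" using i by force
    then show ?thesis
    proof cases
      case 1
      have sc: "scale (Suc k) i = real (S (k + 3))" "scale k i = real (S (k + 2))"
        using 1 i by (auto simp: scale_def numeral_3_eq_3)
      have "dev (Suc k) i j = real (q (k + 2)) * dev k i j - U (rv (C k (i - 1))) j" for j
        unfolding dev_def U_C_Suc sc S_shift(1) using 1 i
        by (simp add: step_def perm_def algebra_simps)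
      from sum_abs_dev_step[OF this, where J = "{1..n + 2}"]
      have "(\<Sum>j=1..n + 2. \<bar>dev (Suc k) i j\<bar>)
          \<le> real (q (k + 2)) * (\<Sum>j=1..n + 2. \<bar>dev k i j\<bar>) + nrm (rv (C k (i - 1)))"
        by (simp add: nrm_def)
      also have "\<dots> \<le> real (q (k + 2)) * (real (S (k + 2)) * delta k) + 2 * real (S (k + 2))"
        using IH[OF i] two'[of "i - 1"] i unfolding sc by (intro add_mono mult_left_mono) auto
      also have "\<dots> = real (S (k + 3)) * delta (Suc k)" unfolding fin by (simp add: S_shift(1))
      finally show ?thesis unfolding sc .
    next
      case 2
      have sc: "scale (Suc k) i = scale k (n + 2)" using 2 by (simp add: scale_def add_2_eq_Suc')
      have "dev (Suc k) i j = dev k (n + 2) j" for j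
        unfolding dev_def U_C_Suc sc using 2 by (simp add: step_def perm_def)
      then have "(\<Sum>j=1..n + 2. \<bar>dev (Suc k) i j\<bar>) \<le> scale k (n + 2) * delta k"
        using IH[of "n + 2"] by simp
      also have "\<dots> \<le> scale k (n + 2) * delta (Suc k)"
        using scale_pos[of k "n + 2"] dS by (intro mult_left_mono) auto
      finally show ?thesis unfolding sc .
    next
      case 3
      have sc: "scale (Suc k) i = real (S (k + 3))" "scale k (n + 1) = real (S (k + 1))"
        using 3 by (auto simp: scale_def numeral_3_eq_3)
      let ?M = "real (q (k + 2) * q (k + 1))"
      have "dev (Suc k) i j = ?M * dev k (n + 1) j - U (rv (C k n)) j" for j
        unfolding dev_def U_C_Suc sc S_shift(2) using 3
        by (simp add: step_def perm_def algebra_simps)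
      from sum_abs_dev_step[OF this, where J = "{1..n + 2}"]
      have "(\<Sum>j=1..n + 2. \<bar>dev (Suc k) i j\<bar>)
          \<le> ?M * (\<Sum>j=1..n + 2. \<bar>dev k (n + 1) j\<bar>) + nrm (rv (C k n))"
        by (simp add: nrm_def)
      also have "\<dots> \<le> ?M * (real (S (k + 1)) * delta k) + 2 * real (S (k + 2))"
        using IH[of "n + 1"] two'[of n] unfolding sc by (intro add_mono mult_left_mono) auto
      also have "\<dots> = real (S (k + 3)) * delta (Suc k)" unfolding fin by (simp add: S_shift(2))
      finally show ?thesis unfolding sc .
    qed
  qed
  moreover have "nrm (rv (C (Suc k) 0)) \<le> 2 * scale (Suc k) 0"
    using two[of "n + 1"] by (simp add: C_Suc_simps(1)[simplified] scale_def)
  ultimately show ?case by blast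
qed

lemma dev_bound:
  "i \<in> {1..n + 2} \<Longrightarrow> (\<Sum>j=1..n + 2. \<bar>dev k i j\<bar>) \<le> scale k i / 8"
proof -
  assume "i \<in> {1..n + 2}"
  then have "(\<Sum>j=1..n + 2. \<bar>dev k i j\<bar>) \<le> scale k i * delta k" using dev_bound_aux by blast
  also have "\<dots> \<le> scale k i * (1 / 8)"
    using delta_le[of k] scale_pos[of k i] by (intro mult_left_mono) auto
  finally show ?thesis by simp
qed

lemma nrm_C_le: "i \<le> n + 2 \<Longrightarrow> nrm (rv (C k i)) \<le> 2 * scale k i"
  using dev_bound_aux[of k] nrm_le_dev[of i k] dev_bound[of i k] scale_pos[of k i]
  by (cases "i = 0") auto

text \<open>Diagonal dominance: in the coordinates \<open>U\<close> the vectors 1 to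
  \<open>n + 2\<close> form a permuted diagonal matrix with relative errors of at most
  \<open>1 / 8\<close> in total for each vector, so coefficients are controlled by the size of the
  combination. The vector of index 0 is treated as a perturbation.\<close>

lemma nrm_lower:
  fixes c :: "nat \<Rightarrow> real"
  assumes "z = (\<lambda>t. \<Sum>i\<le>n + 2. c i * rv (C k i) t)"
  shows "(\<Sum>i=1..n + 2. \<bar>c i\<bar> * scale k i) \<le> 2 * nrm z + 4 * \<bar>c 0\<bar> * real (S k)"
proof -
  let ?J = "{1..n + 2}"
  \<comment> \<open>Coordinate \<open>j\<close> is dominated by the basis vector of index
    \<open>perm k j\<close>, because \<open>perm k\<close> is an involution.\<close>
  have "\<bar>c (perm k j)\<bar> * scale k (perm k j)
      \<le> \<bar>U z j\<bar> + \<bar>c 0\<bar> * \<bar>U (rv (C k 0)) j\<bar> + (\<Sum>i\<in>?J. \<bar>c i\<bar> * \<bar>dev k i j\<bar>)"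
    if j: "j \<in> ?J" for j
  proof -
    have "{..n + 2} = insert 0 ?J" by auto
    then have "U z j = c 0 * U (rv (C k 0)) j + (\<Sum>i\<in>?J. c i * U (rv (C k i)) j)"
      unfolding assms U_sum by simp
    also have "(\<Sum>i\<in>?J. c i * U (rv (C k i)) j) =
        (\<Sum>i\<in>?J. c i * dev k i j) + (\<Sum>i\<in>?J. if i = perm k j then c i * scale k i else 0)"
      unfolding sum.distrib[symmetric]
      by (intro sum.cong refl)
        (use j in \<open>auto simp: dev_def algebra_simps perm_perm\<close>)
    also have "(\<Sum>i\<in>?J. if i = perm k j then c i * scale k i else 0)
        = c (perm k j) * scale k (perm k j)"
      using perm_range[OF j, of k] by simp
    finally have "c (perm k j) * scale k (perm k j)
        = U z j - c 0 * U (rv (C k 0)) j - (\<Sum>i\<in>?J. c i * dev k i j)" by simp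
    moreover have "\<bar>c (perm k j)\<bar> * scale k (perm k j) = \<bar>c (perm k j) * scale k (perm k j)\<bar>"
      using scale_pos[of k "perm k j"] by (simp add: abs_mult)
    moreover have "\<bar>\<Sum>i\<in>?J. c i * dev k i j\<bar> \<le> (\<Sum>i\<in>?J. \<bar>c i\<bar> * \<bar>dev k i j\<bar>)"
      using sum_abs[of "\<lambda>i. c i * dev k i j" ?J] by (simp add: abs_mult)
    moreover have "\<bar>c 0 * U (rv (C k 0)) j\<bar> = \<bar>c 0\<bar> * \<bar>U (rv (C k 0)) j\<bar>" by (rule abs_mult)
    ultimately show ?thesis by linarith
  qed
  then have "(\<Sum>j\<in>?J. \<bar>c (perm k j)\<bar> * scale k (perm k j))
      \<le> (\<Sum>j\<in>?J. \<bar>U z j\<bar> + \<bar>c 0\<bar> * \<bar>U (rv (C k 0)) j\<bar> + (\<Sum>i\<in>?J. \<bar>c i\<bar> * \<bar>dev k i j\<bar>))"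
    by (rule sum_mono)
  also have "\<dots> = nrm z + \<bar>c 0\<bar> * nrm (rv (C k 0)) + (\<Sum>j\<in>?J. \<Sum>i\<in>?J. \<bar>c i\<bar> * \<bar>dev k i j\<bar>)"
    by (simp add: sum.distrib nrm_def sum_distrib_left)
  also have "(\<Sum>j\<in>?J. \<Sum>i\<in>?J. \<bar>c i\<bar> * \<bar>dev k i j\<bar>) = (\<Sum>i\<in>?J. \<bar>c i\<bar> * (\<Sum>j\<in>?J. \<bar>dev k i j\<bar>))"
    by (subst sum.swap) (simp add: sum_distrib_left)
  also have "\<dots> \<le> (\<Sum>i\<in>?J. \<bar>c i\<bar> * (scale k i / 8))"
    using dev_bound by (intro sum_mono mult_left_mono) auto
  also have "\<dots> = (\<Sum>i\<in>?J. \<bar>c i\<bar> * scale k i) / 8" by (simp add: sum_divide_distrib)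
  finally have "(\<Sum>j\<in>?J. \<bar>c (perm k j)\<bar> * scale k (perm k j))
      \<le> nrm z + \<bar>c 0\<bar> * nrm (rv (C k 0)) + (\<Sum>i\<in>?J. \<bar>c i\<bar> * scale k i) / 8" by simp
  moreover have "(\<Sum>j\<in>?J. \<bar>c (perm k j)\<bar> * scale k (perm k j)) = (\<Sum>i\<in>?J. \<bar>c i\<bar> * scale k i)"
    by (rule sum.reindex_bij_betw[OF bij_betw_perm])
  moreover have "\<bar>c 0\<bar> * nrm (rv (C k 0)) \<le> \<bar>c 0\<bar> * (2 * real (S k))"
    using nrm_C_le[of 0 k] by (intro mult_left_mono) (auto simp: scale_def)
  moreover have "0 \<le> nrm z" "0 \<le> \<bar>c 0\<bar> * real (S k)" by (simp_all add: nrm_nonneg)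
  ultimately show ?thesis by linarith
qed

end

section \<open>Values of the form\<close>

locale cascade_form = cascade +
  fixes a :: "nat \<Rightarrow> real"
  assumes a_pi: "a \<in> pi_d (n + 3)"
    and a_chain: "chain (\<lambda>i. Lform (n + 3) a (C k i))"
begin

abbreviation L :: "(nat \<Rightarrow> int) \<Rightarrow> real" where
  "L \<equiv> Lform (n + 3) a"

definition X :: "nat \<Rightarrow> nat \<Rightarrow> real" where
  "X k i = L (C k i)"

text \<open>The vectors \<open>z_k\<close> of the construction; by \<open>V_shift\<close> the basis
  at stage \<open>k\<close> also contains the next two of them.\<close>

definition V :: "nat \<Rightarrow> nat \<Rightarrow> int" where
  "V k = C k 0"

definition lam :: "nat \<Rightarrow> real" where
  "lam k = L (V k)"

lemma V_shift: "C k (n + 1) = V (k + 1)" "C k (n + 2) = V (k + 2)"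
  using C_Suc_simps(1)[of k] C_Suc_simps(3)[of k] C_Suc_simps(1)[of "Suc k"]
  by (simp_all add: V_def add_2_eq_Suc')

lemma X_shift: "X k 0 = lam k" "X k (n + 1) = lam (k + 1)" "X k (n + 2) = lam (k + 2)"
  unfolding X_def lam_def V_shift by (simp_all add: V_def)

lemma X_chain: "chain (X k)"
  using a_chain[of k] by (simp add: X_def[abs_def])

lemma X_Suc: "X (Suc k) i = step k (X k) i"
  by (simp add: X_def[abs_def] Lform_C)

lemma L_sum: "L (\<lambda>t. \<Sum>i\<in>I. c i * f i t) = (\<Sum>i\<in>I. of_int (c i) * L (f i))"
  unfolding Lform_def of_int_sum of_int_mult sum_distrib_left
  by (subst sum.swap) (simp add: mult.left_commute)

lemma L_lincomb: "L (\<lambda>t. b * x t + c * y t) = of_int b * L x + of_int c * L y"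
  by (simp add: Lform_def sum.distrib distrib_left sum_distrib_left mult.left_commute)

lemma L_scale: "L (\<lambda>t. b * x t) = of_int b * L x"
  using L_lincomb[of b x 0 x] by simp

text \<open>The defect \<open>q (k + 2) * X k i - X k (i - 1)\<close> is an entry of the next chain.
  It is therefore nonnegative and at most the first entry of that chain, which is
  \<open>X k (n + 1)\<close> and hence at most \<open>X k i\<close>.\<close>

lemma X_bounds:
  assumes "1 \<le> i" "i \<le> n"
  shows "(real (q (k + 2)) - 1) * X k i \<le> X k (i - 1)" "X k (i - 1) \<le> real (q (k + 2)) * X k i"
proof -
  have e: "X (Suc k) i = real (q (k + 2)) * X k i - X k (i - 1)"
    using assms by (simp add: X_Suc step_def)
  have "X (Suc k) i \<le> X (Suc k) 0" using chain_antimono[OF X_chain] assms by simp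
  also have "\<dots> = X k (n + 1)" by (simp add: X_Suc step_def)
  also have "\<dots> \<le> X k i" using chain_antimono[OF X_chain] assms by simp
  finally show "(real (q (k + 2)) - 1) * X k i \<le> X k (i - 1)"
    using e by (simp add: algebra_simps)
  have "0 \<le> X (Suc k) i" using chain_nonneg[OF X_chain] assms by simp
  then show "X k (i - 1) \<le> real (q (k + 2)) * X k i" using e by linarith
qed

lemma X_bounds_last:
  "(real (q (k + 2) * q (k + 1)) - 1) * X k (n + 1) \<le> X k n"
  "X k n \<le> real (q (k + 2) * q (k + 1)) * X k (n + 1)"
proof -
  have e: "X (Suc k) (n + 2) = real (q (k + 2) * q (k + 1)) * X k (n + 1) - X k n"
    by (simp add: X_Suc step_def)
  have "X (Suc k) (n + 2) \<le> X (Suc k) 0" using chain_antimono[OF X_chain] by simp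
  also have "\<dots> = X k (n + 1)" by (simp add: X_Suc step_def)
  finally show "(real (q (k + 2) * q (k + 1)) - 1) * X k (n + 1) \<le> X k n"
    using e by (simp add: algebra_simps)
  have "0 \<le> X (Suc k) (n + 2)" using chain_nonneg[OF X_chain] by simp
  then show "X k n \<le> real (q (k + 2) * q (k + 1)) * X k (n + 1)" using e by linarith
qed

lemma lam_0: "lam 0 = 1"
proof -
  have "lam 0 = (\<Sum>t<n + 3. if t = n + 2 then a t else 0)"
    unfolding lam_def V_def Lform_def C_0 by (intro sum.cong) (auto simp: C0_def)
  then show ?thesis using a_pi by (simp add: pi_d_def add_2_eq_Suc')
qed

lemma M_ge: "64 \<le> real (q (k + 2) * q (k + 1))"
proof -
  have "8 * 8 \<le> real (q (k + 2)) * real (q (k + 1))"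
    using q_ge_real[of "k + 2"] q_ge_real[of "k + 1"] by (intro mult_mono) linarith+
  then show ?thesis by simp
qed

text \<open>The upper bounds on ratios of neighbouring values push positivity to the right along the
  chain, starting from index 0.\<close>

lemma X_pos_of_first:
  assumes "0 < X k 0" "i \<le> n + 1"
  shows "0 < X k i"
proof -
  have low: "0 < X k i" if "i \<le> n" for i
    using that
  proof (induction i)
    case (Suc i)
    have "X k i \<le> real (q (k + 2)) * X k (Suc i)" using X_bounds(2)[of "Suc i" k] Suc by simp
    then have "0 < real (q (k + 2)) * X k (Suc i)" using Suc by linarith
    then show ?case by (simp add: zero_less_mult_iff)
  qed (use assms in simp)
  have "0 < real (q (k + 2) * q (k + 1)) * X k (n + 1)"
    using low[of n] X_bounds_last(2)[of k] by linarith
  then have "0 < X k (n + 1)" using M_ge[of k] by (auto simp: zero_less_mult_iff)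
  with low show ?thesis using assms(2) by (cases "i = n + 1") auto
qed

lemma lam_pos: "0 < lam k"
proof (induction k)
  case 0
  then show ?case by (simp add: lam_0)
next
  case (Suc k)
  then show ?case using X_pos_of_first[of k "n + 1"] X_shift[of k] by simp
qed

lemma X_pos: "i \<le> n + 2 \<Longrightarrow> 0 < X k i"
  using X_pos_of_first[of k i] lam_pos[of k] lam_pos[of "k + 2"] X_shift[of k]
  by (cases "i = n + 2") auto

text \<open>Per unit of intended length, the values beyond index \<open>i\<close> are at most
  \<open>2 * X k i / S (k + 3)\<close>. Hence, for vectors short compared with
  \<open>S (k + 3)\<close>, the first nonzero coefficient decides the size of the form.\<close>

lemma X_small:
  assumes "i \<le> n" "i < j" "j \<le> n + 2"
  shows "X k j * real (S (k + 3)) \<le> 2 * X k i * scale k j"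
proof -
  consider "j \<le> n" | "j = n + 1" | "j = n + 2" using assms by force
  then show ?thesis
  proof cases
    case 1
    let ?N = "real (q (k + 2))"
    have "?N * X k j \<le> 2 * ((?N - 1) * X k j)"
      using q_ge_real[of "k + 2"] X_pos[of j k] assms(3) by (simp add: algebra_simps)
    also have "(?N - 1) * X k j \<le> X k (j - 1)" using X_bounds(1)[of j k] 1 assms by simp
    also have "X k (j - 1) \<le> X k i" using chain_antimono[OF X_chain] assms by simp
    finally have "?N * X k j * real (S (k + 2)) \<le> 2 * X k i * real (S (k + 2))"
      by (intro mult_right_mono) auto
    then show ?thesis using 1 assms by (simp add: S_shift(1) scale_def mult_ac)
  next
    case 2
    let ?M = "real (q (k + 2) * q (k + 1))"
    have "?M * X k j \<le> 2 * ((?M - 1) * X k j)"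
      using M_ge[of k] X_pos[of j k] assms(3) mult_right_mono[of 64 ?M "X k j"]
      by (simp add: algebra_simps)
    also have "(?M - 1) * X k j \<le> X k n" using X_bounds_last(1)[of k] 2 by simp
    also have "X k n \<le> X k i" using chain_antimono[OF X_chain] assms by simp
    finally have "?M * X k j * real (S (k + 1)) \<le> 2 * X k i * real (S (k + 1))"
      by (intro mult_right_mono) auto
    then show ?thesis using 2 assms unfolding S_shift(2) by (simp add: scale_def mult_ac)
  next
    case 3
    let ?M = "real (q (k + 2) * q (k + 1))"
    have "X k j \<le> X k (n + 1)" using chain_antimono[OF X_chain] 3 by simp
    then have "?M * X k j \<le> ?M * X k (n + 1)" by (intro mult_left_mono) auto
    also have "\<dots> \<le> 2 * ((?M - 1) * X k (n + 1))"
      using M_ge[of k] X_pos[of "n + 1" k] mult_right_mono[of 64 ?M "X k (n + 1)"]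
      by (simp add: algebra_simps)
    also have "(?M - 1) * X k (n + 1) \<le> X k n" using X_bounds_last(1)[of k] .
    also have "X k n \<le> X k i" using chain_antimono[OF X_chain] assms by simp
    finally have "?M * X k j * real (S (k + 1)) \<le> 2 * X k i * real (S (k + 1))"
      by (intro mult_right_mono) auto
    also have "\<dots> \<le> 2 * X k i * real (S (k + 2))"
      using X_pos[of i k] assms S_mono[of "k + 1" "k + 2"] by (intro mult_left_mono) auto
    finally show ?thesis using 3 unfolding S_shift(2) by (simp add: scale_def mult_ac)
  qed
qed

section \<open>Integer vectors in the coordinates of a stage\<close>

lemma stage_coordinates:
  assumes "z \<in> zvecs (n + 3)"
  obtains c where "z = (\<lambda>t. \<Sum>i\<le>n + 2. c i * C k i t)"
    "L z = (\<Sum>i\<le>n + 2. of_int (c i) * X k i)"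
    "(\<Sum>i=1..n + 2. \<bar>of_int (c i)\<bar> * scale k i) \<le> 2 * nrm (rv z) + 4 * \<bar>of_int (c 0)\<bar> * real (S k)"
proof -
  obtain c where z: "z = (\<lambda>t. \<Sum>i\<le>n + 2. c i * C k i t)"
    using zvecs_subset_stage_lattice[OF assms, of k] by (auto simp: stage_lattice_def)
  have "rv z = (\<lambda>t. \<Sum>i\<le>n + 2. of_int (c i) * rv (C k i) t)"
    unfolding z by (simp add: rv_def)
  from nrm_lower[OF this] show ?thesis
    using that[OF z] L_sum[where f = "C k" and c = c and I = "{..n + 2}"] by (simp add: z X_def)
qed

text \<open>The terms after \<open>i0\<close> are estimated by \<open>X_small\<close>; the resulting
  sum is then enlarged to all indices from 1, the shape that \<open>nrm_lower\<close>
  bounds.\<close>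

lemma L_dominated_by_first_coordinate:
  fixes c :: "nat \<Rightarrow> int"
  assumes "i0 \<le> n" "\<And>i. i < i0 \<Longrightarrow> c i = 0"
  shows "\<bar>of_int (c i0)\<bar> * X k i0 - 2 * X k i0 / real (S (k + 3)) * (\<Sum>i=1..n + 2. \<bar>of_int (c i)\<bar> * scale k i)
    \<le> \<bar>\<Sum>i\<le>n + 2. of_int (c i) * X k i\<bar>"
proof -
  let ?s = "real (S (k + 3))"
  have sp: "0 < ?s" by (simp add: S_pos)
  have "(\<Sum>i\<le>n + 2. of_int (c i) * X k i) = (\<Sum>i=i0..n + 2. of_int (c i) * X k i)"
    using assms by (intro sum.mono_neutral_right) auto
  also have "\<dots> = of_int (c i0) * X k i0 + (\<Sum>i=Suc i0..n + 2. of_int (c i) * X k i)"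
    using assms by (intro sum.atLeast_Suc_atMost) auto
  finally have e: "(\<Sum>i\<le>n + 2. of_int (c i) * X k i) = \<dots>" .
  have "\<bar>\<Sum>i=Suc i0..n + 2. of_int (c i) * X k i\<bar> \<le> (\<Sum>i=Suc i0..n + 2. \<bar>of_int (c i) * X k i\<bar>)"
    by (rule sum_abs)
  also have "\<dots> \<le> (\<Sum>i=Suc i0..n + 2. \<bar>of_int (c i)\<bar> * (2 * X k i0 / ?s * scale k i))"
  proof (intro sum_mono)
    fix i assume i: "i \<in> {Suc i0..n + 2}"
    then have "X k i \<le> 2 * X k i0 / ?s * scale k i"
      using X_small[of i0 i k] assms sp by (simp add: field_simps)
    then show "\<bar>of_int (c i) * X k i\<bar> \<le> \<bar>of_int (c i)\<bar> * (2 * X k i0 / ?s * scale k i)"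
      using X_pos[of i k] i unfolding abs_mult by (intro mult_left_mono) auto
  qed
  also have "\<dots> \<le> (\<Sum>i=1..n + 2. \<bar>of_int (c i)\<bar> * (2 * X k i0 / ?s * scale k i))"
    using X_pos[of i0 k] assms scale_pos[of k]
    by (intro sum_mono2) (auto intro!: mult_nonneg_nonneg simp: less_imp_le)
  also have "\<dots> = 2 * X k i0 / ?s * (\<Sum>i=1..n + 2. \<bar>of_int (c i)\<bar> * scale k i)"
    unfolding sum_distrib_left by (intro sum.cong) auto
  finally have b: "\<bar>\<Sum>i=Suc i0..n + 2. of_int (c i) * X k i\<bar> \<le> \<dots>" .
  have "\<bar>of_int (c i0) * X k i0\<bar> = \<bar>of_int (c i0)\<bar> * X k i0"
    using X_pos[of i0 k] assms by (simp add: abs_mult)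
  with b show ?thesis unfolding e by linarith
qed

lemma S_add3_ge: "512 * real (S k) \<le> real (S (k + 3))"
proof -
  have "8 * (8 * 8) \<le> real (q (k + 2)) * (real (q (k + 1)) * real (q k))"
    using q_ge_real[of "k + 2"] q_ge_real[of "k + 1"] q_ge_real[of k] by (intro mult_mono) simp_all
  then have "512 * real (S k) \<le> real (q (k + 2)) * (real (q (k + 1)) * real (q k)) * real (S k)"
    by (intro mult_right_mono) auto
  also have "\<dots> = real (S (k + 3))"
    by (simp add: S_Suc numeral_3_eq_3 add_2_eq_Suc')
  finally show ?thesis .
qed

text \<open>The length assumption and \<open>S_add3_ge\<close> bound the weighted coefficient sum by
  \<open>(1 + |c 0|) * S (k + 3) / 8\<close>. The tail is then at most a quarter of
  \<open>(1 + |c 0|) * lam k\<close>, which leaves at least \<open>lam k / 2\<close> because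
  \<open>|c 0| >= 1\<close>.\<close>

lemma L_large_outside_hyperplane:
  fixes c :: "nat \<Rightarrow> int"
  assumes "L z = (\<Sum>i\<le>n + 2. of_int (c i) * X k i)"
    and "(\<Sum>i=1..n + 2. \<bar>of_int (c i)\<bar> * scale k i) \<le> 2 * nrm (rv z) + 4 * \<bar>of_int (c 0)\<bar> * real (S k)"
    and "16 * nrm (rv z) \<le> real (S (k + 3))" and "c 0 \<noteq> 0"
  shows "lam k / 2 \<le> \<bar>L z\<bar>"
proof -
  let ?s = "real (S (k + 3))" and ?x = "lam k" and ?c = "\<bar>of_int (c 0)\<bar> :: real"
  have sp: "0 < ?s" by (simp add: S_pos)
  have xp: "0 < ?x" by (rule lam_pos)
  have c1: "1 \<le> ?c" using assms(4) by linarith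
  have "?c * (512 * real (S k)) \<le> ?c * ?s" using S_add3_ge[of k] c1 by (intro mult_left_mono) auto
  moreover have "0 \<le> ?c * real (S k)" by simp
  ultimately have "2 * nrm (rv z) + 4 * ?c * real (S k) \<le> ?s / 8 + ?c * ?s / 8"
    using assms(3) unfolding mult.assoc mult.left_commute[of ?c 512] by linarith
  with assms(2) have "(\<Sum>i=1..n + 2. \<bar>of_int (c i)\<bar> * scale k i) \<le> ?s / 8 + ?c * ?s / 8" by linarith
  then have "2 * ?x / ?s * (\<Sum>i=1..n + 2. \<bar>of_int (c i)\<bar> * scale k i) \<le> 2 * ?x / ?s * (?s / 8 + ?c * ?s / 8)"
    using sp xp by (intro mult_left_mono) auto
  also have "\<dots> = ?x / 4 + ?c * ?x / 4" using sp by (simp add: field_simps)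
  finally have "?c * ?x - (?x / 4 + ?c * ?x / 4) \<le> \<bar>L z\<bar>"
    using L_dominated_by_first_coordinate[of 0 c k] unfolding assms(1) X_shift(1) by simp
  moreover have "1 * ?x \<le> ?c * ?x" using c1 xp by (intro mult_right_mono) auto
  ultimately show ?thesis by linarith
qed

lemma lam_decay_strong: "63 * lam (k + 1) \<le> X k n"
proof -
  have "63 * lam (k + 1) \<le> (real (q (k + 2) * q (k + 1)) - 1) * lam (k + 1)"
    using M_ge[of k] lam_pos[of "k + 1"] by (intro mult_right_mono) auto
  also have "\<dots> \<le> X k n" using X_bounds_last(1)[of k] unfolding X_shift .
  finally show ?thesis .
qed

lemma lam_decay: "63 * lam (k + 1) \<le> lam k"
  using lam_decay_strong[of k] chain_antimono[OF X_chain, of 0 n k] X_shift(1)[of k] by simp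

text \<open>When \<open>c 0 = 0\<close>, every index other than \<open>n + 1\<close> belongs to a
  vector of intended length \<open>S (k + 2)\<close>, too long to occur in so short a
  \<open>z\<close>.\<close>

lemma dichotomy_multiple:
  assumes "z \<in> zvecs (n + 3)" "16 * nrm (rv z) < real (S (k + 2))"
  shows "(\<exists>b. z = (\<lambda>t. b * V (k + 1) t)) \<or> lam k / 2 \<le> \<bar>L z\<bar>"
proof -
  obtain c where c: "z = (\<lambda>t. \<Sum>i\<le>n + 2. c i * C k i t)"
    "L z = (\<Sum>i\<le>n + 2. of_int (c i) * X k i)"
    "(\<Sum>i=1..n + 2. \<bar>of_int (c i)\<bar> * scale k i) \<le> 2 * nrm (rv z) + 4 * \<bar>of_int (c 0)\<bar> * real (S k)"
    using stage_coordinates[OF assms(1), of k] by blast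
  show ?thesis
  proof (cases "c 0 = 0")
    case False
    have "16 * nrm (rv z) \<le> real (S (k + 3))" using assms(2) S_mono[of "k + 2" "k + 3"] by simp
    then show ?thesis using L_large_outside_hyperplane[OF c(2,3)] False by blast
  next
    case True
    have "c i = 0" if i: "i \<le> n + 2" "i \<noteq> n + 1" for i
    proof (rule ccontr)
      assume ci: "c i \<noteq> 0"
      then have i1: "i \<in> {1..n + 2}" using i True by (cases i) auto
      have "1 * scale k i \<le> \<bar>of_int (c i)\<bar> * scale k i"
        using ci scale_pos[of k i] by (intro mult_right_mono) auto
      also have "\<dots> \<le> (\<Sum>i=1..n + 2. \<bar>of_int (c i)\<bar> * scale k i)"
        using i1 scale_pos[of k] by (intro member_le_sum) (auto simp: less_imp_le)
      finally have "scale k i \<le> 2 * nrm (rv z)" using c(3) True by simp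
      then show False
        using assms(2) i1 i nrm_nonneg[of "rv z"] by (simp add: scale_def split: if_splits)
    qed
    then have "(\<Sum>i\<le>n + 2. c i * C k i t) = (\<Sum>i\<in>{n + 1}. c i * C k i t)" for t
      by (intro sum.mono_neutral_right) auto
    then have "z = (\<lambda>t. c (n + 1) * V (k + 1) t)" unfolding c(1) V_shift(1)[symmetric] by simp
    then show ?thesis by blast
  qed
qed

text \<open>For vectors one level longer, a nonzero coefficient of index at most \<open>n\<close>
  still makes the form exceed \<open>lam (k + 1)\<close>; otherwise \<open>z\<close> lies in the
  plane of \<open>V (k + 1)\<close> and \<open>V (k + 2)\<close>.\<close>

lemma dichotomy_two_dim:
  assumes "z \<in> zvecs (n + 3)" "16 * nrm (rv z) \<le> real (S (k + 3))"
  shows "(\<exists>b c. z = (\<lambda>t. b * V (k + 1) t + c * V (k + 2) t) \<and>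
      \<bar>of_int c\<bar> * real (S (k + 2)) \<le> 2 * nrm (rv z)) \<or> lam (k + 1) < \<bar>L z\<bar>"
proof -
  obtain c where c: "z = (\<lambda>t. \<Sum>i\<le>n + 2. c i * C k i t)"
    "L z = (\<Sum>i\<le>n + 2. of_int (c i) * X k i)"
    "(\<Sum>i=1..n + 2. \<bar>of_int (c i)\<bar> * scale k i) \<le> 2 * nrm (rv z) + 4 * \<bar>of_int (c 0)\<bar> * real (S k)"
    using stage_coordinates[OF assms(1), of k] by blast
  note Xn = lam_decay_strong[of k]
  have lp: "0 < lam (k + 1)" by (rule lam_pos)
  consider "c 0 \<noteq> 0" | "c 0 = 0" "\<exists>i\<le>n. c i \<noteq> 0" | "\<forall>i\<le>n. c i = 0" by blast
  then show ?thesis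
  proof cases
    case 1
    have "lam k / 2 \<le> \<bar>L z\<bar>" using L_large_outside_hyperplane[OF c(2,3) assms(2) 1] .
    moreover have "X k n \<le> lam k" using chain_antimono[OF X_chain, of 0 n k] X_shift(1)[of k] by simp
    ultimately show ?thesis using Xn lp by linarith
  next
    case 2
    \<comment> \<open>The first nonzero coefficient. With \<open>c 0 = 0\<close> the tail costs at
      most a quarter of \<open>X k i0\<close>, and \<open>X k i0 >= X k n\<close> exceeds
      \<open>lam (k + 1)\<close> by the factor 63.\<close>
    define i0 where "i0 = (LEAST i. c i \<noteq> 0)"
    obtain i1 where i1: "i1 \<le> n" "c i1 \<noteq> 0" using 2 by blast
    have i0: "c i0 \<noteq> 0" unfolding i0_def by (rule LeastI[of "\<lambda>i. c i \<noteq> 0", OF i1(2)])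
    have i0n: "i0 \<le> n" using Least_le[of "\<lambda>i. c i \<noteq> 0", OF i1(2)] i1(1) unfolding i0_def by linarith
    have i0min: "\<And>i. i < i0 \<Longrightarrow> c i = 0" unfolding i0_def using not_less_Least by blast
    let ?s = "real (S (k + 3))" and ?x = "X k i0"
    have sp: "0 < ?s" by (simp add: S_pos)
    have xp: "0 < ?x" using X_pos i0n by simp
    have "(\<Sum>i=1..n + 2. \<bar>of_int (c i)\<bar> * scale k i) \<le> ?s / 8" using c(3) 2 assms(2) by simp
    then have "2 * ?x / ?s * (\<Sum>i=1..n + 2. \<bar>of_int (c i)\<bar> * scale k i) \<le> 2 * ?x / ?s * (?s / 8)"
      using sp xp by (intro mult_left_mono) auto
    also have "\<dots> = ?x / 4" using sp by simp
    finally have "\<bar>of_int (c i0)\<bar> * ?x - ?x / 4 \<le> \<bar>L z\<bar>"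
      using L_dominated_by_first_coordinate[of i0 c k, OF i0n i0min] unfolding c(2) by simp
    moreover have "1 * ?x \<le> \<bar>of_int (c i0)\<bar> * ?x" using i0 xp by (intro mult_right_mono) auto
    moreover have "X k n \<le> ?x" using chain_antimono[OF X_chain] i0n by simp
    ultimately show ?thesis using Xn lp by linarith
  next
    case 3
    have "c i = 0" if "i \<in> {..n + 2} - {n + 1, n + 2}" for i
    proof -
      have "i \<le> n" using that by force
      then show ?thesis using 3 by blast
    qed
    then have "(\<Sum>i\<le>n + 2. c i * C k i t) = (\<Sum>i\<in>{n + 1, n + 2}. c i * C k i t)" for t
      by (intro sum.mono_neutral_right) auto
    then have z: "z = (\<lambda>t. c (n + 1) * V (k + 1) t + c (n + 2) * V (k + 2) t)"
      unfolding c(1) V_shift[symmetric] by simp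
    have "\<bar>of_int (c (n + 2))\<bar> * scale k (n + 2) \<le> (\<Sum>i=1..n + 2. \<bar>of_int (c i)\<bar> * scale k i)"
      using scale_pos[of k] by (intro member_le_sum) (auto simp: less_imp_le)
    then have "\<bar>of_int (c (n + 2))\<bar> * real (S (k + 2)) \<le> 2 * nrm (rv z)"
      using c(3) 3 by (simp add: scale_def)
    with z show ?thesis by blast
  qed
qed

text \<open>The product of the intended lengths \<open>scale k i\<close> over the indices 1 to
  \<open>n + 2\<close>; \<open>lam k\<close> turns out to be comparable to its reciprocal.\<close>

definition weight :: "nat \<Rightarrow> real" where
  "weight k = real (S (k + 2)) ^ (n + 1) * real (S (k + 1))"

lemma weight_pos: "0 < weight k"
  by (simp add: weight_def S_pos)

lemma weight_Suc:
  "weight (Suc k) = real (q (k + 2)) ^ n * real (q (k + 2) * q (k + 1)) * weight k"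
  by (simp add: weight_def S_Suc add_2_eq_Suc' power_mult_distrib)

lemma lam_le: "lam k \<le> real (q (k + 2)) ^ n * real (q (k + 2) * q (k + 1)) * lam (Suc k)"
proof -
  let ?N = "real (q (k + 2))"
  have "X k 0 \<le> ?N ^ i * X k i" if "i \<le> n" for i
    using that
  proof (induction i)
    case (Suc i)
    have "X k i \<le> ?N * X k (Suc i)" using X_bounds(2)[of "Suc i" k] Suc.prems by simp
    then have "?N ^ i * X k i \<le> ?N ^ i * (?N * X k (Suc i))" by (intro mult_left_mono) auto
    with Suc show ?case by (simp add: mult_ac)
  qed simp
  from this[of n] have "lam k \<le> ?N ^ n * X k n" by (simp add: X_shift)
  also have "\<dots> \<le> ?N ^ n * (real (q (k + 2) * q (k + 1)) * lam (k + 1))"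
    using X_bounds_last(2)[of k] unfolding X_shift by (intro mult_left_mono) auto
  finally show ?thesis by (simp add: mult.assoc)
qed

lemma lam_ge:
  "(real (q (k + 2)) - 1) ^ n * (real (q (k + 2) * q (k + 1)) - 1) * lam (Suc k) \<le> lam k"
proof -
  let ?N = "real (q (k + 2)) - 1"
  have N0: "0 \<le> ?N" using q_ge_real[of "k + 2"] by linarith
  have "?N ^ i * X k i \<le> X k 0" if "i \<le> n" for i
    using that
  proof (induction i)
    case (Suc i)
    have "?N * X k (Suc i) \<le> X k i" using X_bounds(1)[of "Suc i" k] Suc.prems by simp
    then have "?N ^ i * (?N * X k (Suc i)) \<le> ?N ^ i * X k i" using N0 by (intro mult_left_mono) auto
    with Suc show ?case by (simp add: mult_ac)
  qed simp
  from this[of n] have "?N ^ n * X k n \<le> lam k" by (simp add: X_shift)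
  moreover have "?N ^ n * ((real (q (k + 2) * q (k + 1)) - 1) * lam (k + 1)) \<le> ?N ^ n * X k n"
    using X_bounds_last(1)[of k] N0 unfolding X_shift by (intro mult_left_mono) auto
  ultimately show ?thesis by (simp add: mult.assoc)
qed

text \<open>\<open>lam_le\<close> bounds the decay of \<open>lam\<close> by exactly the factor by
  which \<open>weight\<close> grows, so their product never decreases.\<close>

lemma lam_weight_lower: "weight 0 \<le> lam k * weight k"
proof (induction k)
  case (Suc k)
  have "lam k * weight k \<le> (real (q (k + 2)) ^ n * real (q (k + 2) * q (k + 1)) * lam (Suc k)) * weight k"
    using lam_le weight_pos[of k] by (intro mult_right_mono) auto
  also have "\<dots> = lam (Suc k) * weight (Suc k)" unfolding weight_Suc by (simp add: mult_ac)
  finally show ?case using Suc by linarith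
qed (simp add: lam_0)

text \<open>In one stage the product grows at most by the factor \<open>1 / (1 - e k)\<close> with
  \<open>e k = (n + 1) / q (k + 2)\<close>, and the sum of all \<open>e k\<close> is at most
  \<open>1 / 2\<close>.\<close>

lemma lam_weight_upper: "lam k * weight k \<le> 2 * weight 0"
proof -
  define e where "e = (\<lambda>k. real (n + 1) / real (q (k + 2)))"
  have e_sum: "(\<Sum>l<k. e l) \<le> 1 / 2" for k
  proof -
    have "(\<Sum>l<k. e l) = real (n + 1) * (\<Sum>l<k. 1 / real (q (l + 2)))"
      by (simp add: e_def sum_distrib_left)
    also have "\<dots> \<le> real (n + 1) * (1 / (2 * real (q 0)))"
      using sum_inverse_q by (intro mult_left_mono) auto
    also have "\<dots> \<le> 1 / 2" using q0 by (simp add: field_simps)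
    finally show ?thesis .
  qed
  have stp: "lam (Suc k) * weight (Suc k) * (1 - e k) \<le> lam k * weight k" for k
  proof -
    let ?N = "real (q (k + 2))" and ?M = "real (q (k + 2) * q (k + 1))"
    have N8: "8 \<le> ?N" using q_ge_real by simp
    have NM: "?N \<le> ?M"
      using mult_left_mono[of 1 "real (q (k + 1))" ?N] q_ge_real[of "k + 1"] by simp
    \<comment> \<open>Bernoulli's inequality for the \<open>n + 1\<close> factors
      \<open>1 - 1 / N\<close>, the last of which is replaced by the larger
      \<open>1 - 1 / M\<close>.\<close>
    have "1 - e k = 1 + real (n + 1) * (- 1 / ?N)" by (simp add: e_def)
    also have "\<dots> \<le> (1 + (- 1 / ?N)) ^ (n + 1)"
      using N8 by (intro Bernoulli_inequality) (simp add: field_simps)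
    also have "\<dots> = (1 - 1 / ?N) ^ n * (1 - 1 / ?N)" by simp
    also have "\<dots> \<le> (1 - 1 / ?N) ^ n * (1 - 1 / ?M)"
      using N8 NM by (intro mult_left_mono) (simp_all add: frac_le del: of_nat_mult)
    finally have "?N ^ n * ?M * (1 - e k) \<le> ?N ^ n * ?M * ((1 - 1 / ?N) ^ n * (1 - 1 / ?M))"
      by (intro mult_left_mono) auto
    also have "\<dots> = (?N * (1 - 1 / ?N)) ^ n * (?M * (1 - 1 / ?M))"
      by (simp add: power_mult_distrib mult_ac)
    also have "\<dots> = (?N - 1) ^ n * (?M - 1)"
    proof -
      have "?N * (1 - 1 / ?N) = ?N - 1" using N8 by (simp add: field_simps)
      moreover have "?M * (1 - 1 / ?M) = ?M - 1"
        using N8 NM by (simp add: right_diff_distrib del: of_nat_mult)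
      ultimately show ?thesis by simp
    qed
    finally have b: "?N ^ n * ?M * (1 - e k) \<le> (?N - 1) ^ n * (?M - 1)" .
    have "lam (Suc k) * weight (Suc k) * (1 - e k) = (?N ^ n * ?M * (1 - e k)) * lam (Suc k) * weight k"
      unfolding weight_Suc by (simp add: mult_ac)
    also have "\<dots> \<le> ((?N - 1) ^ n * (?M - 1)) * lam (Suc k) * weight k"
      using b lam_pos[of "Suc k"] weight_pos[of k] by (intro mult_right_mono) auto
    also have "\<dots> \<le> lam k * weight k"
      using lam_ge[of k] weight_pos[of k] by (intro mult_right_mono) auto
    finally show ?thesis .
  qed
  have e0: "0 \<le> e k" for k by (simp add: e_def)
  have lw: "0 < lam k * weight k" for k using lam_pos weight_pos by simp
  \<comment> \<open>The product of the factors \<open>1 - e l\<close> is at least 1 minus the sum of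
    the \<open>e l\<close>, here carried through the induction.\<close>
  have "lam k * weight k * (1 - (\<Sum>l<k. e l)) \<le> weight 0"
  proof (induction k)
    case (Suc k)
    let ?s = "\<Sum>l<k. e l" and ?u = "lam (Suc k) * weight (Suc k)"
    have s0: "0 \<le> ?s" using e0 by (simp add: sum_nonneg)
    have "1 - (?s + e k) \<le> (1 - e k) * (1 - ?s)"
      using mult_nonneg_nonneg[OF e0[of k] s0] by (simp add: algebra_simps)
    then have "?u * (1 - (?s + e k)) \<le> ?u * ((1 - e k) * (1 - ?s))"
      using lw[of "Suc k"] by (intro mult_left_mono) auto
    also have "\<dots> = ?u * (1 - e k) * (1 - ?s)" by simp
    also have "\<dots> \<le> lam k * weight k * (1 - ?s)"
      using stp e_sum[of k] by (intro mult_right_mono) auto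
    finally show ?case using Suc by simp
  qed (simp add: lam_0)
  moreover have "lam k * weight k * (1 / 2) \<le> lam k * weight k * (1 - (\<Sum>l<k. e l))"
    using e_sum[of k] lw[of k] by (intro mult_left_mono) auto
  ultimately show ?thesis by linarith
qed

section \<open>Comparison of norms\<close>

lemma unorm_L2: "unorm (n + 3) x = L2_set x {..<n + 2}"
  by (simp add: unorm_def L2_set_def add_2_eq_Suc')

lemma vnorm_L2: "vnorm (n + 3) x = L2_set x {..<n + 3}"
  by (simp add: vnorm_def L2_set_def)

lemma S2_eq: "real (S 2) = real (q 1) * real (S 1)"
  using S_Suc_real[of 1] by (simp add: numeral_2_eq_2)

lemma nrm_expand:
  "nrm x = real (S 2) * (\<Sum>i<n. \<bar>x i\<bar>) + real (S 1) * \<bar>x n + real (q 1) * x (n + 1)\<bar>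
    + real (S 2) * \<bar>x (n + 1)\<bar>"
proof -
  have "nrm x = (\<Sum>j=1..n. \<bar>U x j\<bar>) + \<bar>U x (n + 1)\<bar> + \<bar>U x (n + 2)\<bar>"
    by (simp add: nrm_def add_2_eq_Suc')
  also have "(\<Sum>j=1..n. \<bar>U x j\<bar>) = (\<Sum>i<n. \<bar>U x (Suc i)\<bar>)"
    by (simp add: sum.atLeast1_atMost_eq)
  also have "\<dots> = (\<Sum>i<n. real (S 2) * \<bar>x i\<bar>)"
    by (intro sum.cong) (auto simp: U_def abs_mult)
  finally show ?thesis by (simp add: U_def abs_mult sum_distrib_left add_2_eq_Suc')
qed

lemma unorm_le_nrm: "unorm (n + 3) x \<le> 2 * nrm x"
proof -
  let ?A = "\<Sum>i<n. \<bar>x i\<bar>" and ?w = "\<bar>x n + real (q 1) * x (n + 1)\<bar>"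
  have S1: "1 \<le> real (S 1)" "1 \<le> real (S 2)" using S_pos[of 1] S_pos[of 2] by simp_all
  have qS: "real (q 1) \<le> real (S 2)" unfolding S2_eq using S1 by (simp add: mult_le_cancel_left1)
  have "unorm (n + 3) x \<le> (\<Sum>i<n + 2. \<bar>x i\<bar>)"
    unfolding unorm_L2 by (rule L2_set_le_sum_abs)
  also have "\<dots> = ?A + \<bar>x n\<bar> + \<bar>x (n + 1)\<bar>" by (simp add: add_2_eq_Suc')
  also have "\<bar>x n\<bar> \<le> ?w + real (q 1) * \<bar>x (n + 1)\<bar>"
    using abs_triangle_ineq4[of "x n + real (q 1) * x (n + 1)" "real (q 1) * x (n + 1)"]
    by (simp add: abs_mult)
  also have "real (q 1) * \<bar>x (n + 1)\<bar> \<le> real (S 2) * \<bar>x (n + 1)\<bar>"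
    using qS by (intro mult_right_mono) auto
  finally have 1: "unorm (n + 3) x \<le> ?A + (?w + real (S 2) * \<bar>x (n + 1)\<bar>) + \<bar>x (n + 1)\<bar>" by simp
  have "0 \<le> ?A" by (simp add: sum_nonneg)
  then have "1 * ?A \<le> real (S 2) * ?A" "1 * ?w \<le> real (S 1) * ?w" "1 * \<bar>x (n + 1)\<bar> \<le> real (S 2) * \<bar>x (n + 1)\<bar>"
    using S1 by (intro mult_right_mono; simp)+
  moreover have "0 \<le> ?w" "0 \<le> \<bar>x (n + 1)\<bar>" by simp_all
  moreover have "u \<le> 2 * P + 2 * Q + 2 * R"
    if "u \<le> A + (w + R) + y" "1 * A \<le> P" "1 * w \<le> Q" "1 * y \<le> R" "0 \<le> A" "0 \<le> w" "0 \<le> y"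
    for A w y P Q R u :: real
    using that by linarith
  ultimately show ?thesis using 1 \<open>0 \<le> ?A\<close> unfolding nrm_expand distrib_left by blast
qed

text \<open>The comparison constant in \<open>nrm_le_unorm\<close>: \<open>n\<close>, 2 and 1
  multiples of \<open>S 2\<close> come from the three groups of coordinates in
  \<open>nrm_expand\<close>.\<close>

definition K :: real where
  "K = (real n + 3) * real (S 2)"

lemma K_ge_1: "1 \<le> K"
proof -
  have "1 * 1 \<le> (real n + 3) * real (S 2)"
    using S_pos[of 2] by (intro mult_mono) auto
  then show ?thesis by (simp add: K_def)
qed

lemma unorm_nonneg: "0 \<le> unorm (n + 3) x"
  by (simp add: unorm_L2)

lemma coordinate_le_unorm:
  assumes "i < n + 2"
  shows "\<bar>x i\<bar> \<le> unorm (n + 3) x"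
proof -
  have "(x i)\<^sup>2 \<le> (\<Sum>i<n + 2. (x i)\<^sup>2)" using assms by (intro member_le_sum) auto
  then have "sqrt ((x i)\<^sup>2) \<le> unorm (n + 3) x"
    unfolding unorm_L2 L2_set_def by (rule real_sqrt_le_mono)
  then show ?thesis by simp
qed

lemma nrm_le_unorm: "nrm x \<le> K * unorm (n + 3) x"
proof -
  let ?u = "unorm (n + 3) x"
  have m: "\<bar>x i\<bar> \<le> ?u" if "i < n + 2" for i
    using coordinate_le_unorm[OF that] .
  have "(\<Sum>i<n. \<bar>x i\<bar>) \<le> (\<Sum>i<n. ?u)" using m by (intro sum_mono) auto
  then have "real (S 2) * (\<Sum>i<n. \<bar>x i\<bar>) \<le> real (S 2) * (real n * ?u)"
    by (intro mult_left_mono) auto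
  moreover have "real (S 1) * \<bar>x n + real (q 1) * x (n + 1)\<bar> \<le> 2 * real (S 2) * ?u"
  proof -
    have "\<bar>x n + real (q 1) * x (n + 1)\<bar> \<le> \<bar>x n\<bar> + real (q 1) * \<bar>x (n + 1)\<bar>"
      using abs_triangle_ineq[of "x n" "real (q 1) * x (n + 1)"] by (simp add: abs_mult)
    also have "\<dots> \<le> ?u + real (q 1) * ?u" using m by (intro add_mono mult_left_mono) auto
    also have "\<dots> \<le> real (q 1) * ?u + real (q 1) * ?u"
      using q_ge_real[of 1] unorm_nonneg[of x] mult_right_mono[of 1 "real (q 1)" ?u] by simp
    finally have "real (S 1) * \<bar>x n + real (q 1) * x (n + 1)\<bar> \<le> real (S 1) * (2 * real (q 1) * ?u)"
      by (intro mult_left_mono) auto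
    then show ?thesis by (simp add: S2_eq mult_ac)
  qed
  moreover have "real (S 2) * \<bar>x (n + 1)\<bar> \<le> real (S 2) * ?u" using m by (intro mult_left_mono) auto
  ultimately show ?thesis unfolding nrm_expand K_def by (simp add: algebra_simps)
qed

lemma unorm_scale: "unorm (n + 3) (\<lambda>t. b * x t) = \<bar>b\<bar> * unorm (n + 3) x"
  by (simp add: unorm_def power_mult_distrib sum_distrib_left[symmetric] real_sqrt_mult)

lemma vnorm_scale: "vnorm (n + 3) (\<lambda>t. b * x t) = \<bar>b\<bar> * vnorm (n + 3) x"
  by (simp add: vnorm_def power_mult_distrib sum_distrib_left[symmetric] real_sqrt_mult)

lemma unorm_le_vnorm: "unorm (n + 3) x \<le> vnorm (n + 3) x"
  unfolding unorm_def vnorm_def by (intro real_sqrt_le_mono sum_mono2) auto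

text \<open>The last coefficient of the form is 1, so the last component of \<open>z\<close> is
  \<open>L z\<close> minus a combination of the others.\<close>

lemma vnorm_le_L:
  "vnorm (n + 3) (rv z) \<le> \<bar>L z\<bar> + (1 + (\<Sum>i<n + 2. \<bar>a i\<bar>)) * unorm (n + 3) (rv z)"
proof -
  let ?u = "unorm (n + 3) (rv z)" and ?l = "of_int (z (n + 2)) :: real"
  have m: "\<bar>of_int (z i)\<bar> \<le> ?u" if "i < n + 2" for i
    using coordinate_le_unorm[OF that, of "rv z"] by (simp add: rv_def)
  have d3: "{..<n + 3} = insert (n + 2) {..<n + 2}" by auto
  have "L z = ?l + (\<Sum>i<n + 2. a i * of_int (z i))"
    using a_pi unfolding Lform_def d3 by (simp add: pi_d_def add_2_eq_Suc')
  moreover have "\<bar>\<Sum>i<n + 2. a i * of_int (z i)\<bar> \<le> (\<Sum>i<n + 2. \<bar>a i\<bar>) * ?u"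
  proof -
    have "\<bar>\<Sum>i<n + 2. a i * of_int (z i)\<bar> \<le> (\<Sum>i<n + 2. \<bar>a i * of_int (z i)\<bar>)" by (rule sum_abs)
    also have "\<dots> \<le> (\<Sum>i<n + 2. \<bar>a i\<bar> * ?u)"
      unfolding abs_mult using m by (intro sum_mono mult_left_mono) auto
    finally show ?thesis by (simp add: sum_distrib_right)
  qed
  ultimately have "\<bar>?l\<bar> \<le> \<bar>L z\<bar> + (\<Sum>i<n + 2. \<bar>a i\<bar>) * ?u" by linarith
  moreover have "vnorm (n + 3) (rv z) = sqrt (?l\<^sup>2 + ?u\<^sup>2)"
    unfolding vnorm_L2 unorm_L2 L2_set_def d3 by (simp add: sum_nonneg rv_def)
  moreover have "\<dots> \<le> \<bar>?l\<bar> + \<bar>?u\<bar>" by (rule sqrt_sum_squares_le_sum_abs)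
  ultimately show ?thesis using unorm_nonneg[of "rv z"] by (simp add: algebra_simps)
qed

lemma one_le_sqrt_sum_squares:
  fixes z :: "nat \<Rightarrow> int"
  assumes "finite A" "i \<in> A" "z i \<noteq> 0"
  shows "1 \<le> sqrt (\<Sum>i\<in>A. (rv z i)\<^sup>2)"
proof -
  have "0 < (z i)\<^sup>2" using assms(3) by simp
  then have "1 \<le> (z i)\<^sup>2" by linarith
  then have "1 \<le> (rv z i)\<^sup>2" unfolding rv_def by (metis of_int_1_le_iff of_int_power)
  also have "\<dots> \<le> (\<Sum>i\<in>A. (rv z i)\<^sup>2)" using assms by (intro member_le_sum) auto
  finally show ?thesis by simp
qed

lemma vnorm_ge_1: "z \<in> zvecs (n + 3) \<Longrightarrow> z \<noteq> (\<lambda>_. 0) \<Longrightarrow> 1 \<le> vnorm (n + 3) (rv z)"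
  using one_le_sqrt_sum_squares[of "{..<n + 3}" _ z] unfolding vnorm_def zvecs_def
  by (metis (mono_tags, lifting) finite_lessThan lessThan_iff mem_Collect_eq not_less)

lemma unorm_ge_1: "unorm (n + 3) (rv z) \<noteq> 0 \<Longrightarrow> 1 \<le> unorm (n + 3) (rv z)"
proof -
  assume "unorm (n + 3) (rv z) \<noteq> 0"
  then obtain i where "i < n + 2" "z i \<noteq> 0"
    unfolding unorm_L2 L2_set_eq_0_iff[OF finite_lessThan] by (auto simp: rv_def)
  then show ?thesis
    using one_le_sqrt_sum_squares[of "{..<n + 2}" i z] by (simp add: unorm_L2 L2_set_def)
qed

lemma nrm_V_le: "nrm (rv (V k)) \<le> 2 * real (S k)"
  using nrm_C_le[of 0 k] by (simp add: V_def scale_def)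

text \<open>\<open>V (k + 1)\<close> is the basis vector of index \<open>n + 1\<close> at stage
  \<open>k\<close>, so \<open>nrm_lower\<close> applies with a single coefficient 1.
  \<open>V 0\<close> is the last unit vector and has \<open>nrm\<close> 0, so the bound has to start
  at \<open>V 1\<close>.\<close>

lemma nrm_V_ge: "real (S (Suc k)) \<le> 2 * nrm (rv (V (Suc k)))"
proof -
  have "rv (V (k + 1)) = (\<lambda>t. \<Sum>i\<le>n + 2. (if i = n + 1 then 1 else 0) * rv (C k i) t)"
    by (simp add: V_shift[symmetric] if_distrib[of "\<lambda>x. x * _"] cong: if_cong del: One_nat_def)
  from nrm_lower[OF this] have "(\<Sum>i=1..n + 2. \<bar>if i = n + 1 then 1 else 0\<bar> * scale k i) \<le> 2 * nrm (rv (V (k + 1)))"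
    by simp
  moreover have "(\<Sum>i=1..n + 2. \<bar>if i = n + 1 then 1 else 0\<bar> * scale k i)
      = (\<Sum>i=1..n + 2. if i = n + 1 then scale k i else 0)"
    by (intro sum.cong) auto
  ultimately show ?thesis by (simp add: scale_def)
qed

text \<open>Nearly, \<open>p\<close> is \<open>s\<close> times the unit vector at
  \<open>n + 1\<close> and \<open>r\<close> is \<open>s'\<close> times the one at
  \<open>n + 2\<close>. The product of differences is then at most \<open>- 49 / 64\<close> of
  \<open>s * s'\<close>, while the other terms add at most \<open>10 / 64\<close> of it.\<close>

lemma obtuse_coordinates:
  fixes p r :: "nat \<Rightarrow> real"
  assumes p: "(\<Sum>j=1..n + 2. \<bar>p j - s * (if j = n + 1 then 1 else 0)\<bar>) \<le> s / 8"
    and r: "(\<Sum>j=1..n + 2. \<bar>r j - s' * (if j = n + 2 then 1 else 0)\<bar>) \<le> s' / 8"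
    and "0 < s" "0 < s'" "0 \<le> c" "c \<le> 1"
  shows "c * ((\<Sum>j=1..n. p j * r j) + p (n + 2) * r (n + 2))
    + (p (n + 1) - p (n + 2)) * (r (n + 1) - r (n + 2)) \<le> 0"
proof -
  have split: "(\<Sum>j=1..n + 2. f j) = (\<Sum>j=1..n. f j) + f (n + 1) + f (n + 2)" for f :: "nat \<Rightarrow> real"
    by (simp add: add_2_eq_Suc')
  have "(\<Sum>j=1..n. \<bar>p j - s * (if j = n + 1 then 1 else 0)\<bar>) = (\<Sum>j=1..n. \<bar>p j\<bar>)"
    "(\<Sum>j=1..n. \<bar>r j - s' * (if j = n + 2 then 1 else 0)\<bar>) = (\<Sum>j=1..n. \<bar>r j\<bar>)"
    by (intro sum.cong; simp)+
  then have p': "(\<Sum>j=1..n. \<bar>p j\<bar>) + \<bar>p (n + 1) - s\<bar> + \<bar>p (n + 2)\<bar> \<le> s / 8"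
    and r': "(\<Sum>j=1..n. \<bar>r j\<bar>) + \<bar>r (n + 1)\<bar> + \<bar>r (n + 2) - s'\<bar> \<le> s' / 8"
    using p r unfolding split by simp_all
  have n0: "0 \<le> (\<Sum>j=1..n. \<bar>p j\<bar>)" "0 \<le> (\<Sum>j=1..n. \<bar>r j\<bar>)" by (simp_all add: sum_nonneg)
  have "(\<Sum>j=1..n. p j * r j) \<le> (\<Sum>j=1..n. s / 8 * \<bar>r j\<bar>)"
  proof (intro sum_mono)
    fix j assume "j \<in> {1..n}"
    then have "\<bar>p j\<bar> \<le> (\<Sum>j=1..n. \<bar>p j\<bar>)" by (intro member_le_sum) auto
    then have "\<bar>p j\<bar> \<le> s / 8" using p' by linarith
    then have "\<bar>p j\<bar> * \<bar>r j\<bar> \<le> s / 8 * \<bar>r j\<bar>" by (intro mult_right_mono) auto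
    then show "p j * r j \<le> s / 8 * \<bar>r j\<bar>" using abs_ge_self[of "p j * r j"] by (simp add: abs_mult)
  qed
  also have "\<dots> = s / 8 * (\<Sum>j=1..n. \<bar>r j\<bar>)" by (simp add: sum_distrib_left)
  also have "\<dots> \<le> s / 8 * (s' / 8)" using r' n0 assms by (intro mult_left_mono) linarith+
  finally have 1: "(\<Sum>j=1..n. p j * r j) \<le> s * s' / 64" by simp
  have "\<bar>p (n + 2)\<bar> * \<bar>r (n + 2)\<bar> \<le> s / 8 * (9 * s' / 8)"
    using p' r' n0 assms by (intro mult_mono) linarith+
  then have 2: "p (n + 2) * r (n + 2) \<le> 9 * (s * s') / 64"
    using abs_ge_self[of "p (n + 2) * r (n + 2)"] by (simp add: abs_mult)
  have "7 * s / 8 * (7 * s' / 8) \<le> (p (n + 1) - p (n + 2)) * (r (n + 2) - r (n + 1))"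
    using p' r' n0 assms by (intro mult_mono) linarith+
  then have 3: "(p (n + 1) - p (n + 2)) * (r (n + 1) - r (n + 2)) \<le> - (49 * (s * s') / 64)"
    by (simp add: algebra_simps)
  have ss: "0 < s * s'" using assms by simp
  have "c * ((\<Sum>j=1..n. p j * r j) + p (n + 2) * r (n + 2)) \<le> c * (10 * (s * s') / 64)"
    using 1 2 assms by (intro mult_left_mono) auto
  also have "\<dots> \<le> 1 * (10 * (s * s') / 64)" using ss assms by (intro mult_right_mono) auto
  finally show ?thesis using 3 ss by linarith
qed

text \<open>Because \<open>S 2 = q 1 * S 1\<close>, the component \<open>x n\<close> is the
  difference of the last two \<open>U\<close> coordinates divided by \<open>S 1\<close>. The
  negative contribution that makes the angle obtuse comes from this difference.\<close>

lemma inner_U: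
  "(real (S 1))\<^sup>2 * (\<Sum>i<n + 2. x i * y i) =
    (real (S 1) / real (S 2))\<^sup>2 * ((\<Sum>j=1..n. U x j * U y j) + U x (n + 2) * U y (n + 2))
    + (U x (n + 1) - U x (n + 2)) * (U y (n + 1) - U y (n + 2))"
proof -
  have p: "0 < real (S 1)" "0 < real (S 2)" by (simp_all add: S_pos)
  have "(\<Sum>j=1..n. U x j * U y j) = (\<Sum>i<n. U x (Suc i) * U y (Suc i))"
    by (simp add: sum.atLeast1_atMost_eq)
  also have "\<dots> = (\<Sum>i<n. (real (S 2))\<^sup>2 * (x i * y i))"
    by (intro sum.cong) (auto simp: U_def power2_eq_square)
  also have "\<dots> = (real (S 2))\<^sup>2 * (\<Sum>i<n. x i * y i)" by (simp add: sum_distrib_left)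
  finally have 1: "(\<Sum>j=1..n. U x j * U y j) = (real (S 2))\<^sup>2 * (\<Sum>i<n. x i * y i)" .
  have 2: "U x (n + 2) = real (S 2) * x (n + 1)" for x by (simp add: U_def)
  have 3: "U x (n + 1) - U x (n + 2) = real (S 1) * x n" for x
    by (simp add: U_def S2_eq algebra_simps)
  have 4: "(\<Sum>i<n + 2. x i * y i) = (\<Sum>i<n. x i * y i) + x n * y n + x (n + 1) * y (n + 1)"
    by (simp add: add_2_eq_Suc')
  show ?thesis unfolding 1 3 4 unfolding 2 using p by (simp add: field_simps power2_eq_square)
qed

lemma V_obtuse: "(\<Sum>i<n + 2. rv (V (k + 1)) i * rv (V (k + 2)) i) \<le> 0"
proof -
  let ?p = "U (rv (V (k + 1)))" and ?r = "U (rv (V (k + 2)))"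
  have d1: "(\<Sum>j=1..n + 2. \<bar>?p j - real (S (k + 1)) * (if j = perm k (n + 1) then 1 else 0)\<bar>) \<le> real (S (k + 1)) / 8"
    using dev_bound[of "n + 1" k] unfolding dev_def V_shift by (simp add: scale_def)
  have d2: "(\<Sum>j=1..n + 2. \<bar>?r j - real (S (k + 2)) * (if j = perm k (n + 2) then 1 else 0)\<bar>) \<le> real (S (k + 2)) / 8"
    using dev_bound[of "n + 2" k] unfolding dev_def V_shift by (simp add: scale_def)
  have c: "0 \<le> (real (S 1) / real (S 2))\<^sup>2" "(real (S 1) / real (S 2))\<^sup>2 \<le> 1"
    using S_mono[of 1 2] S_pos[of 2] by (auto simp: power_le_one)
  have "(real (S 1))\<^sup>2 * (\<Sum>i<n + 2. rv (V (k + 1)) i * rv (V (k + 2)) i) \<le> 0"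
  proof (cases "even k")
    case True
    then have "perm k (n + 1) = n + 1" "perm k (n + 2) = n + 2" by (simp_all add: perm_def)
    then show ?thesis
      using obtuse_coordinates[OF d1[unfolded \<open>perm k (n + 1) = n + 1\<close>] d2[unfolded \<open>perm k (n + 2) = n + 2\<close>] _ _ c] S_pos
      unfolding inner_U by simp
  next
    case False
    then have pe: "perm k (n + 1) = n + 2" "perm k (n + 2) = n + 1" by (simp_all add: perm_def)
    have "(real (S 1))\<^sup>2 * (\<Sum>i<n + 2. rv (V (k + 2)) i * rv (V (k + 1)) i) \<le> 0"
      using obtuse_coordinates[OF d2[unfolded pe] d1[unfolded pe] _ _ c] S_pos
      unfolding inner_U by simp
    then show ?thesis by (simp add: mult.commute)
  qed
  then show ?thesis using S_pos[of 1] by (simp add: mult_le_0_iff)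
qed

text \<open>With a nonpositive inner product and coefficients of opposite sign the mixed term is
  nonnegative, so the squared length is at least that of \<open>c\<close> times the second vector,
  and \<open>c\<close> is a nonzero integer.\<close>

lemma unorm_V_diff_ge:
  fixes b c :: int
  assumes "b * c < 0"
  shows "unorm (n + 3) (rv (V (k + 2))) \<le> unorm (n + 3) (rv (\<lambda>t. b * V (k + 1) t + c * V (k + 2) t))"
proof -
  let ?x = "rv (V (k + 1))" and ?y = "rv (V (k + 2))"
  have c1: "1 \<le> c\<^sup>2"
    using assms by (auto simp: power2_eq_square int_one_le_iff_zero_less zero_less_mult_iff)
      (metis linorder_neqE_linordered_idom mult_zero_right)
  have "(\<Sum>i<n + 2. (rv (\<lambda>t. b * V (k + 1) t + c * V (k + 2) t) i)\<^sup>2)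
      = (of_int b)\<^sup>2 * (\<Sum>i<n + 2. (?x i)\<^sup>2) + 2 * of_int (b * c) * (\<Sum>i<n + 2. ?x i * ?y i)
        + (of_int c)\<^sup>2 * (\<Sum>i<n + 2. (?y i)\<^sup>2)"
    unfolding sum_distrib_left sum.distrib[symmetric]
    by (intro sum.cong) (auto simp: rv_def power2_eq_square algebra_simps)
  moreover have "0 \<le> (of_int b)\<^sup>2 * (\<Sum>i<n + 2. (?x i)\<^sup>2)" by (simp add: sum_nonneg)
  moreover have "0 \<le> 2 * of_int (b * c) * (\<Sum>i<n + 2. ?x i * ?y i)"
    using V_obtuse[of k] assms by (intro mult_nonpos_nonpos) (auto simp del: of_int_mult)
  moreover have "1 * (\<Sum>i<n + 2. (?y i)\<^sup>2) \<le> (of_int c)\<^sup>2 * (\<Sum>i<n + 2. (?y i)\<^sup>2)"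
    using c1 by (intro mult_right_mono) (auto simp: sum_nonneg simp flip: of_int_power)
  ultimately show ?thesis
    unfolding unorm_L2 L2_set_def by (intro real_sqrt_le_mono) linarith
qed

section \<open>Best approximation vectors\<close>

lemma V_in_zvecs: "V k \<in> zvecs (n + 3)"
  by (simp add: V_def C_in_zvecs)

lemma unorm_V_le: "unorm (n + 3) (rv (V k)) \<le> 4 * real (S k)"
  using unorm_le_nrm[of "rv (V k)"] nrm_V_le[of k] by linarith

lemma unorm_V_ge: "real (S (Suc k)) \<le> 2 * K * unorm (n + 3) (rv (V (Suc k)))"
  using nrm_V_ge[of k] nrm_le_unorm[of "rv (V (Suc k))"] by simp

lemma unorm_V_pos: "0 < unorm (n + 3) (rv (V (Suc k)))"
proof -
  have "0 < 2 * K * unorm (n + 3) (rv (V (Suc k)))"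
    using unorm_V_ge[of k] S_pos[of "Suc k"] by linarith
  then show ?thesis using K_ge_1 by (simp add: zero_less_mult_iff)
qed

lemma unorm_multiple:
  "unorm (n + 3) (rv (\<lambda>t. b * z t)) = \<bar>of_int b\<bar> * unorm (n + 3) (rv z)"
  using unorm_scale[of "of_int b" "rv z"] by (simp add: rv_def)

lemma vnorm_multiple:
  "vnorm (n + 3) (rv (\<lambda>t. b * z t)) = \<bar>of_int b\<bar> * vnorm (n + 3) (rv z)"
  using vnorm_scale[of "of_int b" "rv z"] by (simp add: rv_def)

lemma abs_L_multiple: "\<bar>L (\<lambda>t. b * V k t)\<bar> = \<bar>of_int b\<bar> * lam k"
  using lam_pos[of k] by (simp add: L_scale lam_def abs_mult)

lemma lam_antimono: "k \<le> l \<Longrightarrow> lam l \<le> lam k"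
proof (induction rule: dec_induct)
  case (step l)
  then show ?case using lam_decay[of l] lam_pos[of "l + 1"] by simp
qed simp

text \<open>The assumption on \<open>q (k + 1)\<close> puts every vector no longer than
  \<open>V (k + 1)\<close> below the threshold of \<open>dichotomy_multiple\<close>. Competitors are
  thus multiples of \<open>V (k + 1)\<close>, which are not shorter, or have a form value strictly
  larger than \<open>lam (k + 1)\<close>.\<close>

lemma V_best:
  assumes "64 * K < real (q (k + 1))"
  shows "best_approx (n + 3) a (V (k + 1))"
proof -
  let ?V = "V (k + 1)"
  have up: "0 < unorm (n + 3) (rv ?V)" using unorm_V_pos[of k] by simp
  have key: "(\<exists>b. b \<noteq> 0 \<and> z = (\<lambda>t. b * ?V t)) \<or> lam (k + 1) < \<bar>L z\<bar>"
    if z: "z \<in> zvecs (n + 3)" "0 < unorm (n + 3) (rv z)" "unorm (n + 3) (rv z) \<le> unorm (n + 3) (rv ?V)" for z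
  proof -
    have "nrm (rv z) \<le> K * unorm (n + 3) (rv z)" by (rule nrm_le_unorm)
    also have "\<dots> \<le> K * (4 * real (S (k + 1)))"
      using z(3) unorm_V_le[of "k + 1"] K_ge_1 by (intro mult_left_mono) auto
    finally have "16 * nrm (rv z) \<le> 64 * K * real (S (k + 1))" by simp
    also have "\<dots> < real (q (k + 1)) * real (S (k + 1))"
      using assms S_pos[of "k + 1"] by (intro mult_strict_right_mono) auto
    also have "\<dots> = real (S (k + 2))" using S_Suc_real[of "k + 1"] by (simp add: add_2_eq_Suc')
    finally have "(\<exists>b. z = (\<lambda>t. b * ?V t)) \<or> lam k / 2 \<le> \<bar>L z\<bar>"
      using dichotomy_multiple[OF z(1)] by blast
    moreover have "b \<noteq> 0" if "z = (\<lambda>t. b * ?V t)" for b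
      using z(2) unfolding that unorm_multiple by auto
    moreover have "lam (k + 1) < lam k / 2"
      using lam_decay[of k] lam_pos[of "k + 1"] by linarith
    ultimately show ?thesis by (metis less_le_trans)
  qed
  have absV: "\<bar>L ?V\<bar> = lam (k + 1)" using lam_pos[of "k + 1"] by (simp add: lam_def)
  have b1: "1 \<le> \<bar>of_int b :: real\<bar>" if "b \<noteq> 0" for b :: int using that by linarith
  show ?thesis
    unfolding best_approx_def
  proof (intro conjI ballI impI V_in_zvecs)
    show "unorm (n + 3) (rv ?V) \<noteq> 0" using up by simp
  next
    fix z assume "z \<in> zvecs (n + 3)" "0 < unorm (n + 3) (rv z) \<and> unorm (n + 3) (rv z) \<le> unorm (n + 3) (rv ?V)"
    then consider b where "b \<noteq> 0" "z = (\<lambda>t. b * ?V t)" | "lam (k + 1) < \<bar>L z\<bar>" using key by blast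
    then show "\<bar>L ?V\<bar> \<le> \<bar>L z\<bar>"
    proof cases
      case 1
      have "1 * lam (k + 1) \<le> \<bar>of_int b\<bar> * lam (k + 1)"
        using b1[OF 1(1)] lam_pos[of "k + 1"] by (intro mult_right_mono) auto
      then show ?thesis unfolding absV 1(2) abs_L_multiple by simp
    qed (use absV in simp)
  next
    fix z assume z: "z \<in> zvecs (n + 3)" "0 < unorm (n + 3) (rv z) \<and> unorm (n + 3) (rv z) < unorm (n + 3) (rv ?V)"
    then consider b where "b \<noteq> 0" "z = (\<lambda>t. b * ?V t)" | "lam (k + 1) < \<bar>L z\<bar>"
      using key[of z] by auto
    then show "\<bar>L ?V\<bar> < \<bar>L z\<bar>"
    proof cases
      case 1
      have "1 * unorm (n + 3) (rv ?V) \<le> unorm (n + 3) (rv z)"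
        unfolding 1(2) unorm_multiple using b1[OF 1(1)] up by (intro mult_right_mono) auto
      then show ?thesis using z by simp
    qed (use absV in simp)
  qed
qed

text \<open>If the factor were at least 2 in absolute value, the strictly shorter
  \<open>V (Suc k)\<close> would need a strictly larger value of the form, but its value is
  smaller.\<close>

lemma best_multiple_of_V:
  assumes "best_approx (n + 3) a z" "z = (\<lambda>t. b * V (Suc k) t)"
  shows "\<bar>b\<bar> = 1"
proof (rule ccontr)
  assume "\<bar>b\<bar> \<noteq> 1"
  moreover have "b \<noteq> 0" using assms unfolding best_approx_def assms(2) unorm_multiple by auto
  ultimately have b2: "2 \<le> \<bar>of_int b :: real\<bar>" by linarith
  have "2 * unorm (n + 3) (rv (V (Suc k))) \<le> unorm (n + 3) (rv z)"
    unfolding assms(2) unorm_multiple using b2 unorm_V_pos[of k] by (intro mult_right_mono) auto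
  then have "unorm (n + 3) (rv (V (Suc k))) < unorm (n + 3) (rv z)" using unorm_V_pos[of k] by linarith
  then have "\<bar>L z\<bar> < \<bar>L (V (Suc k))\<bar>"
    using assms(1) unorm_V_pos[of k] V_in_zvecs unfolding best_approx_def by blast
  then have "\<bar>of_int b\<bar> * lam (Suc k) < lam (Suc k)"
    using lam_pos[of "Suc k"] unfolding assms(2) abs_L_multiple by (simp add: lam_def)
  moreover have "2 * lam (Suc k) \<le> \<bar>of_int b\<bar> * lam (Suc k)"
    using b2 lam_pos[of "Suc k"] by (intro mult_right_mono) auto
  ultimately show False using lam_pos[of "Suc k"] by linarith
qed

text \<open>Minimality against \<open>V (k + 1)\<close> forces \<open>z\<close> into the plane of
  \<open>V (k + 1)\<close> and \<open>V (k + 2)\<close>. It remains to exclude two nonzero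
  coefficients: with equal signs the values add up beyond \<open>lam (k + 1)\<close>, with opposite
  signs the obtuse angle makes \<open>z\<close> as long as \<open>V (k + 2)\<close>, whose value is
  far smaller.\<close>

lemma best_is_V:
  assumes best: "best_approx (n + 3) a z"
    and lo: "real (S (k + 2)) \<le> 16 * nrm (rv z)" and hi: "16 * nrm (rv z) \<le> real (S (k + 3))"
    and q: "64 * K < real (q (k + 1))"
  shows "\<exists>s j. \<bar>s\<bar> = 1 \<and> k < j \<and> j \<le> k + 2 \<and> z = (\<lambda>t. s * V j t)"
proof -
  have z: "z \<in> zvecs (n + 3)" and min: "\<And>z'. z' \<in> zvecs (n + 3) \<Longrightarrow> 0 < unorm (n + 3) (rv z') \<Longrightarrow>
      unorm (n + 3) (rv z') \<le> unorm (n + 3) (rv z) \<Longrightarrow> \<bar>L z\<bar> \<le> \<bar>L z'\<bar>"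
    and z0: "unorm (n + 3) (rv z) \<noteq> 0"
    using best unfolding best_approx_def by blast+
  have Ll: "\<bar>L (V j)\<bar> = lam j" for j using lam_pos[of j] by (simp add: lam_def)
  \<comment> \<open>The lower bound on \<open>nrm\<close> makes \<open>z\<close> at least as long as
    \<open>V (k + 1)\<close>, which may therefore be compared with it.\<close>
  have "64 * K * real (S (k + 1)) \<le> real (q (k + 1)) * real (S (k + 1))"
    using q by (intro mult_right_mono) auto
  also have "\<dots> = real (S (k + 2))" using S_Suc_real[of "k + 1"] by (simp add: add_2_eq_Suc')
  also have "\<dots> \<le> 16 * (K * unorm (n + 3) (rv z))" using lo nrm_le_unorm[of "rv z"] by linarith
  finally have "K * (4 * real (S (k + 1))) \<le> K * unorm (n + 3) (rv z)" by simp
  then have "4 * real (S (k + 1)) \<le> unorm (n + 3) (rv z)" using K_ge_1 by simp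
  then have "unorm (n + 3) (rv (V (k + 1))) \<le> unorm (n + 3) (rv z)"
    using unorm_V_le[of "k + 1"] by linarith
  then have Lz: "\<bar>L z\<bar> \<le> lam (k + 1)"
    using min[OF V_in_zvecs, of "k + 1"] unorm_V_pos[of k] Ll[of "k + 1"] by simp
  then obtain b c where bc: "z = (\<lambda>t. b * V (k + 1) t + c * V (k + 2) t)"
    "\<bar>of_int c\<bar> * real (S (k + 2)) \<le> 2 * nrm (rv z)"
    using dichotomy_two_dim[OF z hi] by force
  consider "c = 0" | "b = 0" | "b \<noteq> 0" "c \<noteq> 0" by blast
  then show ?thesis
  proof cases
    case 1
    then have "z = (\<lambda>t. b * V (Suc k) t)" using bc by simp
    with best_multiple_of_V[OF best this] show ?thesis by (intro exI[of _ b] exI[of _ "Suc k"]) auto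
  next
    case 2
    then have "z = (\<lambda>t. c * V (Suc (k + 1)) t)" using bc by (simp add: add_2_eq_Suc')
    with best_multiple_of_V[OF best this] show ?thesis
      by (intro exI[of _ c] exI[of _ "Suc (k + 1)"]) auto
  next
    case 3
    have lp: "0 < lam (k + 1)" "0 < lam (k + 2)" by (simp_all add: lam_pos)
    \<comment> \<open>The length of \<open>z\<close> keeps \<open>|c|\<close> below
      \<open>q (k + 2) / 8\<close>, so the second summand of \<open>L z\<close> is at most
      \<open>lam (k + 1) / 8\<close> and cannot cancel the first.\<close>
    have "16 * (\<bar>of_int c\<bar> * real (S (k + 2))) \<le> 2 * (real (q (k + 2)) * real (S (k + 2)))"
      using bc(2) hi unfolding S_shift(1) by linarith
    then have "(8 * \<bar>of_int c\<bar>) * real (S (k + 2)) \<le> real (q (k + 2)) * real (S (k + 2))" by linarith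
    then have c8: "8 * \<bar>of_int c\<bar> \<le> real (q (k + 2))"
      using S_pos[of "k + 2"] mult_le_cancel_right_pos[of "real (S (k + 2))"] by simp
    have "real (q (k + 2)) \<le> real (q (k + 3) * q (k + 2)) - 1"
    proof -
      have "8 * real (q (k + 2)) \<le> real (q (k + 3)) * real (q (k + 2))"
        using q_ge_real[of "k + 3"] by (intro mult_right_mono) auto
      then show ?thesis using q_ge_real[of "k + 2"] unfolding of_nat_mult by linarith
    qed
    then have "8 * \<bar>of_int c\<bar> * lam (k + 2) \<le> (real (q (k + 3) * q (k + 2)) - 1) * lam (k + 2)"
      using c8 lp by (intro mult_right_mono) auto
    also have "\<dots> \<le> X (k + 1) n"
      using X_bounds_last(1)[of "k + 1"] X_shift(2)[of "k + 1"] by (simp add: add_2_eq_Suc' numeral_3_eq_3)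
    also have "\<dots> \<le> lam (k + 1)"
      using chain_antimono[OF X_chain, of 0 n "k + 1"] X_shift(1)[of "k + 1"] by simp
    finally have small: "8 * (\<bar>of_int c\<bar> * lam (k + 2)) \<le> lam (k + 1)" by simp
    have Leq: "L z = of_int b * lam (k + 1) + of_int c * lam (k + 2)"
      unfolding bc(1) L_lincomb lam_def ..
    have absb: "1 * lam (k + 1) \<le> \<bar>of_int b\<bar> * lam (k + 1)"
      using 3 lp by (intro mult_right_mono) auto
    have absc: "0 < \<bar>of_int c\<bar> * lam (k + 2)" using 3 lp by simp
    show ?thesis
    proof (cases "b * c < 0")
      case True
      have "unorm (n + 3) (rv (V (k + 2))) \<le> unorm (n + 3) (rv z)"
        unfolding bc(1) by (rule unorm_V_diff_ge[OF True])
      then have "\<bar>L z\<bar> \<le> lam (k + 2)"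
        using min[OF V_in_zvecs, of "k + 2"] unorm_V_pos[of "k + 1"] Ll[of "k + 2"]
        by (simp add: add_2_eq_Suc')
      moreover have "\<bar>of_int b\<bar> * lam (k + 1) - \<bar>of_int c\<bar> * lam (k + 2) \<le> \<bar>L z\<bar>"
        using abs_triangle_ineq2[of "of_int b * lam (k + 1)" "- (of_int c * lam (k + 2))"] lp
        unfolding Leq by (simp add: abs_mult)
      moreover have "63 * lam (k + 2) \<le> lam (k + 1)"
        using lam_decay[of "k + 1"] by (simp add: add_2_eq_Suc')
      ultimately show ?thesis using small absb lp by linarith
    next
      case False
      then have "b * c > 0" using 3 by (simp add: less_le)
      then have "\<bar>L z\<bar> = \<bar>of_int b\<bar> * lam (k + 1) + \<bar>of_int c\<bar> * lam (k + 2)"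
        unfolding Leq using lp
        by (auto simp: zero_less_mult_iff add_pos_pos add_neg_neg mult_neg_pos abs_of_neg)
      then show ?thesis using Lz absb absc by linarith
    qed
  qed
qed

lemma S_unbounded: "k \<le> S k"
proof (induction k)
  case (Suc k)
  have "2 * S k \<le> q k * S k" using q_ge[of k] by (intro mult_right_mono) auto
  then show ?case using Suc S_pos[of k] unfolding S_Suc by linarith
qed simp

lemma S_level:
  assumes "real (S k0) \<le> r"
  obtains k where "k0 \<le> k" "real (S k) \<le> r" "r < real (S (Suc k))"
proof -
  obtain m where m: "r < real m" using reals_Archimedean2 by blast
  have ex: "r < real (S m)" using m S_unbounded[of m] by (meson less_le_trans of_nat_le_iff)
  define l where "l = (LEAST l. r < real (S l))"
  have l: "r < real (S l)" unfolding l_def by (rule LeastI[of "\<lambda>l. r < real (S l)", OF ex])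
  have lmin: "\<And>j. j < l \<Longrightarrow> real (S j) \<le> r" unfolding l_def using not_less_Least by fastforce
  have "k0 < l"
    using l assms S_mono[of l k0] by (meson leD le_less_trans not_le of_nat_le_iff order_trans)
  then obtain k where "l = Suc k" "k0 \<le> k" by (cases l) auto
  then show ?thesis using that[of k] l lmin[of k] by auto
qed

lemma large_best_is_V:
  assumes best: "best_approx (n + 3) a z" and q: "64 * K < real (q (k0 + 1))"
    and "real (S (k0 + 2)) \<le> 16 * nrm (rv z)"
  shows "\<exists>s j. \<bar>s\<bar> = 1 \<and> k0 < j \<and> z = (\<lambda>t. s * V j t)"
proof -
  obtain k where k: "k0 + 2 \<le> k" "real (S k) \<le> 16 * nrm (rv z)" "16 * nrm (rv z) < real (S (Suc k))"
    using S_level[OF assms(3)] .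
  define k' where "k' = k - 2"
  have k': "k = k' + 2" "Suc k = k' + 3" "k0 \<le> k'" using k(1) by (auto simp: k'_def)
  have "real (q (k0 + 1)) \<le> real (q (k' + 1))" using q_mono[of "k0 + 1" "k' + 1"] k' by simp
  then have "64 * K < real (q (k' + 1))" using q by linarith
  then obtain s j where "\<bar>s\<bar> = 1" "k' < j" "z = (\<lambda>t. s * V j t)"
    using best_is_V[OF best k(2)[unfolded k'(1)] less_imp_le[OF k(3)[unfolded k'(2)]]] by blast
  with k'(3) show ?thesis by (intro exI[of _ s] exI[of _ j]) auto
qed

lemma exists_large_q: "\<exists>k0. \<forall>k\<ge>k0. 64 * K < real (q (k + 1))"
proof -
  have "eventually (\<lambda>k. 64 * K < real (q k)) sequentially"
    using q_at_top by (simp add: filterlim_at_top_dense)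
  then obtain k0 where "\<forall>k\<ge>k0. 64 * K < real (q k)" unfolding eventually_sequentially by blast
  then show ?thesis by (intro exI[of _ k0]) auto
qed

text \<open>A lower bound for the values at the short vectors, which the asymptotic analysis leaves
  out.\<close>

lemma L_nonzero_of_small:
  assumes "z \<in> zvecs (n + 3)" "z \<noteq> (\<lambda>_. 0)" "16 * nrm (rv z) < real (S (k + 2))"
  shows "lam (k + 1) \<le> \<bar>L z\<bar>"
proof -
  consider b where "z = (\<lambda>t. b * V (k + 1) t)" | "lam k / 2 \<le> \<bar>L z\<bar>"
    using dichotomy_multiple[OF assms(1,3)] by blast
  then show ?thesis
  proof cases
    case 1
    then have "b \<noteq> 0" using assms(2) by auto
    then have "1 * lam (k + 1) \<le> \<bar>of_int b\<bar> * lam (k + 1)"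
      using lam_pos[of "k + 1"] by (intro mult_right_mono) auto
    then show ?thesis unfolding 1 abs_L_multiple by simp
  next
    case 2
    then show ?thesis using lam_decay[of k] lam_pos[of "k + 1"] by linarith
  qed
qed

end

section \<open>Exponents\<close>

locale cascade_growth = cascade_form +
  fixes \<beta> :: real
  assumes beta_pos: "0 < \<beta>"
    and growth_lower: "real (S k) powr (1 + \<beta>) \<le> real (S (Suc k))"
    and growth_upper: "real (S (Suc k)) \<le> 2 * real (S k) powr (1 + \<beta>)"
begin

text \<open>The exponent for which \<open>weight k\<close> is comparable to
  \<open>S (k + 1) powr rho\<close>.\<close>

definition rho :: real where "rho = 1 + (real n + 1) * (1 + \<beta>)"

text \<open>The same exponent with respect to \<open>S k\<close>: \<open>lam k\<close> is comparable
  to \<open>S k powr (- tau)\<close>, and \<open>tau_eq\<close> identifies it with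
  \<open>d - 1 + f_d d \<beta>\<close> for \<open>d = n + 3\<close>.\<close>

definition tau :: real where "tau = (1 + \<beta>) * rho"

lemma rho_pos: "0 < rho"
  using beta_pos unfolding rho_def by (intro add_pos_nonneg mult_nonneg_nonneg) auto

lemma tau_pos: "0 < tau"
  using beta_pos rho_pos by (simp add: tau_def)

lemma tau_eq: "tau = real (n + 2) + f_d (n + 3) \<beta>"
  by (simp add: tau_def rho_def f_d_def power2_eq_square algebra_simps)

lemma powr_rho: "real (S k) powr rho = real (S k) * (real (S k) powr (1 + \<beta>)) ^ (n + 1)"
proof -
  have "(real (S k) powr (1 + \<beta>)) ^ (n + 1) = real (S k) powr ((1 + \<beta>) * real (n + 1))"
    using S_pos[of k] by (subst powr_power) (simp_all add: mult.commute)
  moreover have "real (S k) powr rho = real (S k) powr 1 * real (S k) powr ((1 + \<beta>) * real (n + 1))"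
    unfolding powr_add[symmetric] rho_def by (simp add: mult.commute add.commute)
  ultimately show ?thesis using S_pos[of k] by simp
qed

lemma weight_ge: "real (S (k + 1)) powr rho \<le> weight k"
proof -
  have "(real (S (k + 1)) powr (1 + \<beta>)) ^ (n + 1) \<le> real (S (k + 2)) ^ (n + 1)"
    using growth_lower[of "k + 1"] by (intro power_mono) (auto simp: add_2_eq_Suc')
  then show ?thesis
    unfolding powr_rho weight_def by (subst mult.commute) (intro mult_right_mono, auto)
qed

lemma weight_le: "weight k \<le> 2 ^ (n + 1) * real (S (k + 1)) powr rho"
proof -
  have "real (S (k + 2)) ^ (n + 1) \<le> (2 * real (S (k + 1)) powr (1 + \<beta>)) ^ (n + 1)"
    using growth_upper[of "k + 1"] by (intro power_mono) (auto simp: add_2_eq_Suc')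
  then have "weight k \<le> (2 * real (S (k + 1)) powr (1 + \<beta>)) ^ (n + 1) * real (S (k + 1))"
    unfolding weight_def by (intro mult_right_mono) auto
  also have "\<dots> = 2 ^ (n + 1) * real (S (k + 1)) powr rho"
    unfolding powr_rho power_mult_distrib by simp
  finally show ?thesis .
qed

lemma S_powr_tau:
  "real (S k) powr tau \<le> real (S (k + 1)) powr rho"
  "real (S (k + 1)) powr rho \<le> 2 powr rho * real (S k) powr tau"
proof -
  have e: "real (S k) powr tau = (real (S k) powr (1 + \<beta>)) powr rho"
    by (simp add: tau_def powr_powr)
  show "real (S k) powr tau \<le> real (S (k + 1)) powr rho"
    unfolding e using growth_lower[of k] rho_pos by (intro powr_mono2) auto
  have "real (S (k + 1)) powr rho \<le> (2 * real (S k) powr (1 + \<beta>)) powr rho"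
    using growth_upper[of k] rho_pos by (intro powr_mono2) auto
  also have "\<dots> = 2 powr rho * real (S k) powr tau" unfolding e by (simp add: powr_mult)
  finally show "real (S (k + 1)) powr rho \<le> 2 powr rho * real (S k) powr tau" .
qed

lemma lam_rho_lower: "weight 0 \<le> lam k * 2 ^ (n + 1) * real (S (k + 1)) powr rho"
proof -
  have "lam k * weight k \<le> lam k * (2 ^ (n + 1) * real (S (k + 1)) powr rho)"
    using weight_le lam_pos[of k] by (intro mult_left_mono) auto
  then show ?thesis using lam_weight_lower[of k] by (simp add: mult.assoc)
qed

lemma lam_tau_lower: "weight 0 \<le> lam k * (2 ^ (n + 1) * 2 powr rho) * real (S k) powr tau"
proof -
  have "lam k * 2 ^ (n + 1) * real (S (k + 1)) powr rho
      \<le> lam k * 2 ^ (n + 1) * (2 powr rho * real (S k) powr tau)"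
    using S_powr_tau(2) lam_pos[of k] by (intro mult_left_mono) auto
  also have "\<dots> = lam k * (2 ^ (n + 1) * 2 powr rho) * real (S k) powr tau" by simp
  finally show ?thesis using lam_rho_lower[of k] by linarith
qed

lemma lam_tau_upper: "lam k * real (S k) powr tau \<le> 2 * weight 0"
proof -
  have "real (S k) powr tau \<le> weight k" using S_powr_tau(1) weight_ge order_trans by blast
  then have "lam k * real (S k) powr tau \<le> lam k * weight k"
    using lam_pos[of k] by (intro mult_left_mono) auto
  then show ?thesis using lam_weight_upper[of k] by linarith
qed

definition A1 :: real where "A1 = 1 + (\<Sum>i<n + 2. \<bar>a i\<bar>)"

lemma A1_ge_1: "1 \<le> A1"
  by (simp add: A1_def sum_nonneg)

lemma vnorm_V_le: "vnorm (n + 3) (rv (V k)) \<le> (1 + 4 * A1) * real (S k)"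
proof -
  have "vnorm (n + 3) (rv (V k)) \<le> lam k + A1 * unorm (n + 3) (rv (V k))"
    using vnorm_le_L[of "V k"] lam_pos[of k] by (simp add: A1_def lam_def)
  also have "A1 * unorm (n + 3) (rv (V k)) \<le> A1 * (4 * real (S k))"
    using unorm_V_le A1_ge_1 by (intro mult_left_mono) auto
  also have "lam k \<le> real (S k)" using lam_antimono[of 0 k] lam_0 S_pos[of k] by simp
  finally show ?thesis by (simp add: algebra_simps)
qed

lemma vnorm_V_ge: "real (S (Suc k)) \<le> 2 * K * vnorm (n + 3) (rv (V (Suc k)))"
proof -
  have "2 * K * unorm (n + 3) (rv (V (Suc k))) \<le> 2 * K * vnorm (n + 3) (rv (V (Suc k)))"
    using unorm_le_vnorm K_ge_1 by (intro mult_left_mono) auto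
  then show ?thesis using unorm_V_ge[of k] by linarith
qed

lemma vnorm_nonneg: "0 \<le> vnorm (n + 3) x"
  by (simp add: vnorm_L2)

lemma V_asymptotics:
  "\<exists>c1 c2. 0 < c1 \<and> 0 < c2 \<and>
    (\<forall>k. c1 \<le> lam (Suc k) * vnorm (n + 3) (rv (V (Suc k))) powr tau \<and>
         lam (Suc k) * vnorm (n + 3) (rv (V (Suc k))) powr tau \<le> c2)"
proof -
  define D where "D = 2 ^ (n + 1) * 2 powr rho * (2 * K) powr tau"
  have D: "0 < D" using K_ge_1 by (simp add: D_def)
  define E where "E = (1 + 4 * A1) powr tau"
  have E: "0 < E" using A1_ge_1 by (simp add: E_def)
  have "weight 0 / D \<le> lam (Suc k) * vnorm (n + 3) (rv (V (Suc k))) powr tau" for k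
  proof -
    let ?v = "vnorm (n + 3) (rv (V (Suc k)))"
    have "real (S (Suc k)) powr tau \<le> (2 * K * ?v) powr tau"
      using vnorm_V_ge tau_pos by (intro powr_mono2) auto
    also have "\<dots> = (2 * K) powr tau * ?v powr tau"
      using K_ge_1 vnorm_nonneg by (simp add: powr_mult)
    finally have "lam (Suc k) * (2 ^ (n + 1) * 2 powr rho) * real (S (Suc k)) powr tau
        \<le> lam (Suc k) * (2 ^ (n + 1) * 2 powr rho) * ((2 * K) powr tau * ?v powr tau)"
      using lam_pos[of "Suc k"] by (intro mult_left_mono) auto
    also have "\<dots> = lam (Suc k) * ?v powr tau * D" by (simp add: D_def)
    finally have "weight 0 \<le> lam (Suc k) * ?v powr tau * D"
      using lam_tau_lower[of "Suc k"] by linarith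
    then show ?thesis using D by (simp add: divide_le_eq)
  qed
  moreover have "lam (Suc k) * vnorm (n + 3) (rv (V (Suc k))) powr tau \<le> E * (2 * weight 0)" for k
  proof -
    let ?v = "vnorm (n + 3) (rv (V (Suc k)))"
    have "?v powr tau \<le> ((1 + 4 * A1) * real (S (Suc k))) powr tau"
      using vnorm_V_le vnorm_nonneg tau_pos by (intro powr_mono2) auto
    also have "\<dots> = E * real (S (Suc k)) powr tau"
      using A1_ge_1 by (simp add: powr_mult E_def)
    finally have "lam (Suc k) * ?v powr tau \<le> lam (Suc k) * (E * real (S (Suc k)) powr tau)"
      using lam_pos[of "Suc k"] by (intro mult_left_mono) auto
    also have "\<dots> = E * (lam (Suc k) * real (S (Suc k)) powr tau)" by simp
    also have "\<dots> \<le> E * (2 * weight 0)" using lam_tau_upper E by (intro mult_left_mono) auto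
    finally show ?thesis .
  qed
  moreover have "0 < weight 0 / D" "0 < E * (2 * weight 0)" using weight_pos D E by simp_all
  ultimately show ?thesis by blast
qed

lemma best_nonzero: "best_approx (n + 3) a z \<Longrightarrow> z \<noteq> (\<lambda>_. 0)"
  by (auto simp: best_approx_def unorm_def rv_def)

text \<open>Comparison with the first unit vector, whose \<open>unorm\<close> is the least possible
  nonzero value 1.\<close>

lemma best_L_le: 
  assumes "best_approx (n + 3) a z"
  shows "\<bar>L z\<bar> \<le> \<bar>a 0\<bar>"
proof -
  define e where "e = (\<lambda>t::nat. if t = 0 then 1 else 0 :: int)"
  have "(\<Sum>i<n + 2. (rv e i)\<^sup>2) = (\<Sum>i<n + 2. if i = 0 then 1 else 0)"
    by (intro sum.cong) (auto simp: rv_def e_def)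
  then have u: "unorm (n + 3) (rv e) = 1" by (simp add: unorm_L2 L2_set_def)
  have "L e = (\<Sum>i<n + 3. if i = 0 then a i else 0)"
    unfolding Lform_def by (intro sum.cong) (auto simp: e_def)
  then have Le: "L e = a 0" by simp
  have "e \<in> zvecs (n + 3)" by (auto simp: e_def zvecs_def)
  moreover have "1 \<le> unorm (n + 3) (rv z)"
    using assms unorm_ge_1 unfolding best_approx_def by blast
  ultimately have "\<bar>L z\<bar> \<le> \<bar>L e\<bar>" using assms u unfolding best_approx_def by simp
  then show ?thesis by (simp add: Le)
qed

text \<open>Long best approximation vectors are signed \<open>V j\<close> and obey
  \<open>V_asymptotics\<close>. The short ones have bounded norm and form values away from 0, so
  they only worsen the constants.\<close>

lemma best_asymptotics:
  "\<exists>c1 c2. 0 < c1 \<and> 0 < c2 \<and> (\<forall>z. best_approx (n + 3) a z \<longrightarrow>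
    c1 \<le> \<bar>L z\<bar> * vnorm (n + 3) (rv z) powr tau \<and> \<bar>L z\<bar> * vnorm (n + 3) (rv z) powr tau \<le> c2)"
proof -
  obtain c1 c2 where c: "0 < c1" "0 < c2"
    "\<And>k. c1 \<le> lam (Suc k) * vnorm (n + 3) (rv (V (Suc k))) powr tau"
    "\<And>k. lam (Suc k) * vnorm (n + 3) (rv (V (Suc k))) powr tau \<le> c2"
    using V_asymptotics by blast
  obtain k0 where k0: "\<forall>k\<ge>k0. 64 * K < real (q (k + 1))" using exists_large_q by blast
  \<comment> \<open>\<open>W\<close> bounds the full norm of the best approximation vectors below
    the threshold.\<close>
  define W where "W = \<bar>a 0\<bar> + A1 * real (S (k0 + 2))"
  have "min c1 (lam (k0 + 1)) \<le> \<bar>L z\<bar> * vnorm (n + 3) (rv z) powr tau \<and>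
      \<bar>L z\<bar> * vnorm (n + 3) (rv z) powr tau \<le> c2 + \<bar>a 0\<bar> * W powr tau"
    if best: "best_approx (n + 3) a z" for z
  proof (cases "real (S (k0 + 2)) \<le> 16 * nrm (rv z)")
    case True
    then obtain s j where sj: "\<bar>s\<bar> = 1" "k0 < j" "z = (\<lambda>t. s * V j t)"
      using large_best_is_V[OF best _ True] k0 by blast
    then obtain i where "j = Suc i" by (cases j) auto
    moreover have "\<bar>of_int s :: real\<bar> = 1" using sj(1) by linarith
    ultimately have e: "\<bar>L z\<bar> = lam (Suc i)" "vnorm (n + 3) (rv z) = vnorm (n + 3) (rv (V (Suc i)))"
      unfolding sj(3) abs_L_multiple vnorm_multiple by simp_all
    have "0 \<le> \<bar>a 0\<bar> * W powr tau" by simp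
    then show ?thesis
      unfolding e using c(3)[of i] c(4)[of i] min.cobounded1[of c1 "lam (k0 + 1)"] by linarith
  next
    case False
    have z: "z \<in> zvecs (n + 3)" using best by (simp add: best_approx_def)
    have lo: "lam (k0 + 1) \<le> \<bar>L z\<bar>"
      using L_nonzero_of_small[OF z best_nonzero[OF best]] False by simp
    have v1: "1 \<le> vnorm (n + 3) (rv z)" using vnorm_ge_1[OF z best_nonzero[OF best]] .
    have "vnorm (n + 3) (rv z) \<le> \<bar>L z\<bar> + A1 * unorm (n + 3) (rv z)"
      using vnorm_le_L by (simp add: A1_def)
    also have "A1 * unorm (n + 3) (rv z) \<le> A1 * real (S (k0 + 2))"
      using unorm_le_nrm[of "rv z"] False A1_ge_1 nrm_nonneg[of "rv z"] by (intro mult_left_mono) linarith+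
    finally have vW: "vnorm (n + 3) (rv z) \<le> W" using best_L_le[OF best] by (simp add: W_def)
    have "\<bar>L z\<bar> * vnorm (n + 3) (rv z) powr tau \<le> \<bar>a 0\<bar> * W powr tau"
      using best_L_le[OF best] vW v1 tau_pos by (intro mult_mono powr_mono2) auto
    moreover have "lam (k0 + 1) * 1 \<le> \<bar>L z\<bar> * vnorm (n + 3) (rv z) powr tau"
      using lo v1 tau_pos by (intro mult_mono ge_one_powr_ge_zero) auto
    ultimately show ?thesis using c(2) by simp
  qed
  moreover have "0 < min c1 (lam (k0 + 1))" "0 < c2 + \<bar>a 0\<bar> * W powr tau"
    using c(1,2) lam_pos by (auto intro: add_pos_nonneg)
  ultimately show ?thesis by blast
qed

lemma best_asymptotics_f:
  "\<exists>c1 c2. 0 < c1 \<and> 0 < c2 \<and> (\<forall>z. best_approx (n + 3) a z \<longrightarrow>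
    c1 * vnorm (n + 3) (rv z) powr (- f_d (n + 3) \<beta>) \<le> \<bar>L z\<bar> * vnorm (n + 3) (rv z) ^ (n + 3 - 1) \<and>
    \<bar>L z\<bar> * vnorm (n + 3) (rv z) ^ (n + 3 - 1) \<le> c2 * vnorm (n + 3) (rv z) powr (- f_d (n + 3) \<beta>))"
proof -
  obtain c1 c2 where c: "0 < c1" "0 < c2" "\<And>z. best_approx (n + 3) a z \<Longrightarrow>
    c1 \<le> \<bar>L z\<bar> * vnorm (n + 3) (rv z) powr tau \<and> \<bar>L z\<bar> * vnorm (n + 3) (rv z) powr tau \<le> c2"
    using best_asymptotics by blast
  have "c1 * vnorm (n + 3) (rv z) powr (- f_d (n + 3) \<beta>) \<le> \<bar>L z\<bar> * vnorm (n + 3) (rv z) ^ (n + 3 - 1) \<and>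
    \<bar>L z\<bar> * vnorm (n + 3) (rv z) ^ (n + 3 - 1) \<le> c2 * vnorm (n + 3) (rv z) powr (- f_d (n + 3) \<beta>)"
    if best: "best_approx (n + 3) a z" for z
  proof -
    let ?v = "vnorm (n + 3) (rv z)" and ?f = "f_d (n + 3) \<beta>"
    have v1: "1 \<le> ?v"
      using vnorm_ge_1[OF _ best_nonzero[OF best]] best by (simp add: best_approx_def)
    have "?v ^ (n + 3 - 1) = ?v powr real (n + 2)"
      using v1 by (simp add: powr_realpow add_2_eq_Suc' del: of_nat_add of_nat_Suc power_Suc)
    also have "\<dots> = ?v powr tau * ?v powr (- ?f)" by (simp add: tau_eq powr_add[symmetric])
    finally have e: "\<bar>L z\<bar> * ?v ^ (n + 3 - 1) = (\<bar>L z\<bar> * ?v powr tau) * ?v powr (- ?f)" by simp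
    show ?thesis unfolding e using c(3)[OF best] by (auto intro: mult_right_mono)
  qed
  with c(1,2) show ?thesis by blast
qed

text \<open>If \<open>z\<close> is no multiple of \<open>V (k + 1)\<close> at the level of its
  length, then \<open>L z\<close> is at least \<open>lam k / 2\<close>, of order at least
  \<open>|z| powr (- rho)\<close>. The resulting exponent \<open>n + 2 - rho\<close> exceeds the
  required one by \<open>(n + 1) * \<beta>^2\<close>, so the bound suffices because
  \<open>|z| >= 1\<close>.\<close>

lemma nonbest_lower_bound:
  "\<exists>c>0. \<forall>z\<in>zvecs (n + 3). \<not> (\<exists>k::int. \<exists>b. best_approx (n + 3) a b \<and> z = (\<lambda>i. k * b i)) \<longrightarrow>
    c * vnorm (n + 3) (rv z) powr (- f_d (n + 3) \<beta> + (real (n + 3) - 1) * \<beta>)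
      \<le> \<bar>L z\<bar> * vnorm (n + 3) (rv z) ^ (n + 3 - 1)"
proof -
  obtain k0 where k0: "\<forall>k\<ge>k0. 64 * K < real (q (k + 1))" using exists_large_q by blast
  define K' where "K' = real (S 1) + 16 * K"
  have K': "0 < K'" using K_ge_1 by (simp add: K'_def add_nonneg_pos)
  define c where "c = weight 0 / (2 * 2 ^ (n + 1) * K' powr rho)"
  have c: "0 < c" using K' weight_pos by (simp add: c_def)
  define g where "g = - f_d (n + 3) \<beta> + (real (n + 3) - 1) * \<beta>"
  have g_eq: "g = real (n + 2) - rho - (real n + 1) * \<beta>\<^sup>2"
    by (simp add: g_def f_d_def rho_def algebra_simps)
  have g_le: "g \<le> real (n + 2) - rho" unfolding g_eq by simp
  have "g = - (\<beta> * real n) - \<beta> - (\<beta>\<^sup>2 + real n * \<beta>\<^sup>2)"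
    unfolding g_eq by (simp add: rho_def algebra_simps)
  moreover have "0 \<le> \<beta> * real n" "0 \<le> \<beta>\<^sup>2" "0 \<le> real n * \<beta>\<^sup>2" using beta_pos by simp_all
  ultimately have g0: "g \<le> 0" using beta_pos by linarith
  have "min c (lam (k0 + 1)) * vnorm (n + 3) (rv z) powr g \<le> \<bar>L z\<bar> * vnorm (n + 3) (rv z) ^ (n + 3 - 1)"
    if z: "z \<in> zvecs (n + 3)"
      and nb: "\<not> (\<exists>k::int. \<exists>b. best_approx (n + 3) a b \<and> z = (\<lambda>i. k * b i))" for z
  proof -
    let ?v = "vnorm (n + 3) (rv z)"
    \<comment> \<open>The zero vector is 0 times a best approximation vector and so falls outside
      the claim.\<close>
    have z0: "z \<noteq> (\<lambda>_. 0)"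
    proof
      assume "z = (\<lambda>_. 0)"
      then have "z = (\<lambda>i. 0 * V (k0 + 1) i)" by simp
      moreover have "best_approx (n + 3) a (V (k0 + 1))" using V_best k0 by blast
      ultimately show False using nb by blast
    qed
    have v1: "1 \<le> ?v" using vnorm_ge_1[OF z z0] .
    have vg1: "?v powr g \<le> 1"
      using powr_mono[of g 0 ?v] v1 g0 by simp
    have ve: "?v ^ (n + 3 - 1) = ?v powr real (n + 2)"
      using v1 by (simp add: powr_realpow add_2_eq_Suc' del: of_nat_add of_nat_Suc power_Suc)
    \<comment> \<open>The level at which \<open>dichotomy_multiple\<close> applies while
      \<open>S (k + 1)\<close> is still of order at most \<open>|z|\<close>. The summand
      \<open>S 1\<close> in \<open>K'\<close> takes care of vectors below the first level.\<close>
    obtain k where k: "16 * nrm (rv z) < real (S (k + 2))" "real (S (k + 1)) \<le> K' * ?v"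
    proof (cases "real (S 2) \<le> 16 * nrm (rv z)")
      case True
      then obtain k where k: "2 \<le> k" "real (S k) \<le> 16 * nrm (rv z)" "16 * nrm (rv z) < real (S (Suc k))"
        using S_level by blast
      have "nrm (rv z) \<le> K * ?v"
        using nrm_le_unorm[of "rv z"] mult_left_mono[OF unorm_le_vnorm[of "rv z"], of K] K_ge_1 by linarith
      then have "real (S k) \<le> 16 * K * ?v" using k(2) by linarith
      also have "\<dots> \<le> K' * ?v" using v1 by (intro mult_right_mono) (auto simp: K'_def)
      finally have "real (S k) \<le> K' * ?v" .
      moreover have "k - 1 + 2 = Suc k" "k - 1 + 1 = k" using k(1) by simp_all
      ultimately show ?thesis using that[of "k - 1"] k(3) by simp
    next
      case False
      have "real (S 1) * 1 \<le> K' * ?v" using v1 K_ge_1 by (intro mult_mono) (auto simp: K'_def)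
      then show ?thesis using that[of 0] False by simp
    qed
    consider b where "z = (\<lambda>t. b * V (k + 1) t)" | "lam k / 2 \<le> \<bar>L z\<bar>"
      using dichotomy_multiple[OF z k(1)] by blast
    then show ?thesis
    proof cases
      case 1
      then have "b \<noteq> 0" using z0 by auto
      then have "1 * lam (k + 1) \<le> \<bar>of_int b\<bar> * lam (k + 1)"
        using lam_pos[of "k + 1"] by (intro mult_right_mono) auto
      then have Lz: "lam (k + 1) \<le> \<bar>L z\<bar>" unfolding 1 abs_L_multiple by simp
      \<comment> \<open>Only the finitely many \<open>V (k + 1)\<close> with \<open>k < k0\<close>
        can fail to be best approximation vectors; for their multiples a constant lower bound
        suffices, as the exponent \<open>g\<close> is at most 0.\<close>
      have "\<not> best_approx (n + 3) a (V (k + 1))" using nb 1 by blast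
      then have "k < k0" using V_best k0 by (meson not_le)
      then have "lam (k0 + 1) \<le> \<bar>L z\<bar>" using Lz lam_antimono[of "k + 1" "k0 + 1"] by simp
      then have "min c (lam (k0 + 1)) * ?v powr g \<le> \<bar>L z\<bar> * 1"
        using vg1 by (intro mult_mono) auto
      also have "\<dots> \<le> \<bar>L z\<bar> * ?v ^ (n + 3 - 1)" using v1 by (intro mult_left_mono one_le_power) auto
      finally show ?thesis .
    next
      case 2
      have "real (S (k + 1)) powr rho \<le> (K' * ?v) powr rho"
        using k(2) rho_pos by (intro powr_mono2) auto
      also have "\<dots> = K' powr rho * ?v powr rho" using K' v1 by (simp add: powr_mult)
      finally have "lam k * 2 ^ (n + 1) * real (S (k + 1)) powr rho
          \<le> lam k * 2 ^ (n + 1) * (K' powr rho * ?v powr rho)"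
        using lam_pos[of k] by (intro mult_left_mono) auto
      then have "weight 0 \<le> lam k * 2 ^ (n + 1) * (K' powr rho * ?v powr rho)"
        using lam_rho_lower[of k] by linarith
      then have "c \<le> lam k / 2 * ?v powr rho"
        using K' by (simp add: c_def divide_le_eq mult_ac)
      also have "\<dots> \<le> \<bar>L z\<bar> * ?v powr rho" using 2 by (intro mult_right_mono) auto
      finally have cv: "c \<le> \<bar>L z\<bar> * ?v powr rho" .
      have "min c (lam (k0 + 1)) * ?v powr g \<le> c * ?v powr (real (n + 2) - rho)"
        using c v1 g_le lam_pos[of "k0 + 1"] by (intro mult_mono powr_mono) auto
      also have "\<dots> \<le> \<bar>L z\<bar> * ?v powr rho * ?v powr (real (n + 2) - rho)"
        using cv by (intro mult_right_mono) auto
      also have "\<dots> = \<bar>L z\<bar> * ?v powr real (n + 2)"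
        by (simp add: mult.assoc powr_add[symmetric])
      finally show ?thesis unfolding ve .
    qed
  qed
  moreover have "0 < min c (lam (k0 + 1))" using c lam_pos by simp
  ultimately show ?thesis unfolding g_def by blast
qed

section \<open>Asymptotic directions\<close>

lemma q_ge_power: "2 ^ k \<le> real (q k)"
proof (induction k)
  case 0
  then show ?case using q_ge_real[of 0] by simp
next
  case (Suc k)
  have "real (2 * q k) \<le> real (q (Suc k))" using q_double by (rule of_nat_mono)
  then have "2 * 2 ^ k \<le> real (q (Suc k))" using Suc unfolding of_nat_mult of_nat_numeral by linarith
  then show ?case by simp
qed

definition dir :: "nat \<Rightarrow> nat \<Rightarrow> real" where
  "dir k = (\<lambda>t. rv (V k) t / vnorm (n + 3) (rv (V k)))"

text \<open>\<open>r\<close> selects the parity class and \<open>m\<close> runs through it; the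
  shift by 1 skips \<open>V 0\<close>.\<close>

definition Vscaled :: "nat \<Rightarrow> nat \<Rightarrow> nat \<Rightarrow> real" where
  "Vscaled r m t = rv (V (2 * m + r + 1)) t / real (S (2 * m + r + 1))"

definition Vlim :: "nat \<Rightarrow> nat \<Rightarrow> real" where
  "Vlim r t = lim (\<lambda>m. Vscaled r m t)"

definition Vdir :: "nat \<Rightarrow> nat \<Rightarrow> real" where
  "Vdir r = (\<lambda>t. Vlim r t / vnorm (n + 3) (Vlim r))"

lemma V_step: "V (k + 3) = (\<lambda>t. int (q (k + 2) * q (k + 1)) * V (k + 1) t - C k n t)"
  using C_Suc_simps(4)[of k] V_shift(2)[of "Suc k"] V_shift(1)[of k]
  by (simp add: numeral_3_eq_3 add_2_eq_Suc')

text \<open>\<open>S (k + 3)\<close> carries exactly the factor in front of \<open>V (k + 1)\<close>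
  in \<open>V_step\<close>. The difference is therefore a component of \<open>C k n\<close> divided
  by \<open>S (k + 3)\<close>, of size at most \<open>4 / q (k + 2)\<close>, which decays
  geometrically.\<close>

lemma Vscaled_step:
  assumes "t < n + 2"
  shows "\<bar>Vscaled r (Suc m) t - Vscaled r m t\<bar> \<le> 4 * (1 / 2) ^ m"
proof -
  define k where "k = 2 * m + r"
  let ?M = "real (q (k + 2) * q (k + 1))"
  have e: "2 * Suc m + r + 1 = k + 3" "2 * m + r + 1 = k + 1" by (simp_all add: k_def)
  have "0 < ?M" "0 < real (q (k + 2))" using M_ge[of k] q_ge_real[of "k + 2"] by linarith+
  then have Sp: "0 < real (S (k + 1))" "0 < ?M" "0 < real (S (k + 3))" "0 < real (S (k + 2))" "0 < real (q (k + 2))"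
    by (simp_all add: S_pos)
  have "Vscaled r (Suc m) t = (?M * rv (V (k + 1)) t - rv (C k n) t) / real (S (k + 3))"
    unfolding Vscaled_def e V_step by (simp add: rv_def)
  also have "\<dots> = Vscaled r m t - rv (C k n) t / real (S (k + 3))"
    using Sp unfolding Vscaled_def e S_shift(2) by (simp add: diff_divide_distrib del: of_nat_mult)
  finally have "\<bar>Vscaled r (Suc m) t - Vscaled r m t\<bar> = \<bar>rv (C k n) t\<bar> / real (S (k + 3))" by simp
  also have "\<dots> \<le> 4 * real (S (k + 2)) / real (S (k + 3))"
  proof (intro divide_right_mono)
    have "\<bar>rv (C k n) t\<bar> \<le> 2 * nrm (rv (C k n))"
      using coordinate_le_unorm[OF assms, of "rv (C k n)"] unorm_le_nrm[of "rv (C k n)"] by linarith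
    also have "\<dots> \<le> 4 * scale k n" using nrm_C_le[of n k] by simp
    also have "scale k n \<le> real (S (k + 2))" using S_mono[of k "k + 2"] by (simp add: scale_def)
    finally show "\<bar>rv (C k n) t\<bar> \<le> 4 * real (S (k + 2))" by simp
  qed simp
  also have "\<dots> = 4 / real (q (k + 2))" unfolding S_shift(1) using Sp by simp
  also have "\<dots> \<le> 4 / 2 ^ m"
  proof (intro divide_left_mono)
    have "(2::real) ^ m \<le> 2 ^ (k + 2)" by (intro power_increasing) (auto simp: k_def)
    then show "2 ^ m \<le> real (q (k + 2))" using q_ge_power[of "k + 2"] by linarith
    show "0 < real (q (k + 2)) * 2 ^ m" using Sp by simp
  qed simp
  finally show ?thesis by (simp add: power_one_over)
qed

lemma convergent_of_summable_steps:
  fixes x :: "nat \<Rightarrow> real"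
  assumes "summable b" "\<And>m. \<bar>x (Suc m) - x m\<bar> \<le> b m"
  shows "convergent x"
proof -
  have "summable (\<lambda>m. x (Suc m) - x m)"
    using assms(2) by (intro summable_comparison_test'[OF assms(1)]) simp
  then have "convergent (\<lambda>m. \<Sum>i<m. x (Suc i) - x i)" by (simp add: summable_iff_convergent)
  then have "convergent (\<lambda>m. x m - x 0)" by (simp add: sum_lessThan_telescope)
  then show ?thesis by (simp add: convergent_diff_const_right_iff)
qed

lemma Vscaled_lim_low: "t < n + 2 \<Longrightarrow> (\<lambda>m. Vscaled r m t) \<longlonglongrightarrow> Vlim r t"
  using convergent_of_summable_steps[of "\<lambda>m. 4 * (1 / 2) ^ m" "\<lambda>m. Vscaled r m t", OF _ Vscaled_step]
  unfolding Vlim_def by (simp add: convergent_LIMSEQ_iff)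

lemma last_coordinate: "rv z (n + 2) = L z - (\<Sum>i<n + 2. a i * rv z i)"
proof -
  have d3: "{..<n + 3} = insert (n + 2) {..<n + 2}" by auto
  show ?thesis using a_pi unfolding Lform_def d3 by (simp add: pi_d_def add_2_eq_Suc' rv_def)
qed

lemma Vscaled_last:
  "Vscaled r m (n + 2) = lam (2 * m + r + 1) / real (S (2 * m + r + 1)) - (\<Sum>i<n + 2. a i * Vscaled r m i)"
  unfolding Vscaled_def last_coordinate lam_def
  by (simp add: diff_divide_distrib sum_divide_distrib)

lemma lam_over_S: "(\<lambda>m. lam (2 * m + r + 1) / real (S (2 * m + r + 1))) \<longlonglongrightarrow> 0"
proof (rule tendsto_sandwich)
  show "eventually (\<lambda>m. 0 \<le> lam (2 * m + r + 1) / real (S (2 * m + r + 1))) sequentially"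
    using lam_pos by (simp add: less_imp_le)
  have "lam (2 * m + r + 1) / real (S (2 * m + r + 1)) \<le> 1 / real (Suc m)" for m
  proof (intro frac_le)
    show "lam (2 * m + r + 1) \<le> 1" using lam_antimono[of 0] lam_0 by simp
    show "real (Suc m) \<le> real (S (2 * m + r + 1))"
      using S_unbounded[of "2 * m + r + 1"] by (simp only: of_nat_le_iff)
  qed simp_all
  then show "eventually (\<lambda>m. lam (2 * m + r + 1) / real (S (2 * m + r + 1)) \<le> 1 / real (Suc m)) sequentially"
    by simp
  show "(\<lambda>m. 1 / real (Suc m)) \<longlonglongrightarrow> 0" using LIMSEQ_inverse_real_of_nat by (simp add: inverse_eq_divide)
qed simp

text \<open>The last component is governed by the form, and \<open>lam / S\<close> tends to 0; hence
  the limit vector lies in the kernel of the form.\<close>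

lemma Vscaled_lim_last: "(\<lambda>m. Vscaled r m (n + 2)) \<longlonglongrightarrow> - (\<Sum>i<n + 2. a i * Vlim r i)"
proof -
  have "(\<lambda>m. lam (2 * m + r + 1) / real (S (2 * m + r + 1)) - (\<Sum>i<n + 2. a i * Vscaled r m i))
      \<longlonglongrightarrow> 0 - (\<Sum>i<n + 2. a i * Vlim r i)"
    by (intro tendsto_diff lam_over_S tendsto_sum tendsto_mult tendsto_const Vscaled_lim_low) auto
  then show ?thesis unfolding Vscaled_last by simp
qed

lemma Vlim_last: "Vlim r (n + 2) = - (\<Sum>i<n + 2. a i * Vlim r i)"
  using Vscaled_lim_last[of r] unfolding Vlim_def[of r "n + 2"] by (rule limI)

lemma Vscaled_above: "n + 3 \<le> t \<Longrightarrow> Vscaled r m t = 0"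
  using V_in_zvecs by (simp add: Vscaled_def rv_def zvecs_def)

lemma Vscaled_lim: "(\<lambda>m. Vscaled r m t) \<longlonglongrightarrow> Vlim r t"
proof -
  consider "t < n + 2" | "t = n + 2" | "n + 3 \<le> t" by linarith
  then show ?thesis
  proof cases
    case 1
    then show ?thesis by (rule Vscaled_lim_low)
  next
    case 2
    then show ?thesis using Vscaled_lim_last[of r] Vlim_last[of r] by simp
  next
    case 3
    have "Vlim r t = 0" unfolding Vlim_def Vscaled_above[OF 3] by simp
    then show ?thesis unfolding Vscaled_above[OF 3] by simp
  qed
qed

lemma Vlim_rvecs: "Vlim r \<in> rvecs (n + 3)"
  by (simp add: rvecs_def Vlim_def Vscaled_above)

lemma form_Vlim: "(\<Sum>i<n + 3. a i * Vlim r i) = 0"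
proof -
  have d3: "{..<n + 3} = insert (n + 2) {..<n + 2}" by auto
  show ?thesis using a_pi Vlim_last[of r] unfolding d3 by (simp add: pi_d_def add_2_eq_Suc')
qed

text \<open>\<open>dev_bound\<close> passes to the limit; within one parity class
  \<open>perm\<close> sends \<open>n + 1\<close> to the fixed position
  \<open>n + 1 + r\<close>.\<close>

lemma U_Vlim:
  assumes "j \<in> {1..n + 2}" "r < 2"
  shows "\<bar>U (Vlim r) j - (if j = n + 1 + r then 1 else 0)\<bar> \<le> 1 / 8"
proof (rule LIMSEQ_le_const2)
  let ?c = "if j = n + 1 + r then 1 else 0 :: real"
  show "(\<lambda>m. \<bar>U (Vscaled r m) j - ?c\<bar>) \<longlonglongrightarrow> \<bar>U (Vlim r) j - ?c\<bar>"
    unfolding U_def by (auto intro!: tendsto_intros Vscaled_lim)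
  have "\<bar>U (Vscaled r m) j - ?c\<bar> \<le> 1 / 8" for m
  proof -
    define k where "k = 2 * m + r"
    have sc: "scale k (n + 1) = real (S (k + 1))" by (simp add: scale_def)
    have Sp: "0 < real (S (k + 1))" by (simp add: S_pos)
    have pk: "perm k (n + 1) = n + 1 + r"
      using assms(2) by (auto simp: perm_def k_def less_2_cases_iff)
    have "\<bar>dev k (n + 1) j\<bar> \<le> (\<Sum>j=1..n + 2. \<bar>dev k (n + 1) j\<bar>)"
      using assms(1) by (intro member_le_sum) auto
    also have "\<dots> \<le> real (S (k + 1)) / 8" using dev_bound[of "n + 1" k] sc by simp
    finally have "\<bar>U (rv (V (k + 1))) j - real (S (k + 1)) * ?c\<bar> \<le> real (S (k + 1)) / 8"
      unfolding dev_def V_shift sc pk .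
    then have "\<bar>U (rv (V (k + 1))) j - real (S (k + 1)) * ?c\<bar> / real (S (k + 1)) \<le> 1 / 8"
      using Sp by (simp add: divide_le_eq)
    also have "\<bar>U (rv (V (k + 1))) j - real (S (k + 1)) * ?c\<bar> / real (S (k + 1))
        = \<bar>(U (rv (V (k + 1))) j - real (S (k + 1)) * ?c) / real (S (k + 1))\<bar>" by simp
    also have "(U (rv (V (k + 1))) j - real (S (k + 1)) * ?c) / real (S (k + 1)) = U (Vscaled r m) j - ?c"
    proof -
      have e: "Vscaled r m = (\<lambda>t. (1 / real (S (k + 1))) * rv (V (k + 1)) t + 0 * rv (V (k + 1)) t)"
        by (simp add: Vscaled_def k_def fun_eq_iff)
      have "U (Vscaled r m) j = U (rv (V (k + 1))) j / real (S (k + 1))" unfolding e U_lincomb by simp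
      then show ?thesis using Sp by (simp add: diff_divide_distrib)
    qed
    finally show ?thesis .
  qed
  then show "\<exists>N. \<forall>m\<ge>N. \<bar>U (Vscaled r m) j - ?c\<bar> \<le> 1 / 8" by blast
qed

lemma vnorm_Vlim_pos:
  assumes "r < 2"
  shows "0 < vnorm (n + 3) (Vlim r)"
proof -
  have j: "n + 1 + r \<in> {1..n + 2}" using assms by auto
  have "\<bar>U (Vlim r) (n + 1 + r) - 1\<bar> \<le> 1 / 8" using U_Vlim[OF j assms] by simp
  then have "7 / 8 \<le> \<bar>U (Vlim r) (n + 1 + r)\<bar>" by linarith
  also have "\<dots> \<le> nrm (Vlim r)" unfolding nrm_def using j by (intro member_le_sum) auto
  also have "\<dots> \<le> K * unorm (n + 3) (Vlim r)" by (rule nrm_le_unorm)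
  finally have "0 < K * unorm (n + 3) (Vlim r)" by linarith
  then have "0 < unorm (n + 3) (Vlim r)" using K_ge_1 by (simp add: zero_less_mult_iff)
  then show ?thesis using unorm_le_vnorm[of "Vlim r"] by linarith
qed

lemma vnorm_V_pos: "0 < vnorm (n + 3) (rv (V (Suc k)))"
  using unorm_V_pos[of k] unorm_le_vnorm[of "rv (V (Suc k))"] by linarith

lemma dir_eq_Vscaled: "dir (2 * m + r + 1) t = Vscaled r m t / vnorm (n + 3) (Vscaled r m)"
proof -
  let ?k = "2 * m + r + 1"
  have Vscaled: "Vscaled r m = (\<lambda>t. (1 / real (S ?k)) * rv (V ?k) t)" by (simp add: Vscaled_def fun_eq_iff)
  have "vnorm (n + 3) (Vscaled r m) = vnorm (n + 3) (rv (V ?k)) / real (S ?k)"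
    unfolding Vscaled vnorm_scale by simp
  then show ?thesis using S_pos[of ?k] unfolding dir_def Vscaled_def by simp
qed

lemma vnorm_tendsto:
  assumes "\<And>t. (\<lambda>m. x m t) \<longlonglongrightarrow> z t"
  shows "(\<lambda>m. vnorm (n + 3) (x m)) \<longlonglongrightarrow> vnorm (n + 3) z"
  unfolding vnorm_def by (intro tendsto_intros assms)

lemma dir_tendsto:
  assumes "r < 2"
  shows "(\<lambda>m. dir (2 * m + r + 1) t) \<longlonglongrightarrow> Vdir r t"
  unfolding dir_eq_Vscaled Vdir_def using vnorm_Vlim_pos[OF assms]
  by (intro tendsto_divide Vscaled_lim vnorm_tendsto) auto

lemma dir_close:
  assumes "r < 2" "0 < e"
  shows "\<exists>m0. \<forall>m\<ge>m0. vnorm (n + 3) (\<lambda>i. dir (2 * m + r + 1) i - Vdir r i) < e"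
proof -
  have "(\<lambda>m. vnorm (n + 3) (\<lambda>i. dir (2 * m + r + 1) i - Vdir r i)) \<longlonglongrightarrow> vnorm (n + 3) (\<lambda>i. Vdir r i - Vdir r i)"
    by (intro vnorm_tendsto tendsto_intros dir_tendsto assms)
  then have "(\<lambda>m. vnorm (n + 3) (\<lambda>i. dir (2 * m + r + 1) i - Vdir r i)) \<longlonglongrightarrow> 0"
    by (simp add: vnorm_def)
  then have "eventually (\<lambda>m. vnorm (n + 3) (\<lambda>i. dir (2 * m + r + 1) i - Vdir r i) < e) sequentially"
    using assms(2) by (rule order_tendstoD)
  then show ?thesis unfolding eventually_sequentially .
qed

lemma Vdir_rvecs: "Vdir r \<in> rvecs (n + 3)"
  using Vlim_rvecs[of r] by (simp add: Vdir_def rvecs_def)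

lemma vnorm_Vdir: "r < 2 \<Longrightarrow> vnorm (n + 3) (Vdir r) = 1"
  using vnorm_scale[of "1 / vnorm (n + 3) (Vlim r)" "Vlim r"] vnorm_Vlim_pos[of r] by (simp add: Vdir_def)

lemma form_Vdir: "(\<Sum>i<n + 3. a i * Vdir r i) = 0"
  using form_Vlim[of r] by (simp add: Vdir_def sum_divide_distrib[symmetric])

lemma vnorm_sign: "\<bar>s\<bar> = 1 \<Longrightarrow> vnorm (n + 3) (\<lambda>i. s * x i) = vnorm (n + 3) x"
  by (simp add: vnorm_scale)

lemma best_approx_sign:
  fixes s :: int
  assumes "best_approx (n + 3) a z" "\<bar>s\<bar> = 1"
  shows "best_approx (n + 3) a (\<lambda>t. s * z t)"
proof -
  have "\<bar>of_int s :: real\<bar> = 1" using assms(2) by linarith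
  then have "unorm (n + 3) (rv (\<lambda>t. s * z t)) = unorm (n + 3) (rv z)" "\<bar>L (\<lambda>t. s * z t)\<bar> = \<bar>L z\<bar>"
    by (simp_all add: unorm_multiple L_scale abs_mult)
  moreover have "(\<lambda>t. s * z t) \<in> zvecs (n + 3)" using assms(1) by (simp add: best_approx_def zvecs_def)
  ultimately show ?thesis using assms(1) unfolding best_approx_def by simp
qed

lemma sign_dir: 
  fixes s :: int
  assumes "\<bar>s\<bar> = 1"
  shows "(\<lambda>i. rv (\<lambda>t. s * V k t) i / vnorm (n + 3) (rv (\<lambda>t. s * V k t))) = (\<lambda>i. of_int s * dir k i)"
proof -
  have "\<bar>of_int s :: real\<bar> = 1" using assms by linarith
  then show ?thesis unfolding vnorm_multiple by (simp add: dir_def rv_def)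
qed

lemma asym_dir_Vdir:
  fixes s :: int
  assumes "r < 2" "\<bar>s\<bar> = 1"
  shows "asym_dir (n + 3) a (\<lambda>i. of_int s * Vdir r i)"
proof -
  have s1: "\<bar>of_int s :: real\<bar> = 1" using assms(2) by linarith
  obtain k0 where k0: "\<forall>k\<ge>k0. 64 * K < real (q (k + 1))" using exists_large_q by blast
  have "\<exists>v\<in>best_dirs (n + 3) a. v \<noteq> (\<lambda>i. of_int s * Vdir r i) \<and>
      vnorm (n + 3) (\<lambda>i. v i - of_int s * Vdir r i) < e" if "0 < e" for e
  proof -
    obtain m0 where m0: "\<forall>m\<ge>m0. vnorm (n + 3) (\<lambda>i. dir (2 * m + r + 1) i - Vdir r i) < e"
      using dir_close[OF assms(1) \<open>0 < e\<close>] by blast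
    define m where "m = max m0 k0"
    define k where "k = 2 * m + r + 1"
    let ?v = "\<lambda>i. of_int s * dir k i"
    have "best_approx (n + 3) a (V k)" using V_best[of "2 * m + r"] k0 by (simp add: k_def m_def)
    then have "best_approx (n + 3) a (\<lambda>t. s * V k t)" by (rule best_approx_sign[OF _ assms(2)])
    then have "?v \<in> best_dirs (n + 3) a"
      unfolding best_dirs_def sign_dir[OF assms(2), of k, symmetric] by blast
    \<comment> \<open>An accumulation point needs directions different from the limit: the form is
      positive at \<open>dir k\<close> but vanishes at \<open>Vdir r\<close>.\<close>
    moreover have "?v \<noteq> (\<lambda>i. of_int s * Vdir r i)"
    proof
      assume "?v = (\<lambda>i. of_int s * Vdir r i)"
      then have "of_int s * dir k i = of_int s * Vdir r i" for i by meson
      moreover have "s \<noteq> 0" using assms(2) by auto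
      ultimately have "dir k i = Vdir r i" for i by simp
      then have "(\<Sum>i<n + 3. a i * dir k i) = 0" using form_Vdir[of r] by simp
      moreover have "(\<Sum>i<n + 3. a i * dir k i) = lam k / vnorm (n + 3) (rv (V k))"
        by (simp add: dir_def lam_def Lform_def rv_def sum_divide_distrib)
      ultimately show False using lam_pos[of k] vnorm_V_pos[of "2 * m + r"] by (simp add: k_def)
    qed
    moreover have "vnorm (n + 3) (\<lambda>i. ?v i - of_int s * Vdir r i) < e"
      using m0 vnorm_sign[OF s1, of "\<lambda>i. dir k i - Vdir r i"]
      by (simp add: right_diff_distrib k_def m_def)
    ultimately show ?thesis by blast
  qed
  moreover have "(\<lambda>i. of_int s * Vdir r i) \<in> rvecs (n + 3)" using Vdir_rvecs[of r] by (simp add: rvecs_def)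
  moreover have "vnorm (n + 3) (\<lambda>i. of_int s * Vdir r i) = 1" using vnorm_sign[OF s1] vnorm_Vdir[OF assms(1)] by simp
  ultimately show ?thesis unfolding asym_dir_def by blast
qed

text \<open>A bound on \<open>nrm\<close> controls the first \<open>n + 2\<close> components, and
  \<open>best_L_le\<close> then controls the last, so only finitely many integer vectors
  remain.\<close>

lemma finite_best_bounded: "finite {z. best_approx (n + 3) a z \<and> 16 * nrm (rv z) < B}"
proof -
  define D where "D = \<lceil>\<bar>a 0\<bar> + A1 * \<bar>B\<bar>\<rceil>"
  have zD: "\<bar>z i\<bar> \<le> D" if z: "best_approx (n + 3) a z" "16 * nrm (rv z) < B" and i: "i < n + 3" for z i
  proof -
    have "(rv z i)\<^sup>2 \<le> (\<Sum>i<n + 3. (rv z i)\<^sup>2)" using i by (intro member_le_sum) auto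
    then have "sqrt ((rv z i)\<^sup>2) \<le> vnorm (n + 3) (rv z)" unfolding vnorm_def by (rule real_sqrt_le_mono)
    then have "\<bar>of_int (z i)\<bar> \<le> vnorm (n + 3) (rv z)" by (simp add: rv_def)
    also have "\<dots> \<le> \<bar>L z\<bar> + A1 * unorm (n + 3) (rv z)" using vnorm_le_L by (simp add: A1_def)
    also have "A1 * unorm (n + 3) (rv z) \<le> A1 * \<bar>B\<bar>"
      using unorm_le_nrm[of "rv z"] z(2) A1_ge_1 nrm_nonneg[of "rv z"] by (intro mult_left_mono) linarith+
    finally have "\<bar>of_int (z i)\<bar> \<le> \<bar>a 0\<bar> + A1 * \<bar>B\<bar>" using best_L_le[OF z(1)] by linarith
    then show ?thesis unfolding D_def by linarith
  qed
  have "{z. best_approx (n + 3) a z \<and> 16 * nrm (rv z) < B}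
      \<subseteq> {f. \<forall>x. (x \<in> {..<n + 3} \<longrightarrow> f x \<in> {- D..D}) \<and> (x \<notin> {..<n + 3} \<longrightarrow> f x = 0)}"
  proof (intro subsetI CollectI allI conjI impI)
    fix z i assume z: "z \<in> {z. best_approx (n + 3) a z \<and> 16 * nrm (rv z) < B}"
    show "z i \<in> {- D..D}" if "i \<in> {..<n + 3}" using zD[of z i] z that by auto
    show "z i = 0" if "i \<notin> {..<n + 3}" using z that by (auto simp: best_approx_def zvecs_def)
  qed
  moreover have "finite {f. \<forall>x. (x \<in> {..<n + 3} \<longrightarrow> f x \<in> {- D..D}) \<and> (x \<notin> {..<n + 3} \<longrightarrow> f x = (0::int))}"
    by (rule finite_set_of_finite_funs) auto
  ultimately show ?thesis by (rule finite_subset)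
qed

lemma vnorm_triangle:
  "vnorm (n + 3) (\<lambda>i. x i - z i) \<le> vnorm (n + 3) (\<lambda>i. x i - v i) + vnorm (n + 3) (\<lambda>i. v i - z i)"
  using L2_set_triangle_ineq[of "\<lambda>i. x i - v i" "\<lambda>i. v i - z i" "{..<n + 3}"] by (simp add: vnorm_L2)

lemma vnorm_diff_pos:
  assumes "x \<in> rvecs (n + 3)" "z \<in> rvecs (n + 3)" "x \<noteq> z"
  shows "0 < vnorm (n + 3) (\<lambda>i. x i - z i)"
proof (rule ccontr)
  assume "\<not> ?thesis"
  then have "vnorm (n + 3) (\<lambda>i. x i - z i) = 0" using vnorm_nonneg[of "\<lambda>i. x i - z i"] by linarith
  then have "\<forall>i<n + 3. x i - z i = 0" unfolding vnorm_L2 L2_set_eq_0_iff[OF finite_lessThan] by simp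
  then have "x i = z i" for i using assms(1,2) by (cases "i < n + 3") (auto simp: rvecs_def)
  then show False using assms(3) by auto
qed

text \<open>A direction close enough to \<open>x\<close> but different from it avoids the finitely
  many directions of short best approximation vectors. It thus comes from a long one, which is a
  signed \<open>V j\<close> whose direction is near its limit.\<close>

lemma asym_dir_near_Vdir:
  assumes "asym_dir (n + 3) a x" "0 < e"
  shows "\<exists>(s::int) r. \<bar>s\<bar> = 1 \<and> r < 2 \<and> vnorm (n + 3) (\<lambda>i. x i - of_int s * Vdir r i) < 2 * e"
proof -
  obtain k0 where k0: "\<forall>k\<ge>k0. 64 * K < real (q (k + 1))" using exists_large_q by blast
  obtain m0 where m0: "\<forall>m\<ge>m0. vnorm (n + 3) (\<lambda>i. dir (2 * m + 0 + 1) i - Vdir 0 i) < e"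
    using dir_close[of 0, OF _ assms(2)] by auto
  obtain m1 where m1: "\<forall>m\<ge>m1. vnorm (n + 3) (\<lambda>i. dir (2 * m + 1 + 1) i - Vdir 1 i) < e"
    using dir_close[of 1, OF _ assms(2)] by auto
  \<comment> \<open>Ensures that \<open>j > k1\<close> has position at least \<open>m0\<close> or
    \<open>m1\<close> in its parity class.\<close>
  define k1 where "k1 = max k0 (2 * max m0 m1 + 2)"
  define F where "F = (\<lambda>z i. rv z i / vnorm (n + 3) (rv z)) ` {z. best_approx (n + 3) a z \<and> 16 * nrm (rv z) < real (S (k1 + 2))}"
  have "finite F" unfolding F_def by (intro finite_imageI finite_best_bounded)
  \<comment> \<open>Its minimum is a positive radius: at most \<open>e\<close>, and no direction in
    \<open>F\<close> other than \<open>x\<close> lies closer to \<open>x\<close>.\<close>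
  define G where "G = insert e ((\<lambda>v. vnorm (n + 3) (\<lambda>i. v i - x i)) ` (F - {x}))"
  have G: "finite G" "G \<noteq> {}" using \<open>finite F\<close> by (simp_all add: G_def)
  have xr: "x \<in> rvecs (n + 3)" using assms(1) by (simp add: asym_dir_def)
  have "v \<in> rvecs (n + 3)" if "v \<in> F" for v
    using that by (auto simp: F_def rvecs_def best_approx_def zvecs_def rv_def)
  then have "0 < g" if "g \<in> G" for g
    using that assms(2) vnorm_diff_pos[OF _ xr] by (auto simp: G_def)
  then have "0 < Min G" using G by simp
  then obtain v where v: "v \<in> best_dirs (n + 3) a" "v \<noteq> x" "vnorm (n + 3) (\<lambda>i. v i - x i) < Min G"
    using assms(1) unfolding asym_dir_def by blast
  have ve: "vnorm (n + 3) (\<lambda>i. v i - x i) < e" using v(3) G by (auto simp: G_def)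
  obtain z where z: "best_approx (n + 3) a z" "v = (\<lambda>i. rv z i / vnorm (n + 3) (rv z))"
    using v(1) unfolding best_dirs_def by blast
  have "\<not> 16 * nrm (rv z) < real (S (k1 + 2))"
  proof
    assume "16 * nrm (rv z) < real (S (k1 + 2))"
    then have "v \<in> F - {x}" using z v(2) by (auto simp: F_def)
    then have "vnorm (n + 3) (\<lambda>i. v i - x i) \<in> G" by (auto simp: G_def)
    then show False using v(3) G(1) Min_le by fastforce
  qed
  then obtain s j where sj: "\<bar>s\<bar> = 1" "k1 < j" "z = (\<lambda>t. s * V j t)"
    using large_best_is_V[OF z(1), of k1] k0 by (auto simp: k1_def)
  have s1: "\<bar>of_int s :: real\<bar> = 1" using sj(1) by linarith
  have vs: "v = (\<lambda>i. of_int s * dir j i)" unfolding z(2) sj(3) sign_dir[OF sj(1)] ..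
  have jm: "2 * m0 + 2 < j" "2 * m1 + 2 < j"
    using sj(2) max.cobounded2[of "2 * max m0 m1 + 2" k0] max.cobounded1[of m0 m1] max.cobounded2[of m1 m0]
    unfolding k1_def by linarith+
  have "\<exists>r<2. vnorm (n + 3) (\<lambda>i. dir j i - Vdir r i) < e"
  proof (cases "odd j")
    case True
    then obtain m where m: "j = 2 * m + 1" by (elim oddE)
    then have "m0 \<le> m" using jm(1) by simp
    then show ?thesis using m0 m by (intro exI[of _ 0]) simp
  next
    case False
    then obtain m' where m': "j = 2 * m'" by (auto elim: evenE)
    then obtain m where m: "m' = Suc m" using sj(2) by (cases m') auto
    then have j: "j = 2 * m + 1 + 1" using m' by simp
    then have "m1 \<le> m" using jm(2) by simp
    then have "vnorm (n + 3) (\<lambda>i. dir j i - Vdir 1 i) < e" using m1 unfolding j by blast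
    then show ?thesis by (intro exI[of _ 1]) simp
  qed
  then obtain r where r: "r < 2" "vnorm (n + 3) (\<lambda>i. dir j i - Vdir r i) < e" by blast
  have "vnorm (n + 3) (\<lambda>i. v i - of_int s * Vdir r i) < e"
    using r(2) vnorm_sign[OF s1, of "\<lambda>i. dir j i - Vdir r i"] by (simp add: vs right_diff_distrib)
  moreover have "vnorm (n + 3) (\<lambda>i. x i - v i) < e"
    using ve vnorm_sign[of "-1" "\<lambda>i. v i - x i"] by simp
  ultimately have "vnorm (n + 3) (\<lambda>i. x i - of_int s * Vdir r i) < 2 * e"
    using vnorm_triangle[of x "\<lambda>i. of_int s * Vdir r i" v] by linarith
  with sj(1) r(1) show ?thesis by blast
qed

text \<open>There are only four candidates; a direction different from all of them would have
  positive distance from each, against \<open>asym_dir_near_Vdir\<close>.\<close>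

lemma asym_dir_iff:
  "asym_dir (n + 3) a x \<longleftrightarrow> (\<exists>(s::int) r. \<bar>s\<bar> = 1 \<and> r < 2 \<and> x = (\<lambda>i. of_int s * Vdir r i))"
proof
  assume x: "asym_dir (n + 3) a x"
  define g where "g = (\<lambda>(s::int) r. vnorm (n + 3) (\<lambda>i. x i - of_int s * Vdir r i))"
  define G where "G = {g 1 0, g (- 1) 0, g 1 1, g (- 1) 1}"
  have G: "finite G" "G \<noteq> {}" by (simp_all add: G_def)
  show "\<exists>(s::int) r. \<bar>s\<bar> = 1 \<and> r < 2 \<and> x = (\<lambda>i. of_int s * Vdir r i)"
  proof (rule ccontr)
    assume no: "\<not> ?thesis"
    have pos: "0 < g s r" if "\<bar>s\<bar> = 1" "r < 2" for s r
      unfolding g_def using no that x Vdir_rvecs[of r]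
      by (intro vnorm_diff_pos) (auto simp: asym_dir_def rvecs_def)
    have "0 < Min G" using G pos by (simp add: G_def)
    then obtain s r where sr: "\<bar>s\<bar> = 1" "r < 2" "g s r < Min G"
      using asym_dir_near_Vdir[OF x, of "Min G / 2"] unfolding g_def by auto
    have "s = 1 \<or> s = - 1" "r = 0 \<or> r = 1" using sr(1,2) by linarith+
    then have "g s r \<in> G" unfolding G_def by blast
    then show False using sr(3) G(1) by (meson Min_le not_le)
  qed
qed (use asym_dir_Vdir in blast)

lemma U_Vdir: "U (Vdir r) j = U (Vlim r) j / vnorm (n + 3) (Vlim r)"
  using U_lincomb[of "1 / vnorm (n + 3) (Vlim r)" "Vlim r" 0 "Vlim r" j] by (simp add: Vdir_def)

text \<open>Which of the two coordinates \<open>n + 1\<close> and \<open>n + 2\<close> of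
  \<open>U\<close> is larger in absolute value does not depend on the sign and differs between the
  two limits.\<close>

lemma Vdir_independent: "Vdir 0 \<noteq> Vdir 1" "Vdir 0 \<noteq> (\<lambda>i. - Vdir 1 i)"
proof -
  have "\<bar>U (Vlim 0) (n + 1) - 1\<bar> \<le> 1 / 8" "\<bar>U (Vlim 0) (n + 2)\<bar> \<le> 1 / 8"
    using U_Vlim[of "n + 1" 0] U_Vlim[of "n + 2" 0] by simp_all
  then have "\<bar>U (Vlim 0) (n + 2)\<bar> < \<bar>U (Vlim 0) (n + 1)\<bar>" by linarith
  then have 0: "\<bar>U (Vdir 0) (n + 2)\<bar> < \<bar>U (Vdir 0) (n + 1)\<bar>"
    using vnorm_Vlim_pos[of 0] by (simp add: U_Vdir divide_strict_right_mono)
  have "\<bar>U (Vlim 1) (n + 1)\<bar> \<le> 1 / 8" "\<bar>U (Vlim 1) (n + 2) - 1\<bar> \<le> 1 / 8"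
    using U_Vlim[of "n + 1" 1] U_Vlim[of "n + 2" 1] by (simp_all add: add_2_eq_Suc')
  then have "\<bar>U (Vlim 1) (n + 1)\<bar> < \<bar>U (Vlim 1) (n + 2)\<bar>" by linarith
  then have 1: "\<bar>U (Vdir 1) (n + 1)\<bar> < \<bar>U (Vdir 1) (n + 2)\<bar>"
    using vnorm_Vlim_pos[of 1] by (simp add: U_Vdir divide_strict_right_mono)
  show "Vdir 0 \<noteq> Vdir 1" using 0 1 by auto
  have "U (\<lambda>i. - Vdir 1 i) j = - U (Vdir 1) j" for j using U_lincomb[of "-1" "Vdir 1" 0 "Vdir 1" j] by simp
  then show "Vdir 0 \<noteq> (\<lambda>i. - Vdir 1 i)" using 0 1 by auto
qed

lemma two_pairs_of_directions:
  "\<exists>u1 u2. u1 \<noteq> u2 \<and> u1 \<noteq> (\<lambda>i. - u2 i) \<and>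
    {x. asym_dir (n + 3) a x} = {u1, (\<lambda>i. - u1 i), u2, (\<lambda>i. - u2 i)}"
proof -
  have s: "\<bar>s\<bar> = 1 \<longleftrightarrow> s = 1 \<or> s = -1" for s :: int by linarith
  have "{x. asym_dir (n + 3) a x} = {Vdir 0, (\<lambda>i. - Vdir 0 i), Vdir 1, (\<lambda>i. - Vdir 1 i)}"
  proof (intro set_eqI)
    fix x
    have "asym_dir (n + 3) a x \<longleftrightarrow> x = (\<lambda>i. of_int 1 * Vdir 0 i) \<or> x = (\<lambda>i. of_int (- 1) * Vdir 0 i) \<or>
        x = (\<lambda>i. of_int 1 * Vdir 1 i) \<or> x = (\<lambda>i. of_int (- 1) * Vdir 1 i)"
      unfolding asym_dir_iff s less_2_cases_iff One_nat_def by blast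
    then show "x \<in> {x. asym_dir (n + 3) a x} \<longleftrightarrow> x \<in> {Vdir 0, (\<lambda>i. - Vdir 0 i), Vdir 1, (\<lambda>i. - Vdir 1 i)}"
      by simp
  qed
  with Vdir_independent show ?thesis by blast
qed

end

theorem theorem2:
  fixes d :: nat and \<beta> :: real
  assumes "d \<ge> 3" and "\<beta> > 0"
  shows "\<exists>a \<in> pi_d d.
    (\<exists>c1 c2. c1 > 0 \<and> c2 > 0 \<and>
      (\<forall>z. best_approx d a z \<longrightarrow>
         c1 * vnorm d (rv z) powr (- f_d d \<beta>)
           \<le> \<bar>Lform d a z\<bar> * vnorm d (rv z) ^ (d - 1) \<and>
         \<bar>Lform d a z\<bar> * vnorm d (rv z) ^ (d - 1)
           \<le> c2 * vnorm d (rv z) powr (- f_d d \<beta>))) \<and>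
    (\<exists>c. c > 0 \<and>
      (\<forall>z \<in> zvecs d. \<not> (\<exists>k::int. \<exists>b. best_approx d a b \<and> z = (\<lambda>i. k * b i)) \<longrightarrow>
         c * vnorm d (rv z) powr (- f_d d \<beta> + (real d - 1) * \<beta>)
           \<le> \<bar>Lform d a z\<bar> * vnorm d (rv z) ^ (d - 1))) \<and>
    (\<exists>u1 u2. u1 \<noteq> u2 \<and> u1 \<noteq> (\<lambda>i. - u2 i) \<and>
      {u. asym_dir d a u} = {u1, (\<lambda>i. - u1 i), u2, (\<lambda>i. - u2 i)})"
proof -
  obtain n where d: "d = n + 3" using assms(1) by (metis add.commute le_Suc_ex)
  obtain S q :: "nat \<Rightarrow> nat" where Sq: "\<And>k. S (Suc k) = q k * S k" "\<And>k. 0 < S k" "n + 8 \<le> q 0"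
    "\<And>k. 2 * q k \<le> q (Suc k)" "\<And>k. real (S k) powr (1 + \<beta>) \<le> real (S (Suc k))"
    "\<And>k. real (S (Suc k)) \<le> 2 * real (S k) powr (1 + \<beta>)"
    using growth_sequence_exists[OF assms(2), where A = "n + 8"] by blast
  interpret cascade n S q
    by unfold_locales (use Sq in auto)
  obtain a where a: "a \<in> pi_d (n + 3)" "\<And>k. chain (\<lambda>i. Lform (n + 3) a (C k i))"
    using chain_form_exists by blast
  interpret cascade_growth n S q a \<beta>
    by unfold_locales (use Sq a assms in auto)
  show ?thesis
    unfolding d using a(1) best_asymptotics_f nonbest_lower_bound two_pairs_of_directions by blast
qed

end
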